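(* Define $\Xi,\mathrm N:(0,\infty)\to\mathbb R$ as follows. For $0<b\le 1$, $$\Xi(b)=\frac{8b^2(7-3b)}{105},\qquad \mathrm N(b)=\frac{4b(28-9b)}{105},$$ and for $b>1$, with $\gamma:=\sqrt{\frac{b-1}{b}}$, $$\Xi(b)=\frac{183\gamma-38b\gamma-88b^2\gamma+112b^2+48b^3\gamma-48b^3-\frac{105\operatorname{acosh}(\sqrt b)}{b}}{210},$$ $$\mathrm N(b)=\frac{\frac{87\gamma}{b}+250\gamma-376b\gamma+448b+144b^2\gamma-144b^2-\frac{105\operatorname{acosh}(\sqrt b)}{b^2}}{420}.$$ Use the endpoint conventions $\Xi(0)=\mathrm N(0)=0$ and $\Xi(\infty)=\mathrm N(\infty)=1$. Let $\mathcal R_{\xi,\nu}:=\{(\xi(C),\nu(C)):C\in\mathcal C\}\subseteq\mathbb R^2$ be the exact $(\xi,\nu)$-region over the set $\mathcal C$ of all bivariate copulas. Then: (1) $\mathcal R_{\xi,\nu}$ is convex and closed, and $$\mathcal R_{\xi,\nu}=\bigl\{(\Xi(b),y)\in\mathbb R^2:\ -\mathrm N(b)\le y\le \mathrm N(b),\ b\in[0,\infty]\bigr\}.$$ (2) The upper and lower curved boundary branches of $\mathcal R_{\xi,\nu}$, namely $\{(\Xi(b),\mathrm N(b)):b>0\}$ and $\{(\Xi(b),-\mathrm N(b)):b>0\}$ (which meet in the limit point $(0,0)$), are traced uniquely by the copula family $(C_b)_{b\in\mathbb R\setminus\{0\}}$: for every $b>0$, $C_b$ is the unique copula with $(\xi(C),\nu(C))=(\Xi(b),\mathrm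 N(b))$, and $C_{-b}$ is the unique copula with $(\xi(C),\nu(C))=(\Xi(b),-\mathrm N(b))$. The remaining boundary of $\mathcal R_{\xi,\nu}$ is the vertical segment $\{(1,y):-1\le y\le 1\}$. (3) $C_1$ maximizes the difference $\nu(C)-\xi(C)$ over all bivariate copulas $C$.
   Context: A (bivariate) copula is a distribution function on $[0,1]^2$ with uniform marginals; $\mathcal C$ is the set of all of them. $\partial_1 C$ denotes the partial derivative of $C$ in its first argument (it exists almost everywhere). Chatterjee's rank correlation of a copula $C$ is $$\xi(C):=6\int_0^1\!\!\int_0^1(\partial_1C(t,v))^2\,\mathrm dt\,\mathrm dv-2,$$ and Blest's rank correlation is $$\nu(C):=24\int_0^1\!\!\int_0^1(1-u)\,C(u,v)\,\mathrm du\,\mathrm dv-2.$$ The family $(C_b)$: write $\operatorname{clamp}(y,\alpha,\beta):=\min\{\max\{y,\alpha\},\beta\}$ for $\alpha<\beta$. For $b>0$ and $v\in[0,1]$ let $q(v)=q_b(v)\in[-1/b,1]$ be the unique number with $\int_0^1\operatorname{clamp}\bigl(b((1-t)^2-q(v)),0,1\bigr)\,\mathrm dt=v$ (existence and uniqueness hold). Put $h_b(t,v):=\operatorname{clamp}\bigl(b((1-t)^2-q(v)),0,1\bigr)$ and $$C_b(u,v):=\int_0^u h_b(t,v)\,\mathrm dt,\qquad (u,v)\in[0,1]^2,\ b>0.$$ For $b<0$ put $C_b(u,v):=u-C_{-b}(u,1-v)$. $\operatorname{acosh}(x)=\log(x+\sqrt{x^2-1})$ for $x\ge1$. *)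

theory Defs
  imports "HOL-Probability.Probability"
begin

(* Only the values of C on the unit square matter; a copula is represented by any
   real function of two real arguments with the right values there. *)
definition copula :: "(real \<Rightarrow> real \<Rightarrow> real) \<Rightarrow> bool" where
  "copula C \<longleftrightarrow>
     (\<exists>M :: (real \<times> real) measure.
        prob_space M \<and> sets M = sets borel \<and>
        distr M borel fst = uniform_measure lborel {0..1} \<and>
        distr M borel snd = uniform_measure lborel {0..1} \<and>
        (\<forall>u\<in>{0..1}. \<forall>v\<in>{0..1}. C u v = measure M ({..u} \<times> {..v})))"

(* The derivative exists for almost every t only; the arbitrary value of deriv at
   the remaining points, and at t = 0 and t = 1, does not affect the integral. *)
definition chatterjee_xi :: "(real \<Rightarrow> real \<Rightarrow> real) \<Rightarrow> real" where
  "chatterjee_xi C =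
     6 * (LINT v:{0..1}|lebesgue. LINT t:{0..1}|lebesgue. (deriv (\<lambda>s. C s v) t)\<^sup>2) - 2"

definition blest_nu :: "(real \<Rightarrow> real \<Rightarrow> real) \<Rightarrow> real" where
  "blest_nu C =
     24 * (LINT v:{0..1}|lebesgue. LINT u:{0..1}|lebesgue. (1 - u) * C u v) - 2"

definition xi_nu_region :: "(real \<times> real) set" where
  "xi_nu_region = {(chatterjee_xi C, blest_nu C) |C. copula C}"

definition clip :: "real \<Rightarrow> real \<Rightarrow> real \<Rightarrow> real" where
  "clip y \<alpha> \<beta> = min (max y \<alpha>) \<beta>"

definition q_shift :: "real \<Rightarrow> real \<Rightarrow> real" where
  "q_shift b v =
     (THE q. q \<in> {-1/b..1} \<and> (LINT t:{0..1}|lebesgue. clip (b * ((1 - t)\<^sup>2 - q)) 0 1) = v)"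

definition h_fam :: "real \<Rightarrow> real \<Rightarrow> real \<Rightarrow> real" where
  "h_fam b t v = clip (b * ((1 - t)\<^sup>2 - q_shift b v)) 0 1"

definition C_pos :: "real \<Rightarrow> real \<Rightarrow> real \<Rightarrow> real" where
  "C_pos b u v = (LINT t:{0..u}|lebesgue. h_fam b t v)"

(* Only meaningful for nonzero b. *)
definition C_fam :: "real \<Rightarrow> real \<Rightarrow> real \<Rightarrow> real" where
  "C_fam b u v = (if b > 0 then C_pos b u v else u - C_pos (-b) u (1 - v))"

definition Xi :: "real \<Rightarrow> real" where
  "Xi b =
     (if b \<le> 1 then 8 * b^2 * (7 - 3 * b) / 105
      else let \<gamma> = sqrt ((b - 1) / b) in
        (183 * \<gamma> - 38 * b * \<gamma> - 88 * b^2 * \<gamma> + 112 * b^2 + 48 * b^3 * \<gamma> - 48 * b^3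
          - 105 * arcosh (sqrt b) / b) / 210)"

definition Nu :: "real \<Rightarrow> real" where
  "Nu b =
     (if b \<le> 1 then 4 * b * (28 - 9 * b) / 105
      else let \<gamma> = sqrt ((b - 1) / b) in
        (87 * \<gamma> / b + 250 * \<gamma> - 376 * b * \<gamma> + 448 * b + 144 * b^2 * \<gamma> - 144 * b^2
          - 105 * arcosh (sqrt b) / b^2) / 420)"

definition Xi_ext :: "ereal \<Rightarrow> real" where
  "Xi_ext b = (if b = 0 then 0 else if b = \<infinity> then 1 else Xi (real_of_ereal b))"

definition Nu_ext :: "ereal \<Rightarrow> real" where
  "Nu_ext b = (if b = 0 then 0 else if b = \<infinity> then 1 else Nu (real_of_ereal b))"

definition upper_branch :: "(real \<times> real) set" where
  "upper_branch = {(Xi b, Nu b) |b. b > 0}"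

definition lower_branch :: "(real \<times> real) set" where
  "lower_branch = {(Xi b, - Nu b) |b. b > 0}"

definition unique_copula_at :: "(real \<Rightarrow> real \<Rightarrow> real) \<Rightarrow> real \<times> real \<Rightarrow> bool" where
  "unique_copula_at C p \<longleftrightarrow>
     copula C \<and> (chatterjee_xi C, blest_nu C) = p \<and>
     (\<forall>D. copula D \<and> (chatterjee_xi D, blest_nu D) = p \<longrightarrow>
        (\<forall>u\<in>{0..1}. \<forall>v\<in>{0..1}. D u v = C u v))"

end

theory Submission
  imports Defs "HOL-Real_Asymp.Real_Asymp"
begin

text \<open>Write \<open>h = \<partial>\<^sub>1 C\<close>. For fixed \<open>v\<close> the section \<open>h(\<cdot>, v)\<close> takes values in \<open>[0, 1]\<close> and has mean \<open>v\<close>, and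
  \<open>\<xi> = 6 \<integral>\<integral> h\<^sup>2 - 2\<close>, \<open>\<nu> = 12 \<integral>\<integral> (1 - t)\<^sup>2 h - 2\<close>. Hence \<open>\<nu> - \<xi> / b\<close> can be maximised
  pointwise in \<open>v\<close>, with \<open>q_shift b v\<close> as the Lagrange multiplier of the mean constraint. The maximiser
  is the clipped kernel of \<open>C_fam b\<close>, and by strong concavity the deficit of any copula is at least
  \<open>(6 / b) \<integral>\<integral> (h - h_b)\<^sup>2\<close>. So each \<open>C_fam b\<close> is the only copula on a supporting line of slope \<open>1 / b\<close>.
  Substituting \<open>v = level b q\<close> turns \<open>\<xi>\<close> and \<open>\<nu>\<close> of \<open>C_fam b\<close> into elementary integrals over \<open>q\<close>.

  Conversely, a copula with \<open>\<nu> = y\<close> and \<open>\<xi> \<le> x \<le> 1\<close> yields the point \<open>(x, y)\<close>: mix it with a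
  deterministic copula, which has \<open>\<xi> = 1\<close>, with the same \<open>\<nu> = y\<close>, and use that \<open>\<xi>\<close> is
  continuous along the mixture.\<close>

section \<open>Densities of copula sections\<close>

text \<open>The weight (1 - t)^2 comes from exchanging the order of integration: the integral of (1
  - u) C(u, v) over u is half the integral of (1 - t)^2 h(t, v) over t. Hence \<nu> - \<xi> / b is,
  up to a constant, 6 times the double integral of 2 (1 - t)^2 h - h^2 / b. After subtracting 2 q h,
  whose mean is fixed, the integrand is maximal at h = b ((1 - t)^2 - q), and 0 <= h <= 1 clips
  this. The obstacle is measurability in v: \<open>section_density\<close> provides a density for
  each v separately, without joint measurability. Integrals over v are therefore taken only of
  quantities determined by C itself, such as \<open>sq_int C\<close> and \<open>wt_int C\<close>.
  Densities are bounded at every point, so no exceptional sets enter the pointwise estimates. The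
  supporting lines also describe the region: it is the part of [0, 1] x [-1, 1] below all these
  lines and above their mirror images, which makes closedness immediate. That these constraints
  suffice rests on the continuity of \<open>Xi\<close> and its limits 0 and 1: every abscissa in (0,
  1) is attained by some \<open>C_fam b\<close>.\<close>

definition section_density :: "(real \<Rightarrow> real) \<Rightarrow> (real \<Rightarrow> real) \<Rightarrow> bool" where
  "section_density f h \<longleftrightarrow>
     h \<in> borel_measurable borel \<and> (\<forall>t. 0 \<le> h t \<and> h t \<le> 1) \<and>
     (\<forall>u\<in>{0..1}. f u = (LINT t:{0..u}|lborel. h t))"

section \<open>Differentiating a primitive almost everywhere\<close>

lemma set_integrable_bounded:
  fixes h :: "real \<Rightarrow> real"
  assumes "h \<in> borel_measurable borel" "\<And>t. t \<in> {a..b} \<Longrightarrow> \<bar>h t\<bar> \<le> B"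
  shows "set_integrable lborel {a..b} h"
  unfolding set_integrable_def
  by (rule integrableI_bounded_set_indicator[where B = B])
     (use assms emeasure_lborel_cbox_finite[of a b] in auto)

text \<open>The intervals start at t, so this controls right-hand difference quotients only.
  Left-hand ones come from applying it to the reflected function.\<close>

lemma AE_right_derivative:
  fixes g :: "real \<Rightarrow> real"
  assumes "\<And>a b. g integrable_on {a..b}"
  shows "AE t in lebesgue. ((\<lambda>s. integral {t..t + s} g / s) \<longlongrightarrow> g t) (at_right 0)"
proof -
  obtain N where N: "negligible N"
    and lim: "\<And>x e. \<lbrakk>x \<notin> N; 0 < e\<rbrakk> \<Longrightarrow>
               \<exists>d>0. \<forall>h. 0 < h \<and> h < d \<longrightarrow>
                         norm(integral (cbox x (x + h *\<^sub>R One)) g /\<^sub>R h ^ DIM(real) - g x) < e"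
    using integrable_ccontinuous_explicit[of g] assms by auto
  have "N \<in> null_sets lebesgue"
    using N by (simp add: negligible_iff_null_sets)
  then show ?thesis
  proof (rule AE_I')
    show "{t \<in> space lebesgue. \<not> ((\<lambda>s. integral {t..t + s} g / s) \<longlongrightarrow> g t) (at_right 0)} \<subseteq> N"
    proof (rule subsetI, rule ccontr)
      fix t assume t: "t \<in> {t \<in> space lebesgue. \<not> ((\<lambda>s. integral {t..t + s} g / s) \<longlongrightarrow> g t) (at_right 0)}"
        and "t \<notin> N"
      have "((\<lambda>s. integral {t..t + s} g / s) \<longlongrightarrow> g t) (at_right 0)"
        unfolding tendsto_iff eventually_at_right_field
      proof (intro allI impI)
        fix e :: real assume "e > 0"
        from lim[OF \<open>t \<notin> N\<close> this] obtain d where "d > 0"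
          "\<forall>h. 0 < h \<and> h < d \<longrightarrow> norm(integral (cbox t (t + h *\<^sub>R One)) g /\<^sub>R h ^ DIM(real) - g t) < e"
          by blast
        then show "\<exists>d>0. \<forall>h>0. h < d \<longrightarrow> dist (integral {t..t + h} g / h) (g t) < e"
          by (auto simp: dist_real_def divide_inverse mult.commute)
      qed
      with t show False by simp
    qed
  qed
qed

text \<open>Reflection preserves Lebesgue null sets. This carries an almost-everywhere statement
  about a reflected function back to the original one.\<close>

lemma AE_lebesgue_uminus:
  assumes "AE t in lebesgue. P (t::real)"
  shows "AE t in lebesgue. P (- t)"
proof -
  from assms have "AE t in lborel. P t"
    by (simp only: AE_completion_iff)
  then obtain N where N: "N \<in> sets lborel" "emeasure lborel N = 0" "{t \<in> space lborel. \<not> P t} \<subseteq> N"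
    by (rule AE_E)
  have "emeasure lborel (uminus -` N) = emeasure (distr lborel borel uminus) N"
    using N by (subst emeasure_distr) auto
  also have "\<dots> = 0"
    using N by (simp add: lborel_distr_uminus)
  finally have "uminus -` N \<in> null_sets lborel"
    using N(1) measurable_sets[of uminus borel borel N] by (auto simp: null_sets_def)
  then have "AE t in lborel. P (- t)"
    by (rule AE_I') (use N(3) in auto)
  then show ?thesis
    by (rule AE_completion)
qed

lemma section_densityD:
  assumes "section_density f h"
  shows "h \<in> borel_measurable borel" "0 \<le> h t" "h t \<le> 1"
    "u \<in> {0..1} \<Longrightarrow> f u = (LINT t:{0..u}|lborel. h t)"
    "set_integrable lborel {a..b} h"
    "h integrable_on {a..b}"
    "u \<in> {0..1} \<Longrightarrow> f u = integral {0..u} h"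
proof -
  show 1: "h \<in> borel_measurable borel" "0 \<le> h t" "h t \<le> 1"
    "u \<in> {0..1} \<Longrightarrow> f u = (LINT t:{0..u}|lborel. h t)" for t u
    using assms by (auto simp: section_density_def)
  show 2: "set_integrable lborel {a..b} h" for a b
    by (rule set_integrable_bounded[where B = 1]) (use 1 in auto)
  show "h integrable_on {a..b}" "u \<in> {0..1} \<Longrightarrow> f u = integral {0..u} h"
    using 1(4) set_borel_integral_eq_integral[OF 2] by auto
qed

lemma section_density_AE_deriv:
  assumes "section_density f h"
  shows "AE t in lebesgue. t \<in> {0<..<1} \<longrightarrow> (f has_real_derivative h t) (at t)"
proof -
  note h = section_densityD[OF assms]
  have right: "AE t in lebesgue. ((\<lambda>s. integral {t..t + s} h / s) \<longlongrightarrow> h t) (at_right 0)"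
    by (rule AE_right_derivative) (use h in auto)
  have "(\<lambda>x. h (- x)) integrable_on {a..b}" for a b
    using h(6)[of "-b" "-a"] Henstock_Kurzweil_Integration.integrable_reflect_real[of h "- a" "- b"] by simp
  then have "AE t in lebesgue. ((\<lambda>s. integral {t..t + s} (\<lambda>x. h (- x)) / s) \<longlongrightarrow> h (- t)) (at_right 0)"
    by (rule AE_right_derivative)
  from AE_lebesgue_uminus[OF this]
  have left: "AE t in lebesgue. ((\<lambda>s. integral {t - s..t} h / s) \<longlongrightarrow> h t) (at_right 0)"
  proof eventually_elim
    case (elim t)
    have "integral {- t..- t + s} (\<lambda>x. h (- x)) = integral {t - s..t} h" for s
      using Henstock_Kurzweil_Integration.integral_reflect_real[of "t - s" t h] Henstock_Kurzweil_Integration.integral_reflect_real[of t "t - s" h] by simp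
    with elim show ?case by simp
  qed
  from right left show ?thesis
  proof eventually_elim
    case (elim t)
    show ?case
    proof
      assume t: "t \<in> {0<..<1}"
      have R: "((\<lambda>s. (f (t + s) - f t) / s) \<longlongrightarrow> h t) (at_right 0)"
      proof (rule Lim_transform_eventually[OF elim(1)])
        show "\<forall>\<^sub>F s in at_right 0. integral {t..t + s} h / s = (f (t + s) - f t) / s"
          unfolding eventually_at_right_field
        proof (intro exI[of _ "1 - t"] conjI allI impI)
          fix s assume "0 < s" "s < 1 - t"
          then show "integral {t..t + s} h / s = (f (t + s) - f t) / s"
            using t h(7)[of t] h(7)[of "t + s"] Henstock_Kurzweil_Integration.integral_combine[OF _ _ h(6)[of 0 "t + s"], of t]
            by auto
        qed (use t in auto)
      qed
      have L: "((\<lambda>s. (f (t - s) - f t) / (- s)) \<longlongrightarrow> h t) (at_right 0)"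
      proof (rule Lim_transform_eventually[OF elim(2)])
        show "\<forall>\<^sub>F s in at_right 0. integral {t - s..t} h / s = (f (t - s) - f t) / (- s)"
          unfolding eventually_at_right_field
        proof (intro exI[of _ t] conjI allI impI)
          fix s assume "0 < s" "s < t"
          then show "integral {t - s..t} h / s = (f (t - s) - f t) / (- s)"
            using t h(7)[of t] h(7)[of "t - s"] Henstock_Kurzweil_Integration.integral_combine[OF _ _ h(6)[of 0 "t"], of "t - s"]
            by (auto simp: field_simps)
        qed (use t in auto)
      qed
      show "(f has_real_derivative h t) (at t)"
        unfolding DERIV_def filterlim_at_split
        using R L by (simp add: filterlim_at_left_to_right)
    qed
  qed
qed

text \<open>Bridges the definitions, which integrate a derivative with arbitrary values on a null
  set against \<open>lebesgue\<close>, to Borel functions on \<open>lborel\<close>. The endpoints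
  form a null set, so nothing is asked of \<open>f\<close> there, and completeness of
  \<open>lebesgue\<close> makes \<open>f\<close> measurable although it only agrees almost
  everywhere with a Borel function.\<close>

lemma set_integral_lebesgue_eq_lborel:
  fixes f g :: "real \<Rightarrow> real"
  assumes g: "g \<in> borel_measurable borel" and ae: "AE t in lebesgue. t \<in> {a<..<b} \<longrightarrow> f t = g t"
  shows "(LINT t:{a..b}|lebesgue. f t) = (LINT t:{a..b}|lborel. g t)"
    and "set_borel_measurable lebesgue {a..b} f"
proof -
  have "AE t in lborel. t \<notin> {a, b}"
    by (rule AE_not_in) (simp add: finite_imp_null_set_lborel)
  then have "AE t in lebesgue. t \<notin> {a, b}"
    by (rule AE_completion)
  with ae have *: "AE t in lebesgue. indicator {a..b} t *\<^sub>R f t = indicator {a..b} t *\<^sub>R g t"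
    by eventually_elim (auto simp: indicator_def)
  have gm: "(\<lambda>t. indicator {a..b} t *\<^sub>R g t) \<in> borel_measurable lborel"
    using g by simp
  then have gm': "(\<lambda>t. indicator {a..b} t *\<^sub>R g t) \<in> borel_measurable lebesgue"
    by (rule measurable_completion)
  have fm: "(\<lambda>t. indicator {a..b} t *\<^sub>R f t) \<in> borel_measurable lebesgue"
    by (rule borel_measurable_AE[OF gm']) (use * in \<open>auto elim: eventually_mono\<close>)
  show "(LINT t:{a..b}|lebesgue. f t) = (LINT t:{a..b}|lborel. g t)"
    unfolding set_lebesgue_integral_def
    by (subst integral_cong_AE[OF fm gm' *]) (rule integral_completion[OF gm])
  show "set_borel_measurable lebesgue {a..b} f"
    using fm by (simp add: set_borel_measurable_def)
qed

text \<open>The first identity is Lebesgue differentiation. The second writes f(u) as the integral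
  of h over [0, u] and swaps the integrals over the triangle t <= u <= 1; the inner integral of 1 -
  u over [t, 1] is (1 - t)^2 / 2.\<close>

lemma section_density_integrals:
  assumes "section_density f h"
  shows "(LINT t:{0..1}|lebesgue. (deriv f t)\<^sup>2) = (LINT t:{0..1}|lborel. (h t)\<^sup>2)"
    and "(LINT u:{0..1}|lebesgue. (1 - u) * f u) = (LINT t:{0..1}|lborel. (1 - t)\<^sup>2 * h t) / 2"
proof -
  note h = section_densityD[OF assms]
  have [measurable]: "h \<in> borel_measurable borel" by (rule h)
  show "(LINT t:{0..1}|lebesgue. (deriv f t)\<^sup>2) = (LINT t:{0..1}|lborel. (h t)\<^sup>2)"
  proof (rule set_integral_lebesgue_eq_lborel)
    show "AE t in lebesgue. t \<in> {0<..<1} \<longrightarrow> (deriv f t)\<^sup>2 = (h t)\<^sup>2"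
      using section_density_AE_deriv[OF assms] by eventually_elim (auto dest: DERIV_imp_deriv)
  qed simp
  define k where "k = (\<lambda>t u. indicator {0..1} u * indicator {0..u} t * (1 - u) * h t)"
  \<comment> \<open>Membership is rewritten as inequalities in the pair, which makes joint
    measurability evident.\<close>
  have k_if: "case_prod k =
      (\<lambda>z. if 0 \<le> snd z \<and> snd z \<le> 1 \<and> 0 \<le> fst z \<and> fst z \<le> snd z then (1 - snd z) * h (fst z) else 0)"
    by (auto simp: k_def indicator_def fun_eq_iff)
  have [measurable]: "case_prod k \<in> borel_measurable (lborel \<Otimes>\<^sub>M lborel)"
    unfolding k_if by measurable
  have int: "integrable (lborel \<Otimes>\<^sub>M lborel) (case_prod k)"
  proof (rule integrableI_bounded_set)
    show "emeasure (lborel \<Otimes>\<^sub>M lborel) ({0..1::real} \<times> {0..1::real}) < \<infinity>"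
      by (simp add: lborel.emeasure_pair_measure_Times)
    show "AE x in lborel \<Otimes>\<^sub>M lborel. x \<in> {0..1} \<times> {0..1} \<longrightarrow> norm (case_prod k x) \<le> 1"
    proof (rule AE_I2, rule impI)
      fix x :: "real \<times> real" assume "x \<in> {0..1} \<times> {0..1}"
      moreover obtain t u where x: "x = (t, u)" by (cases x)
      ultimately have "0 \<le> (1 - u) * h t" "(1 - u) * h t \<le> 1"
        using h(2,3)[of t] by (auto intro: mult_le_one)
      then show "norm (case_prod k x) \<le> 1"
        by (auto simp: k_def x indicator_def)
    qed
    show "AE x in lborel \<Otimes>\<^sub>M lborel. x \<notin> {0..1} \<times> {0..1} \<longrightarrow> case_prod k x = 0"
      by (rule AE_I2) (auto simp: k_def indicator_def)
  qed (simp_all add: borel_prod)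
  have "(LINT u:{0..1}|lebesgue. (1 - u) * f u) = (LINT u:{0..1}|lborel. (LINT t|lborel. k t u))"
  proof (rule set_integral_lebesgue_eq_lborel)
    show "AE u in lebesgue. u \<in> {0<..<1} \<longrightarrow> (1 - u) * f u = (LINT t|lborel. k t u)"
    proof (rule AE_I2, rule impI)
      fix u :: real assume u: "u \<in> {0<..<1}"
      then have "(1 - u) * f u = (1 - u) * (LINT t:{0..u}|lborel. h t)"
        using h(4)[of u] by simp
      also have "\<dots> = (LINT t|lborel. k t u)"
        unfolding set_lebesgue_integral_def k_def using u
        by (subst integral_mult_right_zero[symmetric])
          (intro Bochner_Integration.integral_cong, auto simp: indicator_def)
      finally show "(1 - u) * f u = (LINT t|lborel. k t u)" .
    qed
  qed measurable
  also have "\<dots> = (LINT u|lborel. (LINT t|lborel. k t u))"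
    unfolding set_lebesgue_integral_def
    by (intro Bochner_Integration.integral_cong) (auto simp: k_def indicator_def)
  also have "\<dots> = (LINT t|lborel. (LINT u|lborel. k t u))"
    by (rule lborel_pair.Fubini_integral[OF int])
  also have "\<dots> = (LINT t:{0..1}|lborel. (1 - t)\<^sup>2 * h t / 2)"
    unfolding set_lebesgue_integral_def
  proof (intro Bochner_Integration.integral_cong refl)
    fix t :: real
    show "(LINT u|lborel. k t u) = indicator {0..1} t *\<^sub>R ((1 - t)\<^sup>2 * h t / 2)"
    proof (cases "t \<in> {0..1}")
      case True
      have "(LINT u|lborel. k t u) = (LINT u:{t..1}|lborel. h t * (1 - u))"
        unfolding set_lebesgue_integral_def using True
        by (intro Bochner_Integration.integral_cong) (auto simp: k_def indicator_def)
      also have "\<dots> = h t * (LINT u:{t..1}|lborel. (1 - u))"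
        by simp
      also have "(LINT u:{t..1}|lborel. (1 - u)) = (1 - t)\<^sup>2 / 2"
      proof -
        have "(LINT u|lborel. (1 - u) * indicator {t..1} u) = - ((1 - 1)\<^sup>2 / 2) - - ((1 - t)\<^sup>2 / 2)"
          by (rule integral_FTC_Icc_real) (use True in \<open>auto intro!: derivative_eq_intros continuous_intros simp: field_simps\<close>)
        then show ?thesis by (simp add: set_lebesgue_integral_def mult.commute)
      qed
      finally show ?thesis using True by simp
    next
      case False
      then have "k t u = 0" for u by (auto simp: k_def indicator_def)
      with False show ?thesis by simp
    qed
  qed
  also have "\<dots> = (LINT t:{0..1}|lborel. (1 - t)\<^sup>2 * h t) / 2"
    by simp
  finally show "(LINT u:{0..1}|lebesgue. (1 - u) * f u) = (LINT t:{0..1}|lborel. (1 - t)\<^sup>2 * h t) / 2" .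
qed

section \<open>Copulas as probability measures on the plane\<close>

lemma copula_measureE:
  assumes "copula C"
  obtains M :: "(real \<times> real) measure" where "prob_space M" "sets M = sets borel"
    "\<And>u v. \<lbrakk>u \<in> {0..1}; v \<in> {0..1}\<rbrakk> \<Longrightarrow> C u v = measure M ({..u} \<times> {..v})"
    "\<And>A. A \<in> sets borel \<Longrightarrow> measure M (A \<times> UNIV) = measure lborel (A \<inter> {0..1})"
    "\<And>A. A \<in> sets borel \<Longrightarrow> measure M (UNIV \<times> A) = measure lborel (A \<inter> {0..1})"
proof -
  obtain M :: "(real \<times> real) measure" where M: "prob_space M" "sets M = sets borel"
      "distr M borel fst = uniform_measure lborel {0..1}"
      "distr M borel snd = uniform_measure lborel {0..1}"
      "\<forall>u\<in>{0..1}. \<forall>v\<in>{0..1}. C u v = measure M ({..u} \<times> {..v})"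
    using assms by (auto simp: copula_def)
  have sp: "space M = UNIV"
    using sets_eq_imp_space_eq[OF M(2)] by simp
  have mb: "fst \<in> measurable M borel" "snd \<in> measurable M borel"
    by (simp_all add: measurable_cong_sets[OF M(2) refl] borel_prod[symmetric])
  have unif: "measure (uniform_measure lborel {0..1}) A = measure lborel (A \<inter> {0..1::real})"
    if "A \<in> sets borel" for A
    using that by (simp add: measure_uniform_measure Int_commute)
  show thesis
  proof (rule that[OF M(1,2)])
    fix A :: "real set" assume A: "A \<in> sets borel"
    have "measure M (A \<times> UNIV) = measure (distr M borel fst) A"
      using A by (subst measure_distr[OF mb(1)]) (auto simp: sp intro: arg_cong[where f = "measure M"])
    then show "measure M (A \<times> UNIV) = measure lborel (A \<inter> {0..1})"
      using unif[OF A] M(3) by simp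
    have "measure M (UNIV \<times> A) = measure (distr M borel snd) A"
      using A by (subst measure_distr[OF mb(2)]) (auto simp: sp intro: arg_cong[where f = "measure M"])
    then show "measure M (UNIV \<times> A) = measure lborel (A \<inter> {0..1})"
      using unif[OF A] M(4) by simp
  qed (use M(5) in auto)
qed

text \<open>A distribution on the line is determined by its distribution function. Prescribing it on
  [0, 1] suffices: by monotonicity the values 0 at 0 and 1 at 1 force it to be constant on either
  side.\<close>

lemma uniform_measure_unique:
  assumes "real_distribution N" "\<And>u. u \<in> {0..1} \<Longrightarrow> measure N {..u} = u"
  shows "N = uniform_measure lborel {0..1}"
proof (rule cdf_unique)
  interpret N: real_distribution N by fact
  show "real_distribution N" by fact
  have "prob_space (uniform_measure lborel {0..1::real})"
    by (rule prob_space_uniform_measure) auto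
  then show "real_distribution (uniform_measure lborel {0..1::real})"
    by (auto simp: real_distribution_def real_distribution_axioms_def)
  show "cdf N = cdf (uniform_measure lborel {0..1})"
  proof
    fix x :: real
    have U: "measure (uniform_measure lborel {0..1}) {..x} = measure lborel ({..x} \<inter> {0..1})"
      by (simp add: measure_uniform_measure Int_commute)
    consider "x < 0" | "x \<in> {0..1}" | "x > 1" by force
    then show "cdf N x = cdf (uniform_measure lborel {0..1}) x"
    proof cases
      case 1
      have "measure N {..x} \<le> measure N {..0}"
        using 1 by (intro N.finite_measure_mono) auto
      then have "measure N {..x} = 0"
        using assms(2)[of 0] measure_nonneg[of N "{..x}"] by simp
      moreover have "{..x} \<inter> {0..1} = {}" using 1 by auto
      ultimately show ?thesis by (simp add: cdf_def U)
    next
      case 2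
      then have "{..x} \<inter> {0..1} = {0..x}" by auto
      with 2 assms(2)[OF 2] show ?thesis by (simp add: cdf_def U)
    next
      case 3
      have "measure N {..1} \<le> measure N {..x}"
        using 3 by (intro N.finite_measure_mono) auto
      then have "measure N {..x} = 1"
        using assms(2)[of 1] N.prob_le_1[of "{..x}"] by simp
      moreover have "{..x} \<inter> {0..1} = {0..1}" using 3 by auto
      ultimately show ?thesis by (simp add: cdf_def U)
    qed
  qed
qed

lemma copulaI:
  fixes M :: "(real \<times> real) measure"
  assumes "prob_space M" "sets M = sets borel"
    "\<And>u. u \<in> {0..1} \<Longrightarrow> measure M ({..u} \<times> UNIV) = u"
    "\<And>v. v \<in> {0..1} \<Longrightarrow> measure M (UNIV \<times> {..v}) = v"
    "\<And>u v. \<lbrakk>u \<in> {0..1}; v \<in> {0..1}\<rbrakk> \<Longrightarrow> C u v = measure M ({..u} \<times> {..v})"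
  shows "copula C"
  unfolding copula_def
proof (intro exI conjI ballI)
  interpret prob_space M by fact
  have sp: "space M = UNIV"
    using sets_eq_imp_space_eq[OF assms(2)] by simp
  have mb: "fst \<in> measurable M borel" "snd \<in> measurable M borel"
    by (simp_all add: measurable_cong_sets[OF assms(2) refl] borel_prod[symmetric])
  show "distr M borel fst = uniform_measure lborel {0..1}"
  proof (rule uniform_measure_unique)
    show "real_distribution (distr M borel fst)"
      using prob_space_distr[OF mb(1)] by (auto simp: real_distribution_def real_distribution_axioms_def)
    fix u :: real assume "u \<in> {0..1}"
    moreover have "fst -` {..u} \<inter> space M = {..u} \<times> UNIV" by (auto simp: sp)
    ultimately show "measure (distr M borel fst) {..u} = u"
      using assms(3) by (simp add: measure_distr[OF mb(1)])
  qed
  show "distr M borel snd = uniform_measure lborel {0..1}"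
  proof (rule uniform_measure_unique)
    show "real_distribution (distr M borel snd)"
      using prob_space_distr[OF mb(2)] by (auto simp: real_distribution_def real_distribution_axioms_def)
    fix v :: real assume "v \<in> {0..1}"
    moreover have "snd -` {..v} \<inter> space M = UNIV \<times> {..v}" by (auto simp: sp)
    ultimately show "measure (distr M borel snd) {..v} = v"
      using assms(4) by (simp add: measure_distr[OF mb(2)])
  qed
qed (use assms in auto)

text \<open>\<open>C\<close> is meaningful only on the unit square; \<open>G\<close> is the
  distribution function of the underlying measure on the whole plane. Its increments are bounded by
  masses of strips, hence by the uniform margins. The difference quotients and continuity arguments
  below draw on its joint measurability and Lipschitz bounds.\<close>

lemma copula_extend:
  assumes "copula C"
  obtains G :: "real \<Rightarrow> real \<Rightarrow> real" where
    "case_prod G \<in> borel_measurable borel"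
    "\<And>u v. \<lbrakk>u \<in> {0..1}; v \<in> {0..1}\<rbrakk> \<Longrightarrow> C u v = G u v"
    "\<And>u u' v. u \<le> u' \<Longrightarrow> 0 \<le> G u' v - G u v \<and> G u' v - G u v \<le> u' - u"
    "\<And>u v v'. v \<le> v' \<Longrightarrow> 0 \<le> G u v' - G u v \<and> G u v' - G u v \<le> v' - v"
proof -
  obtain M where M: "prob_space M" "sets M = sets borel"
    "\<And>u v. \<lbrakk>u \<in> {0..1}; v \<in> {0..1}\<rbrakk> \<Longrightarrow> C u v = measure M ({..u} \<times> {..v})"
    "\<And>A. A \<in> sets borel \<Longrightarrow> measure M (A \<times> UNIV) = measure lborel (A \<inter> {0..1})"
    "\<And>A. A \<in> sets borel \<Longrightarrow> measure M (UNIV \<times> A) = measure lborel (A \<inter> {0..1})"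
    using copula_measureE[OF assms] by blast
  interpret prob_space M by fact
  have sp: "space M = UNIV"
    using sets_eq_imp_space_eq[OF M(2)] by simp
  note M(2)[measurable_cong]
  have S: "A \<times> B \<in> sets M" if "A \<in> sets borel" "B \<in> sets borel" for A B :: "real set"
    using that by (simp add: M(2) borel_prod[symmetric])
  have len: "measure lborel ({x<..y} \<inter> {0..1}) \<le> y - x" if "x \<le> y" for x y :: real
  proof -
    have "measure lborel ({x<..y} \<inter> {0..1}) \<le> measure lborel {x<..y}"
      by (rule measure_mono_fmeasurable) (use that in \<open>auto simp: fmeasurable_def\<close>)
    then show ?thesis using that by simp
  qed
  define G where "G = (\<lambda>u v. measure M ({..u} \<times> {..v}))"
  show thesis
  proof (rule that[of G])
    have [measurable]: "fst \<in> borel_measurable (borel :: (real \<times> real) measure)"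
      "snd \<in> borel_measurable (borel :: (real \<times> real) measure)"
      by (simp_all add: borel_prod[symmetric])
    \<comment> \<open>Joint measurability: the value of \<open>G\<close> at p is an integral over z
      of a function measurable in p and z together.\<close>
    have "(\<lambda>p. \<integral>z. (if fst z \<le> fst p \<and> snd z \<le> snd p then 1 else 0 :: real) \<partial>M)
        \<in> borel_measurable (borel :: (real \<times> real) measure)"
      by (rule borel_measurable_lebesgue_integral) measurable
    also have "(\<lambda>p. \<integral>z. (if fst z \<le> fst p \<and> snd z \<le> snd p then 1 else 0 :: real) \<partial>M) = case_prod G"
    proof
      fix p :: "real \<times> real"
      have "(\<integral>z. (if fst z \<le> fst p \<and> snd z \<le> snd p then 1 else 0 :: real) \<partial>M) =
          (\<integral>z. indicator ({..fst p} \<times> {..snd p}) z \<partial>M)"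
        by (intro Bochner_Integration.integral_cong) (auto simp: indicator_def)
      then show "(\<integral>z. (if fst z \<le> fst p \<and> snd z \<le> snd p then 1 else 0 :: real) \<partial>M) = case_prod G p"
        by (simp add: G_def sp case_prod_beta)
    qed
    finally show "case_prod G \<in> borel_measurable borel" .
    show "C u v = G u v" if "u \<in> {0..1}" "v \<in> {0..1}" for u v
      using that M(3) by (simp add: G_def)
    show "0 \<le> G u' v - G u v \<and> G u' v - G u v \<le> u' - u" if "u \<le> u'" for u u' v
    proof -
      have "G u' v - G u v = measure M ({..u'} \<times> {..v} - {..u} \<times> {..v})"
        unfolding G_def using that by (subst finite_measure_Diff) (auto intro!: S)
      moreover have "measure M ({..u'} \<times> {..v} - {..u} \<times> {..v}) \<le> measure M ({u<..u'} \<times> UNIV)"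
        by (rule finite_measure_mono) (auto intro!: S)
      ultimately show ?thesis
        using len[OF that] M(4)[of "{u<..u'}"] by simp
    qed
    show "0 \<le> G u v' - G u v \<and> G u v' - G u v \<le> v' - v" if "v \<le> v'" for u v v'
    proof -
      have "G u v' - G u v = measure M ({..u} \<times> {..v'} - {..u} \<times> {..v})"
        unfolding G_def using that by (subst finite_measure_Diff) (auto intro!: S)
      moreover have "measure M ({..u} \<times> {..v'} - {..u} \<times> {..v}) \<le> measure M (UNIV \<times> {v<..v'})"
        by (rule finite_measure_mono) (auto intro!: S)
      ultimately show ?thesis
        using len[OF that] M(5)[of "{v<..v'}"] by simp
    qed
  qed
qed

text \<open>On the set \<open>S\<close> where f exceeds the indicator, the integral of f is at most
  that of the indicator, so the positive difference integrates to 0 and \<open>S\<close> is null.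
  The integral of the indicator is finite, which the subtraction in \<open>ennreal\<close>
  requires.\<close>

lemma density_le_uniform:
  fixes f :: "real \<Rightarrow> ennreal"
  assumes [measurable]: "f \<in> borel_measurable borel"
    and le: "\<And>A. A \<in> sets borel \<Longrightarrow> emeasure (density lborel f) A \<le> emeasure lborel (A \<inter> {0..1})"
  shows "AE x in lborel. f x \<le> indicator {0..1} x"
proof -
  define S where "S = {x. indicator {0..1} x < f x}"
  have [measurable]: "S \<in> sets borel" unfolding S_def by measurable
  have "(\<integral>\<^sup>+x. f x * indicator S x \<partial>lborel) \<le> emeasure lborel (S \<inter> {0..1})"
    using le[of S] by (simp add: emeasure_density)
  also have "\<dots> = (\<integral>\<^sup>+x. indicator (S \<inter> {0..1}) x \<partial>lborel)"
    by simp
  also have "\<dots> = (\<integral>\<^sup>+x. indicator {0..1} x * indicator S x \<partial>lborel)"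
    by (rule nn_integral_cong) (auto simp: indicator_def)
  finally have *: "(\<integral>\<^sup>+x. f x * indicator S x \<partial>lborel) \<le> (\<integral>\<^sup>+x. indicator {0..1} x * indicator S x \<partial>lborel)" .
  have fin: "(\<integral>\<^sup>+x. indicator {0..1} x * indicator S x \<partial>lborel) < \<infinity>"
  proof -
    have "(\<integral>\<^sup>+x. indicator {0..1} x * indicator S x \<partial>lborel) \<le> (\<integral>\<^sup>+x. indicator {0..1::real} x \<partial>lborel)"
      by (intro nn_integral_mono) (auto simp: indicator_def)
    then show ?thesis by (auto simp: top_unique less_top[symmetric])
  qed
  have "(\<integral>\<^sup>+x. f x * indicator S x - indicator {0..1} x * indicator S x \<partial>lborel) =
        (\<integral>\<^sup>+x. f x * indicator S x \<partial>lborel) - (\<integral>\<^sup>+x. indicator {0..1} x * indicator S x \<partial>lborel)"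
    by (rule nn_integral_diff) (use fin in \<open>auto simp: S_def indicator_def intro!: AE_I2\<close>)
  also have "\<dots> = 0"
    by (rule diff_eq_0_ennreal[OF le_less_trans[OF * fin[unfolded infinity_ennreal_def]] *])
  finally have "AE x in lborel. f x * indicator S x - indicator {0..1} x * indicator S x = 0"
    by (subst (asm) nn_integral_0_iff_AE) auto
  then show ?thesis
  proof eventually_elim
    case (elim x)
    have "f x * indicator S x \<le> indicator {0..1} x * indicator S x"
      using elim by (rule ennreal_minus_eq_0)
    then show ?case
      by (cases "x \<in> S") (auto simp: S_def)
  qed
qed

text \<open>For fixed v the measure sending A to M(A x (-\<infinity>, v]) is dominated by the first
  margin, hence by Lebesgue measure on [0, 1]; its Radon-Nikodym density is therefore at most 1
  almost everywhere.\<close>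

lemma copula_section_density:
  assumes "copula C" "v \<in> {0..1}"
  obtains h where "section_density (\<lambda>u. C u v) h"
proof -
  obtain M where M: "prob_space M" "sets M = sets borel"
    "\<And>u v. \<lbrakk>u \<in> {0..1}; v \<in> {0..1}\<rbrakk> \<Longrightarrow> C u v = measure M ({..u} \<times> {..v})"
    "\<And>A. A \<in> sets borel \<Longrightarrow> measure M (A \<times> UNIV) = measure lborel (A \<inter> {0..1})"
    "\<And>A. A \<in> sets borel \<Longrightarrow> measure M (UNIV \<times> A) = measure lborel (A \<inter> {0..1})"
    using copula_measureE[OF assms(1)] by blast
  interpret prob_space M by fact
  have sp: "space M = UNIV"
    using sets_eq_imp_space_eq[OF M(2)] by simp
  note M(2)[measurable_cong]
  have S: "A \<times> B \<in> sets M" if "A \<in> sets borel" "B \<in> sets borel" for A B :: "real set"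
    using that by (simp add: M(2) borel_prod[symmetric])
  define N where "N = distr (density M (indicator (UNIV \<times> {..v}))) borel fst"
  have Uv: "UNIV \<times> {..v} \<in> sets M" by (rule S) auto
  have fin: "emeasure lborel (A \<inter> {0..1}) \<noteq> \<infinity>" if "A \<in> sets borel" for A :: "real set"
  proof -
    have "emeasure lborel (A \<inter> {0..1}) \<le> emeasure lborel {0..1::real}"
      by (rule emeasure_mono) auto
    then show ?thesis by (auto simp: top_unique)
  qed
  have NA: "emeasure N A = emeasure M (A \<times> {..v})" if "A \<in> sets borel" for A
  proof -
    have "fst \<in> measurable (density M (indicator (UNIV \<times> {..v}))) borel"
      by (simp add: measurable_cong_sets[OF M(2) refl] borel_prod[symmetric])
    then have "emeasure N A = emeasure (density M (indicator (UNIV \<times> {..v}))) (A \<times> UNIV)"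
      unfolding N_def using that
      by (subst emeasure_distr) (auto simp: sp intro!: arg_cong2[where f = emeasure])
    also have "\<dots> = (\<integral>\<^sup>+x. indicator (UNIV \<times> {..v}) x * indicator (A \<times> UNIV) x \<partial>M)"
      using that Uv by (intro emeasure_density) (auto intro!: S)
    also have "\<dots> = (\<integral>\<^sup>+x. indicator (A \<times> {..v}) x \<partial>M)"
      by (intro nn_integral_cong) (auto simp: indicator_def)
    also have "\<dots> = emeasure M (A \<times> {..v})"
      using that by (intro nn_integral_indicator) (auto intro!: S)
    finally show ?thesis .
  qed
  have Nle: "emeasure N A \<le> emeasure lborel (A \<inter> {0..1})" if A: "A \<in> sets borel" for A
  proof -
    have "emeasure N A \<le> emeasure M (A \<times> UNIV)"
      unfolding NA[OF A] by (rule emeasure_mono) (auto intro!: S A)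
    also have "\<dots> = ennreal (measure lborel (A \<inter> {0..1}))"
      by (simp add: emeasure_eq_measure M(4)[OF A])
    also have "\<dots> = emeasure lborel (A \<inter> {0..1})"
      using fin[OF A] by (simp add: emeasure_eq_ennreal_measure)
    finally show ?thesis .
  qed
  have "absolutely_continuous lborel N"
    unfolding absolutely_continuous_def
  proof
    fix A assume "A \<in> null_sets (lborel :: real measure)"
    then have A: "A \<in> sets borel" "emeasure lborel A = 0" by (auto simp: null_sets_def)
    have "emeasure N A \<le> emeasure lborel A"
      using Nle[OF A(1)] emeasure_mono[of "A \<inter> {0..1}" A lborel] A by simp
    then show "A \<in> null_sets N" using A by (auto simp: N_def null_sets_def)
  qed
  moreover have "sets N = sets lborel" by (simp add: N_def)
  ultimately obtain f where f: "f \<in> borel_measurable lborel" "density lborel f = N"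
    using sigma_finite_measure.Radon_Nikodym[OF sigma_finite_lborel] by blast
  have f1: "AE x in lborel. f x \<le> indicator {0..1} x"
    by (rule density_le_uniform) (use f Nle in auto)
  \<comment> \<open>Truncating at 1 changes \<open>f\<close> on a null set only and makes the bounds
    hold at every point.\<close>
  define h where "h = (\<lambda>x. enn2real (min (f x) 1))"
  have fh: "AE x in lborel. f x = ennreal (h x)"
    using f1
  proof eventually_elim
    case (elim x)
    moreover have "indicator {0..1} x \<le> (1 :: ennreal)" by (simp add: indicator_def)
    ultimately have "f x \<le> 1" by (rule order_trans)
    then have "f x < top"
      using ennreal_one_less_top by (rule le_less_trans)
    with \<open>f x \<le> 1\<close> show ?case
      by (simp add: h_def min_absorb1 ennreal_enn2real)
  qed
  have "section_density (\<lambda>u. C u v) h"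
    unfolding section_density_def
  proof (intro conjI allI ballI)
    show hm: "h \<in> borel_measurable borel"
      using f(1) unfolding h_def by simp
    fix t show h0: "0 \<le> h t" for t by (simp add: h_def)
    show "h t \<le> 1"
      unfolding h_def by (rule enn2real_leI) auto
    fix u :: real assume u: "u \<in> {0..1}"
    have "ennreal (C u v) = emeasure M ({..u} \<times> {..v})"
      by (simp add: M(3)[OF u assms(2)] emeasure_eq_measure)
    also have "\<dots> = emeasure N {..u}" by (simp add: NA)
    also have "\<dots> = (\<integral>\<^sup>+x. f x * indicator {..u} x \<partial>lborel)"
      using f by (simp flip: f(2) add: emeasure_density)
    also have "\<dots> = (\<integral>\<^sup>+x. ennreal (indicator {0..u} x *\<^sub>R h x) \<partial>lborel)"
    proof (rule nn_integral_cong_AE)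
      show "AE x in lborel. f x * indicator {..u} x = ennreal (indicator {0..u} x *\<^sub>R h x)"
        using f1 fh by eventually_elim (use u in \<open>auto simp: indicator_def split: if_splits\<close>)
    qed
    finally have "ennreal (C u v) = (\<integral>\<^sup>+x. ennreal (indicator {0..u} x *\<^sub>R h x) \<partial>lborel)" .
    then have "(LINT t:{0..u}|lborel. h t) = enn2real (ennreal (C u v))"
      unfolding set_lebesgue_integral_def using hm h0
      by (subst integral_eq_nn_integral) auto
    then show "C u v = (LINT t:{0..u}|lborel. h t)"
      by (simp add: M(3)[OF u assms(2)])
  qed
  then show thesis by (rule that)
qed

lemma copula_margins:
  assumes "copula C" "x \<in> {0..1}"
  shows "C 0 x = 0" "C 1 x = x" "C x 0 = 0" "C x 1 = x"
proof -
  obtain M where M: "prob_space M" "sets M = sets borel"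
    "\<And>u v. \<lbrakk>u \<in> {0..1}; v \<in> {0..1}\<rbrakk> \<Longrightarrow> C u v = measure M ({..u} \<times> {..v})"
    "\<And>A. A \<in> sets borel \<Longrightarrow> measure M (A \<times> UNIV) = measure lborel (A \<inter> {0..1})"
    "\<And>A. A \<in> sets borel \<Longrightarrow> measure M (UNIV \<times> A) = measure lborel (A \<inter> {0..1})"
    using copula_measureE[OF assms(1)] by blast
  interpret prob_space M by fact
  have S: "A \<times> B \<in> sets M" if "A \<in> sets borel" "B \<in> sets borel" for A B :: "real set"
    using that by (simp add: M(2) borel_prod[symmetric])
  have i: "{..0} \<inter> {0..1} = {0::real}" "{..x} \<inter> {0..1} = {0..x}" "{1<..} \<inter> {0..1::real} = {}"
    using assms(2) by auto
  have "measure M ({..0} \<times> {..x}) \<le> measure M ({..0} \<times> UNIV)" "measure M ({..x} \<times> {..0}) \<le> measure M (UNIV \<times> {..0})"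
    by (intro finite_measure_mono S; auto)+
  then show "C 0 x = 0" "C x 0 = 0"
    using M(3)[of 0 x] M(3)[of x 0] M(4,5)[of "{..0}"] assms(2)
    by (auto simp: i measure_le_0_iff)
  have "measure M (UNIV \<times> {..x} - {..1} \<times> {..x}) \<le> measure M ({1<..} \<times> UNIV)"
      "measure M ({..x} \<times> UNIV - {..x} \<times> {..1}) \<le> measure M (UNIV \<times> {1<..})"
    by (intro finite_measure_mono S; auto)+
  then have "measure M (UNIV \<times> {..x} - {..1} \<times> {..x}) = 0" "measure M ({..x} \<times> UNIV - {..x} \<times> {..1}) = 0"
    using M(4,5)[of "{1<..}"] by (auto simp: i measure_le_0_iff)
  moreover have "measure M (UNIV \<times> {..x} - {..1} \<times> {..x}) = measure M (UNIV \<times> {..x}) - measure M ({..1} \<times> {..x})"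
      "measure M ({..x} \<times> UNIV - {..x} \<times> {..1}) = measure M ({..x} \<times> UNIV) - measure M ({..x} \<times> {..1})"
    by (intro finite_measure_Diff S; auto)+
  ultimately show "C 1 x = x" "C x 1 = x"
    using M(3)[of 1 x] M(3)[of x 1] M(4,5)[of "{..x}"] assms(2) by (auto simp: i)
qed

section \<open>The inner integrals of \<open>\<xi>\<close> and \<open>\<nu>\<close>\<close>

definition sq_int :: "(real \<Rightarrow> real \<Rightarrow> real) \<Rightarrow> real \<Rightarrow> real" where
  "sq_int C v = (LINT t:{0..1}|lebesgue. (deriv (\<lambda>s. C s v) t)\<^sup>2)"

definition wt_int :: "(real \<Rightarrow> real \<Rightarrow> real) \<Rightarrow> real \<Rightarrow> real" where
  "wt_int C v = (LINT u:{0..1}|lebesgue. (1 - u) * C u v)"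

lemma chatterjee_xi_eq: "chatterjee_xi C = 6 * (LINT v:{0..1}|lebesgue. sq_int C v) - 2"
  by (simp add: chatterjee_xi_def sq_int_def)

lemma blest_nu_eq: "blest_nu C = 24 * (LINT v:{0..1}|lebesgue. wt_int C v) - 2"
  by (simp add: blest_nu_def wt_int_def)

lemma sq_int_density:
  "section_density (\<lambda>u. C u v) h \<Longrightarrow> sq_int C v = (LINT t:{0..1}|lborel. (h t)\<^sup>2)"
  unfolding sq_int_def by (rule section_density_integrals)

lemma wt_int_density:
  "section_density (\<lambda>u. C u v) h \<Longrightarrow> wt_int C v = (LINT t:{0..1}|lborel. (1 - t)\<^sup>2 * h t) / 2"
  unfolding wt_int_def by (rule section_density_integrals)

lemma set_integrable_lebesgue_bounded:
  fixes h :: "real \<Rightarrow> real"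
  assumes "set_borel_measurable lebesgue {a..b} h" "\<And>t. t \<in> {a..b} \<Longrightarrow> \<bar>h t\<bar> \<le> B"
  shows "set_integrable lebesgue {a..b} h"
  unfolding set_integrable_def
proof (rule integrableI_bounded_set[where A = "{a..b}" and B = B])
  show "emeasure lebesgue {a..b} < \<infinity>"
    using emeasure_lborel_cbox_finite[of a b] by simp
  show "AE x in lebesgue. x \<in> {a..b} \<longrightarrow> norm (indicat_real {a..b} x *\<^sub>R h x) \<le> B"
    using assms(2) by (intro AE_I2) auto
qed (use assms(1) in \<open>auto simp: set_borel_measurable_def\<close>)

text \<open>The density of a section is chosen for each v separately, so measurability in v cannot
  be read off from it. \<open>wt_int\<close> is a parameter integral of the jointly measurable
  \<open>G\<close>; \<open>sq_int\<close> is a pointwise limit of parameter integrals of squared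
  difference quotients, by dominated convergence.\<close>

lemma measurable_section_integrals:
  assumes "copula C"
  shows "set_borel_measurable lebesgue {0..1} (sq_int C)"
    and "set_borel_measurable lebesgue {0..1} (wt_int C)"
proof -
  obtain G :: "real \<Rightarrow> real \<Rightarrow> real" where
    Gm: "case_prod G \<in> borel_measurable borel"
    and GC: "\<And>u v. \<lbrakk>u \<in> {0..1}; v \<in> {0..1}\<rbrakk> \<Longrightarrow> C u v = G u v"
    and G1: "\<And>u u' v. u \<le> u' \<Longrightarrow> 0 \<le> G u' v - G u v \<and> G u' v - G u v \<le> u' - u"
    and "\<And>u v v'. v \<le> v' \<Longrightarrow> 0 \<le> G u v' - G u v \<and> G u v' - G u v \<le> v' - v"
    by (rule copula_extend[OF assms]) (rule that, assumption+)
  have [measurable]: "case_prod G \<in> borel_measurable (borel \<Otimes>\<^sub>M borel)"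
    using Gm by (simp add: borel_prod)
  have Gm': "G x \<in> borel_measurable borel" "(\<lambda>u. G u x) \<in> borel_measurable borel" for x
    by measurable
  have "(\<lambda>v. LINT u:{0..1}|lborel. (1 - u) * G u v) \<in> borel_measurable borel"
    unfolding set_lebesgue_integral_def by measurable
  then have "(\<lambda>v. indicator {0..1} v *\<^sub>R (LINT u:{0..1}|lborel. (1 - u) * G u v)) \<in> borel_measurable lebesgue"
    by (intro measurable_completion) simp
  moreover have "wt_int C v = (LINT u:{0..1}|lborel. (1 - u) * G u v)" if "v \<in> {0..1}" for v
    unfolding wt_int_def by (rule set_integral_lebesgue_eq_lborel(1)) (use GC that Gm' in auto)
  then have "(\<lambda>v. indicator {0..1} v *\<^sub>R wt_int C v) =
      (\<lambda>v. indicator {0..1} v *\<^sub>R (LINT u:{0..1}|lborel. (1 - u) * G u v))"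
    by (auto simp: indicator_def fun_eq_iff)
  ultimately show "set_borel_measurable lebesgue {0..1} (wt_int C)"
    unfolding set_borel_measurable_def by (simp only:)
  \<comment> \<open>Forward difference quotient with step 1 / (n + 1). It uses \<open>G\<close>
    since t + 1 / (n + 1) may leave [0, 1], and it lies in [0, 1] because \<open>G\<close> is
    nondecreasing and 1-Lipschitz in its first argument.\<close>
  define D where "D = (\<lambda>n v t. real (Suc n) * (G (t + 1 / real (Suc n)) v - G t v))"
  have D01: "0 \<le> D n v t \<and> D n v t \<le> 1" for n v t
  proof -
    have "0 \<le> G (t + 1 / real (Suc n)) v - G t v" "G (t + 1 / real (Suc n)) v - G t v \<le> 1 / real (Suc n)"
      using G1[of t "t + 1 / real (Suc n)" v] by auto
    then show ?thesis
      unfolding D_def using mult_left_mono[of _ "1 / real (Suc n)" "real (Suc n)"] by fastforce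
  qed
  have Dm: "(\<lambda>v. LINT t:{0..1}|lborel. (D n v t)\<^sup>2) \<in> borel_measurable borel" for n
    unfolding set_lebesgue_integral_def D_def by measurable
  then have "(\<lambda>v. indicator {0..1} v *\<^sub>R (LINT t:{0..1}|lborel. (D n v t)\<^sup>2)) \<in> borel_measurable lebesgue" for n
    by (intro measurable_completion) simp
  then show "set_borel_measurable lebesgue {0..1} (sq_int C)"
    unfolding set_borel_measurable_def
  proof (rule borel_measurable_LIMSEQ_real[rotated])
    fix v :: real
    show "(\<lambda>n. indicator {0..1} v *\<^sub>R (LINT t:{0..1}|lborel. (D n v t)\<^sup>2)) \<longlonglongrightarrow> indicator {0..1} v *\<^sub>R sq_int C v"
    proof (cases "v \<in> {0..1}")
      case True
      obtain h where h: "section_density (\<lambda>u. C u v) h"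
        using copula_section_density[OF assms True] by blast
      have "(\<lambda>n. LINT t:{0..1}|lborel. (D n v t)\<^sup>2) \<longlonglongrightarrow> (LINT t:{0..1}|lborel. (h t)\<^sup>2)"
        unfolding set_lebesgue_integral_def
      proof (rule integral_dominated_convergence[where w = "indicator {0..1}"])
        have "AE t in lborel. t \<notin> {0, 1}"
          by (rule AE_not_in) (simp add: finite_imp_null_set_lborel)
        moreover have "AE t in lborel. t \<in> {0<..<1} \<longrightarrow> ((\<lambda>u. C u v) has_real_derivative h t) (at t)"
          using section_density_AE_deriv[OF h] by (simp only: AE_completion_iff)
        ultimately show "AE t in lborel. (\<lambda>n. indicat_real {0..1} t *\<^sub>R (D n v t)\<^sup>2) \<longlonglongrightarrow> indicat_real {0..1} t *\<^sub>R (h t)\<^sup>2"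
        proof eventually_elim
          case (elim t)
          show ?case
          proof (cases "t \<in> {0<..<1}")
            case t: True
            then have "((\<lambda>s. (C (t + s) v - C t v) / s) \<longlongrightarrow> h t) (at 0)"
              using elim by (simp add: DERIV_def)
            moreover have "filterlim (\<lambda>n. 1 / real (Suc n)) (at 0) sequentially"
              unfolding filterlim_at using LIMSEQ_Suc[OF lim_1_over_n] by (auto simp del: of_nat_Suc)
            ultimately have "(\<lambda>n. (C (t + 1 / real (Suc n)) v - C t v) / (1 / real (Suc n))) \<longlonglongrightarrow> h t"
              by (rule filterlim_compose)
            moreover have "\<forall>\<^sub>F n in sequentially. 1 / real (Suc n) < 1 - t"
              using t LIMSEQ_Suc[OF lim_1_over_n] by (intro order_tendstoD(2)) auto
            then have "\<forall>\<^sub>F n in sequentially. (C (t + 1 / real (Suc n)) v - C t v) / (1 / real (Suc n)) = D n v t"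
            proof eventually_elim
              case (elim n)
              then have "t + 1 / real (Suc n) \<in> {0..1}"
                using t by auto
              then show ?case
                using t True by (simp add: D_def GC del: of_nat_Suc)
            qed
            ultimately have "(\<lambda>n. D n v t) \<longlonglongrightarrow> h t"
              by (rule Lim_transform_eventually)
            then show ?thesis by (intro tendsto_intros)
          next
            case False
            with elim have "t \<notin> {0..1}" by auto
            then show ?thesis by simp
          qed
        qed
      next
        fix n
        show "AE x in lborel. norm (indicat_real {0..1} x *\<^sub>R (D n v x)\<^sup>2) \<le> indicat_real {0..1} x"
          using D01 by (intro AE_I2) (auto simp: indicator_def power_le_one)
        show "(\<lambda>x. indicat_real {0..1} x *\<^sub>R (D n v x)\<^sup>2) \<in> borel_measurable lborel"
          unfolding D_def using Gm' by measurable
      qed (use section_densityD(1)[OF h] in auto)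
      then show ?thesis
        using True by (simp add: sq_int_density[of C v h, OF h])
    qed simp
  qed
qed

section \<open>Bounds and integrability of the section integrals\<close>

lemma section_density_mass:
  assumes "copula C" "v \<in> {0..1}" "section_density (\<lambda>u. C u v) h"
  shows "(LINT t:{0..1}|lborel. h t) = v"
  using section_densityD(4)[OF assms(3), of 1] copula_margins(2)[OF assms(1,2)] by simp

lemma section_density_integrable:
  assumes "section_density f h"
  shows "set_integrable lborel {0..1} (\<lambda>t. (h t)\<^sup>2)"
    "set_integrable lborel {0..1} (\<lambda>t. (1 - t)\<^sup>2 * h t)"
proof -
  note h = section_densityD[OF assms]
  have [measurable]: "h \<in> borel_measurable borel" by (rule h)
  show "set_integrable lborel {0..1} (\<lambda>t. (h t)\<^sup>2)"
    by (rule set_integrable_bounded[where B = 1]) (use h in \<open>auto simp: power_le_one\<close>)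
  show "set_integrable lborel {0..1} (\<lambda>t. (1 - t)\<^sup>2 * h t)"
    by (rule set_integrable_bounded[where B = 1])
      (use h in \<open>auto simp: abs_mult power_le_one intro!: mult_le_one\<close>)
qed

lemma section_density_diff_square:
  assumes h: "section_density f h" and k: "section_density g k"
  shows "set_integrable lborel {0..1} (\<lambda>t. (h t - k t)\<^sup>2)"
proof (rule set_integrable_bounded[where B = 1])
  show "(\<lambda>t. (h t - k t)\<^sup>2) \<in> borel_measurable borel"
    using section_densityD(1)[OF h] section_densityD(1)[OF k] by measurable
  fix t
  have "\<bar>h t - k t\<bar> \<le> 1"
    using section_densityD(2,3)[OF h, of t] section_densityD(2,3)[OF k, of t] by auto
  then show "\<bar>(h t - k t)\<^sup>2\<bar> \<le> 1" by (simp add: abs_square_le_1)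
qed

text \<open>The upper bound integrates h^2 <= h, the lower one (h - v)^2 >= 0.\<close>

lemma sq_int_bounds:
  assumes "copula C" "v \<in> {0..1}"
  shows "v\<^sup>2 \<le> sq_int C v" "sq_int C v \<le> v"
proof -
  obtain h where h: "section_density (\<lambda>u. C u v) h"
    using copula_section_density[OF assms] by blast
  note h' = section_densityD[OF h] section_density_integrable[OF h]
  have "(LINT t:{0..1}|lborel. (h t)\<^sup>2) \<le> (LINT t:{0..1}|lborel. h t)"
    by (rule set_integral_mono) (use h' in \<open>auto simp: power2_eq_square mult_left_le\<close>)
  then show "sq_int C v \<le> v"
    by (simp add: sq_int_density[of C v h, OF h] section_density_mass[OF assms h])
  have c: "set_integrable lborel {0..1} (\<lambda>t :: real. c :: real)" for c
    by (rule set_integrable_bounded[where B = "\<bar>c\<bar>"]) auto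
  have "(LINT t:{0..1}|lborel. 2 * v * h t - v\<^sup>2) \<le> (LINT t:{0..1}|lborel. (h t)\<^sup>2)"
  proof (rule set_integral_mono)
    show "2 * v * h t - v\<^sup>2 \<le> (h t)\<^sup>2" for t
      using zero_le_power2[of "h t - v"] by (simp add: power2_diff algebra_simps)
  qed (use h' c in \<open>auto intro!: set_integral_diff\<close>)
  also have "(LINT t:{0..1}|lborel. 2 * v * h t - v\<^sup>2) = 2 * v * (LINT t:{0..1}|lborel. h t) - v\<^sup>2"
    using h' c by (subst set_integral_diff) (auto simp: set_lebesgue_integral_def)
  finally show "v\<^sup>2 \<le> sq_int C v"
    by (simp add: sq_int_density[of C v h, OF h] section_density_mass[OF assms h] power2_eq_square)
qed

text \<open>Crude bounds that serve integrability in v.\<close>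

lemma wt_int_bounds:
  assumes "copula C" "v \<in> {0..1}"
  shows "0 \<le> wt_int C v" "wt_int C v \<le> 1"
proof -
  obtain h where h: "section_density (\<lambda>u. C u v) h"
    using copula_section_density[OF assms] by blast
  note h' = section_densityD[OF h] section_density_integrable[OF h]
  have "(LINT t:{0..1}|lborel. (1 - t)\<^sup>2 * h t) \<le> (LINT t:{0..1}|lborel. h t)"
    by (rule set_integral_mono) (use h' in \<open>auto simp: power_le_one mult_left_le_one_le\<close>)
  then show "wt_int C v \<le> 1"
    using assms(2) by (simp add: wt_int_density[of C v h, OF h] section_density_mass[OF assms h])
  have "0 \<le> (LINT t:{0..1}|lborel. (1 - t)\<^sup>2 * h t)"
    unfolding set_lebesgue_integral_def by (rule integral_nonneg_AE) (use h' in auto)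
  then show "0 \<le> wt_int C v"
    by (simp add: wt_int_density[of C v h, OF h])
qed

lemma section_integrals_integrable:
  assumes "copula C"
  shows "set_integrable lebesgue {0..1} (sq_int C)" "set_integrable lebesgue {0..1} (wt_int C)"
proof -
  have "\<bar>sq_int C v\<bar> \<le> 1" "\<bar>wt_int C v\<bar> \<le> 1" if "v \<in> {0..1}" for v
    using sq_int_bounds[OF assms that] wt_int_bounds[OF assms that] that order_trans[OF zero_le_power2[of v] sq_int_bounds(1)[OF assms that]] by auto
  then show "set_integrable lebesgue {0..1} (sq_int C)" "set_integrable lebesgue {0..1} (wt_int C)"
    using measurable_section_integrals[OF assms] by (auto intro!: set_integrable_lebesgue_bounded[where B = 1])
qed

section \<open>Mixtures, reflections and shuffles\<close>

text \<open>The copula is realised as the law of \<open>(t, T t y)\<close> for independent uniform \<open>t\<close> and \<open>y\<close>.\<close>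

lemma kernel_copula:
  fixes T :: "real \<Rightarrow> real \<Rightarrow> real"
  assumes T[measurable]: "case_prod T \<in> borel_measurable (borel \<Otimes>\<^sub>M borel)"
    and k: "\<And>t v. \<lbrakk>t \<in> {0..1}; v \<in> {0..1}\<rbrakk> \<Longrightarrow> measure lborel {y \<in> {0..1}. T t y \<le> v} = k v t"
    and mass: "\<And>v. v \<in> {0..1} \<Longrightarrow> (LINT t:{0..1}|lborel. k v t) = v"
    and C: "\<And>u v. \<lbrakk>u \<in> {0..1}; v \<in> {0..1}\<rbrakk> \<Longrightarrow> C u v = (LINT t:{0..u}|lborel. k v t)"
  shows "copula C"
proof -
  define U where "U = uniform_measure lborel {0..1::real}"
  interpret U: prob_space U
    unfolding U_def by (rule prob_space_uniform_measure) auto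
  interpret P: pair_prob_space U U ..
  have sU[measurable_cong]: "sets U = sets borel" by (simp add: U_def)
  have spU: "space U = UNIV" by (simp add: U_def)
  define M where "M = distr (U \<Otimes>\<^sub>M U) borel (\<lambda>p. (fst p, T (fst p) (snd p)))"
  have Tm[measurable]: "T t \<in> borel_measurable borel" for t by measurable
  have fm: "(\<lambda>p. (fst p, T (fst p) (snd p))) \<in> measurable (U \<Otimes>\<^sub>M U) borel"
    unfolding borel_prod[symmetric] by measurable
  \<comment> \<open>Given t, the second coordinate is \<open>T t y\<close> with y uniform, so
    integrating its conditional law over t in A gives the mass of A x B. For B = (-\<infinity>, v]
    the conditional probability is \<open>k v t\<close>.\<close>
  have meas: "measure M (A \<times> B) = (LINT t:A \<inter> {0..1}|lborel. measure lborel {y \<in> {0..1}. T t y \<in> B})"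
    if [measurable]: "A \<in> sets borel" "B \<in> sets borel" for A B :: "real set"
  proof -
    have fin: "emeasure lborel {y \<in> {0..1}. T t y \<in> B} \<noteq> top" for t
    proof -
      have "emeasure lborel {y \<in> {0..1}. T t y \<in> B} \<le> emeasure lborel {0..1::real}"
        by (rule emeasure_mono) auto
      then show ?thesis by (auto simp: top_unique)
    qed
    have km: "(\<lambda>t. measure lborel {y \<in> {0..1}. T t y \<in> B}) \<in> borel_measurable borel"
    proof -
      have "(\<lambda>t. LINT y|lborel. (if 0 \<le> y \<and> y \<le> 1 \<and> T t y \<in> B then 1 else 0 :: real)) \<in> borel_measurable borel"
        by (rule lborel.borel_measurable_lebesgue_integral) measurable
      also have "(\<lambda>t. LINT y|lborel. (if 0 \<le> y \<and> y \<le> 1 \<and> T t y \<in> B then 1 else 0 :: real)) =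
          (\<lambda>t. LINT y|lborel. indicator {y \<in> {0..1}. T t y \<in> B} y)"
        by (intro ext Bochner_Integration.integral_cong) (auto simp: indicator_def)
      finally show ?thesis by simp
    qed
    have "{p \<in> space (U \<Otimes>\<^sub>M U). fst p \<in> A \<and> T (fst p) (snd p) \<in> B} \<in> sets (U \<Otimes>\<^sub>M U)"
      by measurable
    then have Sm: "{p. fst p \<in> A \<and> T (fst p) (snd p) \<in> B} \<in> sets (U \<Otimes>\<^sub>M U)"
      by (simp add: space_pair_measure spU)
    have "emeasure M (A \<times> B) = emeasure (U \<Otimes>\<^sub>M U) {p. fst p \<in> A \<and> T (fst p) (snd p) \<in> B}"
      unfolding M_def using that
      by (subst emeasure_distr[OF fm])
        (auto simp: borel_prod[symmetric] space_pair_measure spU intro!: arg_cong2[where f = emeasure])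
    also have "\<dots> = (\<integral>\<^sup>+t. emeasure U (Pair t -` {p. fst p \<in> A \<and> T (fst p) (snd p) \<in> B}) \<partial>U)"
      by (rule U.emeasure_pair_measure_alt[OF Sm])
    also have "\<dots> = (\<integral>\<^sup>+t. emeasure U (Pair t -` {p. fst p \<in> A \<and> T (fst p) (snd p) \<in> B}) * indicator {0..1} t \<partial>lborel)"
    proof -
      have "(\<lambda>t. emeasure U (Pair t -` {p. fst p \<in> A \<and> T (fst p) (snd p) \<in> B})) \<in> borel_measurable U"
        by (rule U.measurable_emeasure_Pair[OF Sm])
      then show ?thesis
        unfolding U_def by (subst nn_integral_uniform_measure) (simp_all add: U_def divide_ennreal_def)
    qed
    also have "\<dots> = (\<integral>\<^sup>+t. ennreal (indicator (A \<inter> {0..1}) t *\<^sub>R measure lborel {y \<in> {0..1}. T t y \<in> B}) \<partial>lborel)"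
    proof (rule nn_integral_cong)
      fix t
      have [measurable]: "{y. T t y \<in> B} \<in> sets borel" by measurable
      have *: "{0..1} \<inter> {y. T t y \<in> B} = {y \<in> {0..1}. T t y \<in> B}" by auto
      have "emeasure U {y. T t y \<in> B} = emeasure lborel {y \<in> {0..1}. T t y \<in> B}"
        unfolding U_def by (simp add: * divide_ennreal_def)
      then show "emeasure U (Pair t -` {p. fst p \<in> A \<and> T (fst p) (snd p) \<in> B}) * indicator {0..1} t =
          ennreal (indicator (A \<inter> {0..1}) t *\<^sub>R measure lborel {y \<in> {0..1}. T t y \<in> B})"
        using fin[of t] by (cases "t \<in> A") (auto simp: indicator_def emeasure_eq_ennreal_measure)
    qed
    finally have "emeasure M (A \<times> B) =
        (\<integral>\<^sup>+t. ennreal (indicator (A \<inter> {0..1}) t *\<^sub>R measure lborel {y \<in> {0..1}. T t y \<in> B}) \<partial>lborel)" .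
    then show ?thesis
      unfolding set_lebesgue_integral_def measure_def[of M]
      using km by (subst integral_eq_nn_integral) (auto simp: measure_def)
  qed
  show ?thesis
  proof (rule copulaI[of M])
    show "prob_space M" unfolding M_def by (rule P.prob_space_distr[OF fm])
    show "sets M = sets borel" by (simp add: M_def)
    fix u :: real assume u: "u \<in> {0..1}"
    then have *: "{..u} \<inter> {0..1} = {0..u}" by auto
    have "measure M ({..u} \<times> UNIV) = (LINT t:{0..u}|lborel. measure lborel {0..1::real})"
    proof -
      have "{y \<in> {0..1}. T t y \<in> UNIV} = {0..1}" for t by auto
      then show ?thesis by (simp only: meas * atMost_borel space_in_borel)
    qed
    then show "measure M ({..u} \<times> UNIV) = u" using u by (simp add: set_lebesgue_integral_def)
    fix v :: real assume v: "v \<in> {0..1}"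
    have "measure M ({..u} \<times> {..v}) = (LINT t:{0..u}|lborel. k v t)"
      unfolding set_lebesgue_integral_def using u v k
      by (subst meas) (auto simp: * set_lebesgue_integral_def intro!: Bochner_Integration.integral_cong split: split_indicator)
    then show "C u v = measure M ({..u} \<times> {..v})" using C u v by simp
  next
    fix v :: real assume v: "v \<in> {0..1}"
    have "measure M (UNIV \<times> {..v}) = (LINT t:{0..1}|lborel. k v t)"
      unfolding set_lebesgue_integral_def using v k
      by (subst meas) (auto simp: set_lebesgue_integral_def intro!: Bochner_Integration.integral_cong split: split_indicator)
    then show "measure M (UNIV \<times> {..v}) = v" using mass v by simp
  qed
qed

section \<open>Mixtures and the reflection of the second coordinate\<close>

definition mix :: "real \<Rightarrow> (real \<Rightarrow> real \<Rightarrow> real) \<Rightarrow> (real \<Rightarrow> real \<Rightarrow> real) \<Rightarrow> real \<Rightarrow> real \<Rightarrow> real" where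
  "mix s C D u v = (1 - s) * C u v + s * D u v"

text \<open>The mixed measure is a two-stage experiment: a Bernoulli draw with parameter s selects
  \<open>N\<close> on success and \<open>M\<close> otherwise, so the monadic bind yields a
  probability measure on the plane.\<close>

lemma copula_mix:
  assumes "copula C" "copula D" "s \<in> {0..1}"
  shows "copula (mix s C D)"
proof -
  obtain M where M: "prob_space M" "sets M = sets borel"
    "\<And>u v. \<lbrakk>u \<in> {0..1}; v \<in> {0..1}\<rbrakk> \<Longrightarrow> C u v = measure M ({..u} \<times> {..v})"
    "\<And>A. A \<in> sets borel \<Longrightarrow> measure M (A \<times> UNIV) = measure lborel (A \<inter> {0..1})"
    "\<And>A. A \<in> sets borel \<Longrightarrow> measure M (UNIV \<times> A) = measure lborel (A \<inter> {0..1})"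
    using copula_measureE[OF assms(1)] by blast
  obtain N where N: "prob_space N" "sets N = sets borel"
    "\<And>u v. \<lbrakk>u \<in> {0..1}; v \<in> {0..1}\<rbrakk> \<Longrightarrow> D u v = measure N ({..u} \<times> {..v})"
    "\<And>A. A \<in> sets borel \<Longrightarrow> measure N (A \<times> UNIV) = measure lborel (A \<inter> {0..1})"
    "\<And>A. A \<in> sets borel \<Longrightarrow> measure N (UNIV \<times> A) = measure lborel (A \<inter> {0..1})"
    using copula_measureE[OF assms(2)] by blast
  interpret M: prob_space M by fact
  interpret N: prob_space N by fact
  define f where "f = (\<lambda>b. if b then N else M)"
  have sf: "sets (f b) = sets borel" and pf: "prob_space (f b)" for b
    using M N by (auto simp: f_def)
  have fm: "f \<in> measurable (measure_pmf (bernoulli_pmf s)) (subprob_algebra borel)"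
    using sf pf by (auto simp: space_subprob_algebra prob_space_imp_subprob_space)
  define K where "K = measure_pmf (bernoulli_pmf s) \<bind> f"
  have sK: "sets K = sets borel"
    unfolding K_def using sf by (rule sets_bind) auto
  have K: "measure K X = (1 - s) * measure M X + s * measure N X" if "X \<in> sets borel" for X
  proof -
    have "emeasure K X = (\<integral>\<^sup>+b. emeasure (f b) X \<partial>measure_pmf (bernoulli_pmf s))"
      unfolding K_def by (rule emeasure_bind[OF _ fm that]) simp
    also have "\<dots> = ennreal s * emeasure N X + ennreal (1 - s) * emeasure M X"
      using assms(3) by (simp add: f_def nn_integral_bernoulli_pmf mult.commute)
    also have "\<dots> = ennreal ((1 - s) * measure M X + s * measure N X)"
      using assms(3)
      by (simp add: M.emeasure_eq_measure N.emeasure_eq_measure ennreal_mult[symmetric] add.commute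
          flip: ennreal_plus)
    finally show ?thesis
      using assms(3) by (simp add: measure_def[of K] del: ennreal_plus)
  qed
  have S: "A \<times> B \<in> sets borel" if "A \<in> sets borel" "B \<in> sets borel" for A B :: "real set"
    using that by (simp add: borel_prod[symmetric])
  show ?thesis
  proof (rule copulaI[of K])
    show "prob_space K"
      unfolding K_def by (rule measure_pmf.prob_space_bind[OF _ fm]) (simp add: pf)
    show "sets K = sets borel" by (rule sK)
    fix u :: real assume u: "u \<in> {0..1}"
    then have *: "{..u} \<inter> {0..1} = {0..u}" by auto
    show "measure K ({..u} \<times> UNIV) = u"
      using u by (subst K) (auto intro!: S simp: M(4) N(4) * algebra_simps)
    show "measure K (UNIV \<times> {..u}) = u"
      using u by (subst K) (auto intro!: S simp: M(5) N(5) * algebra_simps)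
    fix v :: real assume v: "v \<in> {0..1}"
    show "mix s C D u v = measure K ({..u} \<times> {..v})"
      using u v by (subst K) (auto intro!: S simp: mix_def M(3) N(3))
  qed
qed

text \<open>The copula of (U, 1 - V) when (U, V) has copula \<open>C\<close>; it is the symmetry
  behind negative parameters and behind the lower half of the region.\<close>

definition flip :: "(real \<Rightarrow> real \<Rightarrow> real) \<Rightarrow> real \<Rightarrow> real \<Rightarrow> real" where
  "flip C u v = u - C u (1 - v)"

lemma copula_flip:
  assumes "copula C"
  shows "copula (flip C)"
proof -
  obtain M where M: "prob_space M" "sets M = sets borel"
    "\<And>u v. \<lbrakk>u \<in> {0..1}; v \<in> {0..1}\<rbrakk> \<Longrightarrow> C u v = measure M ({..u} \<times> {..v})"
    "\<And>A. A \<in> sets borel \<Longrightarrow> measure M (A \<times> UNIV) = measure lborel (A \<inter> {0..1})"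
    "\<And>A. A \<in> sets borel \<Longrightarrow> measure M (UNIV \<times> A) = measure lborel (A \<inter> {0..1})"
    using copula_measureE[OF assms(1)] by blast
  interpret prob_space M by fact
  have sp: "space M = UNIV"
    using sets_eq_imp_space_eq[OF M(2)] by simp
  note M(2)[measurable_cong]
  have S: "A \<times> B \<in> sets M" if "A \<in> sets borel" "B \<in> sets borel" for A B :: "real set"
    using that by (simp add: M(2) borel_prod[symmetric])
  have fm: "(\<lambda>p. (fst p, 1 - snd p)) \<in> measurable M borel"
    unfolding measurable_cong_sets[OF M(2) refl] borel_prod[symmetric] by measurable
  define N where "N = distr M borel (\<lambda>p. (fst p, 1 - snd p))"
  have N: "measure N (A \<times> {..v}) = measure M (A \<times> {1 - v..})" if "A \<in> sets borel" for A v
    unfolding N_def using that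
    by (subst measure_distr[OF fm])
      (auto simp: sp borel_prod[symmetric] intro!: arg_cong[where f = "measure M"])
  have N': "measure N (A \<times> UNIV) = measure M (A \<times> UNIV)" if "A \<in> sets borel" for A
    unfolding N_def using that
    by (subst measure_distr[OF fm])
      (auto simp: sp borel_prod[symmetric] intro!: arg_cong[where f = "measure M"])
  show ?thesis
  proof (rule copulaI[of N])
    show "prob_space N" unfolding N_def by (rule prob_space_distr[OF fm])
    show "sets N = sets borel" by (simp add: N_def)
    fix u :: real assume u: "u \<in> {0..1}"
    then have *: "{..u} \<inter> {0..1} = {0..u}" "{1 - u..} \<inter> {0..1} = {1 - u..1}" by auto
    show marg: "measure N ({..u} \<times> UNIV) = u"
      using u by (simp add: N' M(4) *)
    show "measure N (UNIV \<times> {..u}) = u"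
      using u by (simp add: N M(5) *)
    fix v :: real assume v: "v \<in> {0..1}"
    \<comment> \<open>The half-planes below and above the level 1 - v overlap in a line. It carries
      no mass because the second margin is uniform.\<close>
    have "measure M ({..u} \<times> {1 - v}) \<le> measure M (UNIV \<times> {1 - v})"
      by (intro finite_measure_mono S) auto
    also have "\<dots> = measure lborel ({1 - v} \<inter> {0..1})"
      by (rule M(5)) simp
    also have "{1 - v} \<inter> {0..1} = {1 - v}" using v by auto
    finally have 0: "measure M ({..u} \<times> {1 - v}) = 0"
      by (simp add: measure_le_0_iff)
    have "measure M ({..u} \<times> UNIV) = measure M (({..u} \<times> {1 - v..}) \<union> ({..u} \<times> {..1 - v} - {..u} \<times> {1 - v}))"
      by (rule arg_cong[where f = "measure M"]) auto
    also have "\<dots> = measure M ({..u} \<times> {1 - v..}) + measure M ({..u} \<times> {..1 - v} - {..u} \<times> {1 - v})"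
      by (intro finite_measure_Union S sets.Diff) auto
    also have "measure M ({..u} \<times> {..1 - v} - {..u} \<times> {1 - v}) = measure M ({..u} \<times> {..1 - v}) - measure M ({..u} \<times> {1 - v})"
      by (intro finite_measure_Diff S) auto
    finally have "u = measure M ({..u} \<times> {1 - v..}) + measure M ({..u} \<times> {..1 - v})"
      using 0 marg by (simp add: N')
    then show "flip C u v = measure N ({..u} \<times> {..v})"
      using u v by (simp add: flip_def N M(3))
  qed
qed

lemma section_density_mix:
  assumes "section_density (\<lambda>u. C u v) h" "section_density (\<lambda>u. D u v) g" "s \<in> {0..1}"
  shows "section_density (\<lambda>u. mix s C D u v) (\<lambda>t. (1 - s) * h t + s * g t)"
  unfolding section_density_def
proof (intro conjI allI ballI)
  note h = section_densityD[OF assms(1)] and g = section_densityD[OF assms(2)]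
  show "(\<lambda>t. (1 - s) * h t + s * g t) \<in> borel_measurable borel"
    using h(1) g(1) by measurable
  fix t
  show "0 \<le> (1 - s) * h t + s * g t" using h(2)[of t] g(2)[of t] assms(3) by auto
  show "(1 - s) * h t + s * g t \<le> 1"
    using h(3)[of t] g(3)[of t] assms(3) by (intro convex_bound_le) auto
  fix u :: real assume u: "u \<in> {0..1}"
  show "mix s C D u v = (LINT t:{0..u}|lborel. (1 - s) * h t + s * g t)"
    using h(5) g(5) by (subst set_integral_add) (auto simp: mix_def h(4)[OF u] g(4)[OF u])
qed

lemma section_density_flip:
  assumes "section_density (\<lambda>u. C u (1 - v)) h"
  shows "section_density (\<lambda>u. flip C u v) (\<lambda>t. 1 - h t)"
  unfolding section_density_def
proof (intro conjI allI ballI)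
  note h = section_densityD[OF assms]
  show "(\<lambda>t. 1 - h t) \<in> borel_measurable borel"
    using h(1) by measurable
  fix t
  show "0 \<le> 1 - h t" "1 - h t \<le> 1" using h(2)[of t] h(3)[of t] by auto
  fix u :: real assume u: "u \<in> {0..1}"
  have "set_integrable lborel {0..u} (\<lambda>t :: real. 1 :: real)"
    by (rule set_integrable_bounded[where B = 1]) auto
  then show "flip C u v = (LINT t:{0..u}|lborel. 1 - h t)"
    using h(5) u by (subst set_integral_diff) (auto simp: flip_def h(4)[OF u] set_lebesgue_integral_def)
qed

lemma set_integral_lebesgue_has_integral:
  fixes f :: "real \<Rightarrow> real"
  assumes "(f has_integral I) {a..b}" "set_integrable lebesgue {a..b} f"
  shows "(LINT v:{a..b}|lebesgue. f v) = I"
  using set_lebesgue_integral_eq_integral(2)[OF assms(2)] assms(1) by (simp add: integral_unique)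

lemma set_integral_lebesgue_continuous:
  fixes f :: "real \<Rightarrow> real"
  assumes "(f has_integral I) {a..b}" "continuous_on {a..b} f"
  shows "(LINT v:{a..b}|lebesgue. f v) = I" "set_integrable lebesgue {a..b} f"
    "(LINT v:{a..b}|lborel. f v) = I" "set_integrable lborel {a..b} f"
proof -
  show 1: "set_integrable lebesgue {a..b} f"
    using assms(2) by (rule absolutely_integrable_continuous_real)
  show "(LINT v:{a..b}|lebesgue. f v) = I"
    by (rule set_integral_lebesgue_has_integral[OF assms(1) 1])
  show 2: "set_integrable lborel {a..b} f"
    by (rule borel_integrable_atLeastAtMost') fact
  show "(LINT v:{a..b}|lborel. f v) = I"
    using set_borel_integral_eq_integral(2)[OF 2] assms(1) by (simp add: integral_unique)
qed

lemma set_integral_lebesgue_reflect: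
  fixes f :: "real \<Rightarrow> real"
  assumes "set_integrable lebesgue {0..1} f"
  shows "(LINT v:{0..1}|lebesgue. f (1 - v)) = (LINT v:{0..1}|lebesgue. f v)"
    "set_integrable lebesgue {0..1} (\<lambda>v. f (1 - v))"
proof -
  have e': "indicator {0..1} (1 - v) * f (1 - v) = indicator {0..1} v * f (1 - v)" for v :: real
    by (auto simp: indicator_def)
  have "has_bochner_integral lebesgue (\<lambda>v. indicator {0..1} v *\<^sub>R f v) (LINT v:{0..1}|lebesgue. f v)"
    using assms by (simp add: has_bochner_integral_iff set_integrable_def set_lebesgue_integral_def)
  then have "has_bochner_integral lebesgue (\<lambda>v. indicator {0..1} v *\<^sub>R f (1 - v)) (LINT v:{0..1}|lebesgue. f v)"
    by (subst (asm) has_bochner_integral_lebesgue_real_affine_iff[where c = "-1" and t = 1]) (simp_all add: e')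
  then show "(LINT v:{0..1}|lebesgue. f (1 - v)) = (LINT v:{0..1}|lebesgue. f v)"
    "set_integrable lebesgue {0..1} (\<lambda>v. f (1 - v))"
    by (simp_all add: has_bochner_integral_iff set_integrable_def set_lebesgue_integral_def)
qed

lemma has_integral_power_Icc:
  fixes a b :: real
  assumes "a \<le> b"
  shows "((\<lambda>x. x ^ n) has_integral (b ^ Suc n - a ^ Suc n) / Suc n) {a..b}"
proof -
  have "((\<lambda>x. x ^ n) has_integral (b ^ Suc n / Suc n - a ^ Suc n / Suc n)) {a..b}"
    by (rule fundamental_theorem_of_calculus[OF assms])
      (auto intro!: derivative_eq_intros simp: has_real_derivative_iff_has_vector_derivative[symmetric] simp del: of_nat_Suc power_Suc)
  then show ?thesis by (simp add: diff_divide_distrib)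
qed

lemma has_integral_compl_power_Icc:
  fixes a b :: real
  assumes "a \<le> b"
  shows "((\<lambda>x. (1 - x) ^ n) has_integral ((1 - a) ^ Suc n - (1 - b) ^ Suc n) / Suc n) {a..b}"
proof -
  have "((\<lambda>x. (1 - x) ^ n) has_integral (- ((1 - b) ^ Suc n / Suc n) - (- ((1 - a) ^ Suc n / Suc n)))) {a..b}"
    by (rule fundamental_theorem_of_calculus[OF assms])
      (auto intro!: derivative_eq_intros simp: has_real_derivative_iff_has_vector_derivative[symmetric] simp del: of_nat_Suc power_Suc)
  then show ?thesis by (simp add: diff_divide_distrib)
qed

section \<open>The two coefficients under mixing and reflection\<close>

lemma xi_bounds:
  assumes "copula C"
  shows "0 \<le> chatterjee_xi C" "chatterjee_xi C \<le> 1"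
proof -
  have cont: "continuous_on {0..1} (\<lambda>v. v\<^sup>2 :: real)" "continuous_on {0..1} (\<lambda>v. v :: real)"
    by (auto intro!: continuous_intros)
  have 2: "((\<lambda>v. v\<^sup>2) has_integral 1/3) {0..1::real}" "((\<lambda>v. v) has_integral 1/2) {0..1::real}"
    using has_integral_power_Icc[of 0 1 2] has_integral_power_Icc[of 0 1 1] by simp_all
  note i = set_integral_lebesgue_continuous[OF 2(1) cont(1)] set_integral_lebesgue_continuous[OF 2(2) cont(2)]
  have "(LINT v:{0..1}|lebesgue. v\<^sup>2) \<le> (LINT v:{0..1}|lebesgue. sq_int C v)"
    by (rule set_integral_mono) (use i section_integrals_integrable[OF assms] sq_int_bounds[OF assms] in auto)
  then show "0 \<le> chatterjee_xi C"
    using i(1) by (simp add: chatterjee_xi_eq)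
  have "(LINT v:{0..1}|lebesgue. sq_int C v) \<le> (LINT v:{0..1}|lebesgue. v)"
    by (rule set_integral_mono) (use i section_integrals_integrable[OF assms] sq_int_bounds[OF assms] in auto)
  then show "chatterjee_xi C \<le> 1"
    using i(5) by (simp add: chatterjee_xi_eq)
qed

lemma nu_mix:
  assumes "copula C" "copula D" "s \<in> {0..1}"
  shows "blest_nu (mix s C D) = (1 - s) * blest_nu C + s * blest_nu D"
proof -
  have "wt_int (mix s C D) v = (1 - s) * wt_int C v + s * wt_int D v" if v: "v \<in> {0..1}" for v
  proof -
    obtain h where h: "section_density (\<lambda>u. C u v) h"
      using copula_section_density[OF assms(1) v] by blast
    obtain g where g: "section_density (\<lambda>u. D u v) g"
      using copula_section_density[OF assms(2) v] by blast
    note hg = section_density_mix[of C v h D g s, OF h g assms(3)]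
    have "(LINT t:{0..1}|lborel. (1 - t)\<^sup>2 * ((1 - s) * h t + s * g t)) =
        (LINT t:{0..1}|lborel. (1 - s) * ((1 - t)\<^sup>2 * h t) + s * ((1 - t)\<^sup>2 * g t))"
      by (simp add: algebra_simps)
    also have "\<dots> = (1 - s) * (LINT t:{0..1}|lborel. (1 - t)\<^sup>2 * h t) + s * (LINT t:{0..1}|lborel. (1 - t)\<^sup>2 * g t)"
      using section_density_integrable[OF h] section_density_integrable[OF g]
      by (subst set_integral_add) auto
    finally show ?thesis
      by (simp add: wt_int_density[of C v h, OF h] wt_int_density[of D v g, OF g] wt_int_density[of "mix s C D" v, OF hg] add_divide_distrib)
  qed
  then have "(LINT v:{0..1}|lebesgue. wt_int (mix s C D) v) = (LINT v:{0..1}|lebesgue. (1 - s) * wt_int C v + s * wt_int D v)"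
    by (intro set_lebesgue_integral_cong) auto
  also have "\<dots> = (1 - s) * (LINT v:{0..1}|lebesgue. wt_int C v) + s * (LINT v:{0..1}|lebesgue. wt_int D v)"
    using section_integrals_integrable[OF assms(1)] section_integrals_integrable[OF assms(2)]
    by (subst set_integral_add) auto
  finally show ?thesis by (simp add: blest_nu_eq algebra_simps)
qed

text \<open>From ((1 - s) h + s g)^2 = (1 - s) h^2 + s g^2 - s (1 - s) (h - g)^2.\<close>

lemma sq_int_mix:
  assumes h: "section_density (\<lambda>u. C u v) h" and g: "section_density (\<lambda>u. D u v) g" and "s \<in> {0..1}"
  shows "sq_int (mix s C D) v =
    (1 - s) * sq_int C v + s * sq_int D v - s * (1 - s) * (LINT t:{0..1}|lborel. (h t - g t)\<^sup>2)"
proof -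
  note hg = section_density_mix[of C v h D g s, OF assms]
  note i = section_density_diff_square[OF h g]
  have "(LINT t:{0..1}|lborel. ((1 - s) * h t + s * g t)\<^sup>2) =
      (LINT t:{0..1}|lborel. ((1 - s) * (h t)\<^sup>2 + s * (g t)\<^sup>2) - s * (1 - s) * (h t - g t)\<^sup>2)"
    by (rule set_lebesgue_integral_cong) (auto simp: power2_eq_square algebra_simps)
  also have "\<dots> = (LINT t:{0..1}|lborel. ((1 - s) * (h t)\<^sup>2 + s * (g t)\<^sup>2)) - s * (1 - s) * (LINT t:{0..1}|lborel. (h t - g t)\<^sup>2)"
    using section_density_integrable[OF h] section_density_integrable[OF g] i
    by (subst set_integral_diff) (auto intro!: set_integral_add)
  also have "(LINT t:{0..1}|lborel. ((1 - s) * (h t)\<^sup>2 + s * (g t)\<^sup>2)) =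
      (1 - s) * (LINT t:{0..1}|lborel. (h t)\<^sup>2) + s * (LINT t:{0..1}|lborel. (g t)\<^sup>2)"
    using section_density_integrable[OF h] section_density_integrable[OF g]
    by (subst set_integral_add) auto
  finally show ?thesis
    by (simp add: sq_int_density[of C v h, OF h] sq_int_density[of D v g, OF g] sq_int_density[of "mix s C D" v, OF hg])
qed

text \<open>The constant \<open>K\<close> does not depend on s, so \<xi> is a quadratic polynomial
  along a mixture: convex because \<open>K\<close> is nonnegative, and continuous for the
  intermediate value argument.\<close>

lemma xi_mix:
  assumes "copula C" "copula D"
  shows "\<exists>K\<ge>0. \<forall>s\<in>{0..1}. chatterjee_xi (mix s C D) =
    (1 - s) * chatterjee_xi C + s * chatterjee_xi D - s * (1 - s) * K"
proof -
  \<comment> \<open>\<open>E v\<close> is the integral of (h - g)^2, recovered from the mixture with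
    s = 1/2. In this form it depends on v only through \<open>sq_int\<close>, hence is integrable in
    v although h and g are chosen for each v separately.\<close>
  define E where "E v = 4 * ((sq_int C v + sq_int D v) / 2 - sq_int (mix (1/2) C D) v)" for v
  have E: "sq_int (mix s C D) v = ((1 - s) * sq_int C v + s * sq_int D v) - s * (1 - s) * E v \<and> 0 \<le> E v"
    if v: "v \<in> {0..1}" and s: "s \<in> {0..1}" for s v
  proof -
    obtain h where h: "section_density (\<lambda>u. C u v) h"
      using copula_section_density[OF assms(1) v] by blast
    obtain g where g: "section_density (\<lambda>u. D u v) g"
      using copula_section_density[OF assms(2) v] by blast
    have "E v = (LINT t:{0..1}|lborel. (h t - g t)\<^sup>2)"
      using sq_int_mix[of C v h D g, OF h g, of "1/2"] by (simp add: E_def field_simps)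
    moreover have "0 \<le> (LINT t:{0..1}|lborel. (h t - g t)\<^sup>2)"
      unfolding set_lebesgue_integral_def by (rule integral_nonneg_AE) auto
    ultimately show ?thesis
      using sq_int_mix[of C v h D g, OF h g s] by simp
  qed
  note i = section_integrals_integrable[OF assms(1)] section_integrals_integrable[OF assms(2)]
    section_integrals_integrable[OF copula_mix[OF assms, of "1/2"]]
  have Ei: "set_integrable lebesgue {0..1} E"
    unfolding E_def using i by (auto intro!: set_integral_diff set_integral_add)
  show ?thesis
  proof (intro exI[of _ "6 * (LINT v:{0..1}|lebesgue. E v)"] conjI ballI)
    show "0 \<le> 6 * (LINT v:{0..1}|lebesgue. E v)"
      unfolding set_lebesgue_integral_def
      by (intro mult_nonneg_nonneg integral_nonneg_AE AE_I2) (use E[of _ 0] in \<open>auto simp: indicator_def\<close>)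
    fix s :: real assume s: "s \<in> {0..1}"
    have "(LINT v:{0..1}|lebesgue. sq_int (mix s C D) v) =
        (LINT v:{0..1}|lebesgue. ((1 - s) * sq_int C v + s * sq_int D v) - s * (1 - s) * E v)"
      using E s by (intro set_lebesgue_integral_cong) auto
    also have "\<dots> = (LINT v:{0..1}|lebesgue. ((1 - s) * sq_int C v + s * sq_int D v)) - s * (1 - s) * (LINT v:{0..1}|lebesgue. E v)"
      using i Ei by (subst set_integral_diff) (auto intro!: set_integral_add)
    also have "(LINT v:{0..1}|lebesgue. ((1 - s) * sq_int C v + s * sq_int D v)) =
        (1 - s) * (LINT v:{0..1}|lebesgue. sq_int C v) + s * (LINT v:{0..1}|lebesgue. sq_int D v)"
      using i by (subst set_integral_add) auto
    finally show "chatterjee_xi (mix s C D) = (1 - s) * chatterjee_xi C + s * chatterjee_xi D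
        - s * (1 - s) * (6 * (LINT v:{0..1}|lebesgue. E v))"
      by (simp add: chatterjee_xi_eq algebra_simps)
  qed
qed

lemma xi_mix_le:
  assumes "copula C" "copula D" "s \<in> {0..1}"
  shows "chatterjee_xi (mix s C D) \<le> (1 - s) * chatterjee_xi C + s * chatterjee_xi D"
proof -
  obtain K where "K \<ge> 0" "chatterjee_xi (mix s C D) =
      (1 - s) * chatterjee_xi C + s * chatterjee_xi D - s * (1 - s) * K"
    using xi_mix[OF assms(1,2)] assms(3) by blast
  moreover have "0 \<le> s * (1 - s) * K" using \<open>K \<ge> 0\<close> assms(3) by auto
  ultimately show ?thesis by linarith
qed

text \<open>The section of \<open>flip C\<close> at v has density 1 - h, with h the density of
  \<open>C\<close> at 1 - v. Expanding (1 - h)^2 adds 1 - 2 (1 - v) = 2 v - 1, which integrates to 0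
  over [0, 1]. The constant 1/6 is half the integral of (1 - t)^2, and 24 / 6 - 2 = 2 turns the
  remaining expression into -\<nu>.\<close>

lemma xi_nu_flip:
  assumes "copula C"
  shows "chatterjee_xi (flip C) = chatterjee_xi C" "blest_nu (flip C) = - blest_nu C"
proof -
  have *: "sq_int (flip C) v = sq_int C (1 - v) + (2 * v - 1) \<and> wt_int (flip C) v = 1 / 6 - wt_int C (1 - v)"
    if v: "v \<in> {0..1}" for v
  proof -
    have v': "1 - v \<in> {0..1}" using v by auto
    obtain h where h: "section_density (\<lambda>u. C u (1 - v)) h"
      using copula_section_density[OF assms v'] by blast
    note f = section_density_flip[of C, OF h]
    have c: "((\<lambda>t. 1 :: real) has_integral 1) {0..1::real}" "((\<lambda>t. (1 - t)\<^sup>2) has_integral 1/3) {0..1::real}"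
      using has_integral_power_Icc[of 0 1 0] has_integral_compl_power_Icc[of 0 1 2] by simp_all
    have cont: "continuous_on {0..1::real} (\<lambda>t. 1 :: real)" "continuous_on {0..1::real} (\<lambda>t. (1 - t)\<^sup>2)"
      by (auto intro!: continuous_intros)
    note ci = set_integral_lebesgue_continuous[OF c(1) cont(1)] set_integral_lebesgue_continuous[OF c(2) cont(2)]
    have "(LINT t:{0..1}|lborel. (1 - h t)\<^sup>2) = (LINT t:{0..1}|lborel. (1 - 2 * h t) + (h t)\<^sup>2)"
      by (simp add: power2_diff algebra_simps)
    also have "\<dots> = (LINT t:{0..1}|lborel. 1 - 2 * h t) + (LINT t:{0..1}|lborel. (h t)\<^sup>2)"
      using section_density_integrable[OF h] section_densityD(5)[OF h] ci
      by (subst set_integral_add) (auto intro!: set_integral_diff)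
    also have "(LINT t:{0..1}|lborel. 1 - 2 * h t) = 1 - 2 * (1 - v)"
      using section_densityD(5)[OF h] ci section_density_mass[of C, OF assms v' h]
      by (subst set_integral_diff) auto
    finally have 1: "sq_int (flip C) v = sq_int C (1 - v) + (2 * v - 1)"
      by (simp add: sq_int_density[of "flip C" v, OF f] sq_int_density[of C "1 - v" h, OF h])
    have "(LINT t:{0..1}|lborel. (1 - t)\<^sup>2 * (1 - h t)) = (LINT t:{0..1}|lborel. (1 - t)\<^sup>2 - (1 - t)\<^sup>2 * h t)"
      by (simp add: right_diff_distrib)
    also have "\<dots> = 1 / 3 - (LINT t:{0..1}|lborel. (1 - t)\<^sup>2 * h t)"
      using section_density_integrable[OF h] ci
      by (subst set_integral_diff) (auto intro!: continuous_intros)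
    finally have "wt_int (flip C) v = 1 / 6 - wt_int C (1 - v)"
      by (simp add: wt_int_density[of "flip C" v, OF f] wt_int_density[of C "1 - v" h, OF h])
    with 1 show ?thesis by simp
  qed
  note i = section_integrals_integrable[OF assms]
  note r = set_integral_lebesgue_reflect[OF i(1)] set_integral_lebesgue_reflect[OF i(2)]
  have c: "((\<lambda>t. 1/6 :: real) has_integral 1/6) {0..1::real}" "((\<lambda>t. 2 * t - 1) has_integral 0) {0..1::real}"
    using has_integral_const_real[of "1/6 :: real" 0 1]
      has_integral_diff[OF has_integral_mult_right[OF has_integral_power_Icc[of 0 1 1], of 2] has_integral_power_Icc[of 0 1 0]]
    by simp_all
  have cont: "continuous_on {0..1::real} (\<lambda>t. 1/6 :: real)" "continuous_on {0..1::real} (\<lambda>t. 2 * t - 1)"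
    by (auto intro!: continuous_intros)
  note ci = set_integral_lebesgue_continuous[OF c(1) cont(1)] set_integral_lebesgue_continuous[OF c(2) cont(2)]
  have "(LINT v:{0..1}|lebesgue. sq_int (flip C) v) = (LINT v:{0..1}|lebesgue. sq_int C (1 - v) + (2 * v - 1))"
    using * by (intro set_lebesgue_integral_cong) auto
  also have "\<dots> = (LINT v:{0..1}|lebesgue. sq_int C v)"
    using r ci by (subst set_integral_add) (auto intro!: continuous_intros)
  finally show "chatterjee_xi (flip C) = chatterjee_xi C" by (simp add: chatterjee_xi_eq)
  have "(LINT v:{0..1}|lebesgue. wt_int (flip C) v) = (LINT v:{0..1}|lebesgue. 1 / 6 - wt_int C (1 - v))"
    using * by (intro set_lebesgue_integral_cong) auto
  also have "\<dots> = 1 / 6 - (LINT v:{0..1}|lebesgue. wt_int C v)"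
    using r ci by (subst set_integral_diff) (auto intro!: continuous_intros)
  finally show "blest_nu (flip C) = - blest_nu C" by (simp add: blest_nu_eq)
qed

section \<open>Deterministic copulas of every Blest value\<close>

definition shuffle_map :: "real \<Rightarrow> real \<Rightarrow> real" where
  "shuffle_map a t = (if t < a then t else 1 + a - t)"

text \<open>All mass lies on the graph of \<open>shuffle_map a\<close>, the identity below a and the
  order-reversing map of [a, 1] above. It leads from the countermonotone copula at a = 0 to the
  comonotone one at a = 1, and its \<nu> passes through every value in [-1, 1].\<close>

definition shuffle :: "real \<Rightarrow> real \<Rightarrow> real \<Rightarrow> real" where
  "shuffle a u v = (LINT t:{0..u}|lborel. indicator {s. shuffle_map a s \<le> v} t)"

lemma measurable_shuffle_map: "shuffle_map a \<in> borel_measurable borel"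
  unfolding shuffle_map_def by measurable

lemma measurable_shuffle_indicator:
  "(indicator {s. shuffle_map a s \<le> v} :: real \<Rightarrow> real) \<in> borel_measurable borel"
  using measurable_shuffle_map by measurable

lemma integral_shuffle:
  fixes F g :: "real \<Rightarrow> real"
  assumes a: "a \<in> {0..1}" and v: "v \<in> {0..1}"
    and F: "\<And>t. (F has_real_derivative g t) (at t)" and g: "continuous_on UNIV g"
  shows "(LINT t:{0..1}|lborel. g t * indicator {s. shuffle_map a s \<le> v} t) =
    (if v < a then F v - F 0 else F a - F 0 + (F 1 - F (1 + a - v)))"
proof -
  have gm[measurable]: "g \<in> borel_measurable borel"
    by (rule borel_measurable_continuous_onI) fact
  note m[measurable] = measurable_shuffle_indicator[of a v]
  have FTC: "(\<integral>t. g t * indicator {x..y} t \<partial>lborel) = F y - F x"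
      "integrable lborel (\<lambda>t. g t * indicator {x..y} t)" if "x \<le> y" for x y
  proof -
    show "(\<integral>t. g t * indicator {x..y} t \<partial>lborel) = F y - F x"
      using that F g by (intro integral_FTC_Icc_real) (auto simp: continuous_on_eq_continuous_at)
    show "integrable lborel (\<lambda>t. g t * indicator {x..y} t)"
      using borel_integrable_atLeastAtMost'[of x y g] continuous_on_subset[OF g]
      by (auto simp: set_integrable_def mult.commute)
  qed
  \<comment> \<open>Within [0, 1] the set is [0, v] if v < a, and otherwise [0, a) together with
    [1 + a - v, 1]. Using [0, a] instead matters at most at the point a, also when the two intervals
    meet there.\<close>
  have ae: "AE t in lborel. t \<noteq> a"
    by (rule AE_lborel_singleton)
  show ?thesis
  proof (cases "v < a")
    case True
    have "(LINT t:{0..1}|lborel. g t * indicator {s. shuffle_map a s \<le> v} t) = (\<integral>t. g t * indicator {0..v} t \<partial>lborel)"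
      unfolding set_lebesgue_integral_def
    proof (rule integral_cong_AE)
      show "AE t in lborel. indicator {0..1} t *\<^sub>R (g t * indicator {s. shuffle_map a s \<le> v} t) = g t * indicator {0..v} t"
        using ae by eventually_elim (use True a v in \<open>auto simp: indicator_def shuffle_map_def\<close>)
    qed measurable
    with True FTC(1)[of 0 v] v show ?thesis by simp
  next
    case False
    have "(LINT t:{0..1}|lborel. g t * indicator {s. shuffle_map a s \<le> v} t) =
        (\<integral>t. g t * indicator {0..a} t + g t * indicator {1 + a - v..1} t \<partial>lborel)"
      unfolding set_lebesgue_integral_def
    proof (rule integral_cong_AE)
      show "AE t in lborel. indicator {0..1} t *\<^sub>R (g t * indicator {s. shuffle_map a s \<le> v} t) =
          g t * indicator {0..a} t + g t * indicator {1 + a - v..1} t"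
        using ae by eventually_elim (use False a v in \<open>auto simp: indicator_def shuffle_map_def\<close>)
    qed measurable
    also have "\<dots> = (F a - F 0) + (F 1 - F (1 + a - v))"
      using FTC[of 0 a] FTC[of "1 + a - v" 1] False a v by simp
    finally show ?thesis using False by simp
  qed
qed

lemma shuffle_mass:
  assumes "a \<in> {0..1}" "v \<in> {0..1}"
  shows "(LINT t:{0..1}|lborel. indicator {s. shuffle_map a s \<le> v} t) = v"
  using integral_shuffle[OF assms, of "\<lambda>t. t" "\<lambda>_. 1"] by (auto intro!: derivative_eq_intros)

lemma section_density_shuffle:
  "section_density (\<lambda>u. shuffle a u v) (indicator {s. shuffle_map a s \<le> v})"
  using measurable_shuffle_indicator by (auto simp: section_density_def shuffle_def)

lemma copula_shuffle:
  assumes a: "a \<in> {0..1}"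
  shows "copula (shuffle a)"
proof (rule kernel_copula)
  show "case_prod (\<lambda>t (y :: real). shuffle_map a t) \<in> borel_measurable (borel \<Otimes>\<^sub>M borel)"
    using measurable_shuffle_map by measurable
  show "measure lborel {y \<in> {0..1::real}. shuffle_map a t \<le> v} = indicator {s. shuffle_map a s \<le> v} t" for t v
  proof (cases "shuffle_map a t \<le> v")
    case True
    then have "{y \<in> {0..1::real}. shuffle_map a t \<le> v} = {0..1}" by auto
    then show ?thesis using True by simp
  qed auto
  show "(LINT t:{0..1}|lborel. indicator {s. shuffle_map a s \<le> v} t) = v" if "v \<in> {0..1}" for v
    by (rule shuffle_mass[OF a that])
  show "shuffle a u v = (LINT t:{0..u}|lborel. indicator {s. shuffle_map a s \<le> v} t)" for u v
    by (simp add: shuffle_def)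
qed

text \<open>The sections have indicator densities, so h^2 = h and \<open>sq_int\<close> attains its
  upper bound v. The weighted integral changes form at v = a, hence the split of [0, 1]
  there.\<close>

lemma xi_nu_shuffle:
  assumes a: "a \<in> {0..1}"
  shows "chatterjee_xi (shuffle a) = 1" "blest_nu (shuffle a) = 1 - 2 * (1 - a) ^ 4"
proof -
  note i = section_integrals_integrable[OF copula_shuffle[OF a]]
  have sq: "sq_int (shuffle a) v = v" if v: "v \<in> {0..1}" for v
  proof -
    have "sq_int (shuffle a) v = (LINT t:{0..1}|lborel. (indicator {s. shuffle_map a s \<le> v} t)\<^sup>2)"
      by (rule sq_int_density[of "shuffle a" v, OF section_density_shuffle])
    also have "\<dots> = (LINT t:{0..1}|lborel. indicator {s. shuffle_map a s \<le> v} t)"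
      by (rule set_lebesgue_integral_cong) (auto simp: indicator_def)
    finally show ?thesis using shuffle_mass[OF a v] by simp
  qed
  have "((\<lambda>v. v) has_integral 1/2) {0..1::real}"
    using has_integral_power_Icc[of 0 1 1] by simp
  then have "(sq_int (shuffle a) has_integral 1/2) {0..1::real}"
    using sq by (subst has_integral_cong[where g = "\<lambda>v. v"]) auto
  from set_integral_lebesgue_has_integral[OF this i(1)]
  show "chatterjee_xi (shuffle a) = 1" by (simp add: chatterjee_xi_eq)
  have wt: "wt_int (shuffle a) v =
      (if v < a then (1 - (1 - v) ^ 3) / 6 else (1 - (1 - a) ^ 3) / 6 + (v - a) ^ 3 / 6)" if v: "v \<in> {0..1}" for v
  proof -
    have "wt_int (shuffle a) v = (LINT t:{0..1}|lborel. (1 - t)\<^sup>2 * indicator {s. shuffle_map a s \<le> v} t) / 2"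
      by (rule wt_int_density[of "shuffle a" v, OF section_density_shuffle])
    also have "(LINT t:{0..1}|lborel. (1 - t)\<^sup>2 * indicator {s. shuffle_map a s \<le> v} t) =
        (if v < a then (- ((1 - v) ^ 3 / 3)) - (- ((1 - 0) ^ 3 / 3))
         else (- ((1 - a) ^ 3 / 3)) - (- ((1 - 0) ^ 3 / 3)) + ((- ((1 - 1) ^ 3 / 3)) - (- ((1 - (1 + a - v)) ^ 3 / 3))))"
      by (rule integral_shuffle[OF a v]) (auto intro!: derivative_eq_intros continuous_intros)
    finally show ?thesis by (cases "v < a") (simp_all add: field_simps)
  qed
  have "((\<lambda>v. (1 - (1 - v) ^ 3) / 6) has_integral (a - (1 - (1 - a) ^ 4) / 4) / 6) {0..a}"
    using has_integral_divide[OF has_integral_diff[OF has_integral_power_Icc[of 0 a 0] has_integral_compl_power_Icc[of 0 a 3]], of 6] a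
    by (simp add: eval_nat_numeral)
  then have 1: "(wt_int (shuffle a) has_integral (a - (1 - (1 - a) ^ 4) / 4) / 6) {0..a}"
    using wt a by (subst has_integral_cong[where g = "\<lambda>v. (1 - (1 - v) ^ 3) / 6"]) auto
  have "((\<lambda>v. (1 - (1 - a) ^ 3) / 6 + (v - a) ^ 3 / 6) has_integral
      ((1 - (1 - a) ^ 3) / 6 * 1 + (1 - a) ^ 4 / 24) - ((1 - (1 - a) ^ 3) / 6 * a + (a - a) ^ 4 / 24)) {a..1}"
    by (rule fundamental_theorem_of_calculus)
      (use a in \<open>auto intro!: derivative_eq_intros simp: has_real_derivative_iff_has_vector_derivative[symmetric]\<close>)
  then have 2: "(wt_int (shuffle a) has_integral
      ((1 - (1 - a) ^ 3) / 6 * 1 + (1 - a) ^ 4 / 24) - ((1 - (1 - a) ^ 3) / 6 * a + (a - a) ^ 4 / 24)) {a..1}"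
    using wt a by (subst has_integral_cong[where g = "\<lambda>v. (1 - (1 - a) ^ 3) / 6 + (v - a) ^ 3 / 6"]) auto
  note 3 = set_integral_lebesgue_has_integral[OF has_integral_combine[OF _ _ 1 2] i(2)]
  have "24 * (LINT v:{0..1}|lebesgue. wt_int (shuffle a) v) - 2 = 1 - 2 * (1 - a) ^ 4"
    using a by (subst 3) (auto simp: field_simps power4_eq_xxxx power3_eq_cube)
  then show "blest_nu (shuffle a) = 1 - 2 * (1 - a) ^ 4"
    by (simp add: blest_nu_eq)
qed

text \<open>Bathtub principle: the weight (1 - t)^2 decreases on [0, 1], so a section of mass v does
  best on [0, v]. Subtracting the level (1 - v)^2 shifts both sides equally, since both densities
  have mass v, and makes the comparison pointwise.\<close>

lemma wt_int_le_shuffle: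
  assumes "copula C" "v \<in> {0..1}"
  shows "wt_int C v \<le> wt_int (shuffle 1) v"
proof -
  obtain h where h: "section_density (\<lambda>u. C u v) h"
    using copula_section_density[OF assms] by blast
  define k :: "real \<Rightarrow> real" where "k = indicator {s. shuffle_map 1 s \<le> v}"
  have k: "section_density (\<lambda>u. shuffle 1 u v) k"
    unfolding k_def by (rule section_density_shuffle)
  note ih = section_densityD(5)[OF h] section_density_integrable[OF h]
  note ik = section_densityD(5)[OF k] section_density_integrable[OF k]
  have "(LINT t:{0..1}|lborel. (1 - t)\<^sup>2 * h t - (1 - v)\<^sup>2 * h t) \<le>
      (LINT t:{0..1}|lborel. (1 - t)\<^sup>2 * k t - (1 - v)\<^sup>2 * k t)"
  proof (rule set_integral_mono)
    fix t :: real assume t: "t \<in> {0..1}"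
    have kt: "k t = (if t \<le> v then 1 else 0)"
      using t assms(2) by (auto simp: k_def shuffle_map_def indicator_def)
    have "((1 - t)\<^sup>2 - (1 - v)\<^sup>2) * h t \<le> ((1 - t)\<^sup>2 - (1 - v)\<^sup>2) * k t"
    proof (cases "t \<le> v")
      case True
      then have "(1 - v)\<^sup>2 \<le> (1 - t)\<^sup>2" using assms(2) by (intro power_mono) auto
      then show ?thesis
        using True section_densityD(3)[OF h, of t] by (auto simp: kt intro: mult_left_le)
    next
      case False
      then have "(1 - t)\<^sup>2 \<le> (1 - v)\<^sup>2" using t by (intro power_mono) auto
      then show ?thesis
        using False section_densityD(2)[OF h, of t] by (auto simp: kt intro: mult_nonpos_nonneg)
    qed
    then show "(1 - t)\<^sup>2 * h t - (1 - v)\<^sup>2 * h t \<le> (1 - t)\<^sup>2 * k t - (1 - v)\<^sup>2 * k t"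
      by (simp add: left_diff_distrib)
  qed (use ih ik in \<open>auto intro!: set_integral_diff\<close>)
  also have "(LINT t:{0..1}|lborel. (1 - t)\<^sup>2 * h t - (1 - v)\<^sup>2 * h t) = 2 * wt_int C v - (1 - v)\<^sup>2 * v"
    using ih by (subst set_integral_diff)
      (auto simp: wt_int_density[of C v h, OF h] section_density_mass[of C, OF assms h])
  also have "(LINT t:{0..1}|lborel. (1 - t)\<^sup>2 * k t - (1 - v)\<^sup>2 * k t) = 2 * wt_int (shuffle 1) v - (1 - v)\<^sup>2 * v"
    using ik copula_shuffle[of 1] by (subst set_integral_diff)
      (auto simp: wt_int_density[of "shuffle 1" v k, OF k] section_density_mass[of "shuffle 1", OF _ assms(2) k])
  finally show ?thesis by simp
qed

lemma nu_bounds: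
  assumes "copula C"
  shows "\<bar>blest_nu C\<bar> \<le> 1"
proof -
  have "blest_nu D \<le> 1" if D: "copula D" for D
  proof -
    have "(LINT v:{0..1}|lebesgue. wt_int D v) \<le> (LINT v:{0..1}|lebesgue. wt_int (shuffle 1) v)"
      by (rule set_integral_mono)
        (use section_integrals_integrable[OF D] section_integrals_integrable[OF copula_shuffle[of 1]] wt_int_le_shuffle[OF D] in auto)
    then have "blest_nu D \<le> blest_nu (shuffle 1)" by (simp add: blest_nu_eq)
    then show ?thesis by (simp add: xi_nu_shuffle)
  qed
  from this[OF assms] this[OF copula_flip[OF assms]] show ?thesis
    by (simp add: xi_nu_flip[OF assms])
qed

text \<open>Mixing with a shuffle of the same \<open>\<nu>\<close> raises \<open>\<xi>\<close> continuously up to \<open>1\<close>.\<close>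

lemma xi_nu_region_fill:
  assumes D: "copula D" and "blest_nu D = y" "chatterjee_xi D \<le> x" "x \<le> 1"
  shows "(x, y) \<in> xi_nu_region"
proof -
  have y: "\<bar>y\<bar> \<le> 1" using nu_bounds[OF D] assms(2) by simp
  \<comment> \<open>Solves 1 - 2 (1 - a)^4 = y.\<close>
  define a where "a = 1 - root 4 ((1 - y) / 2)"
  have "0 \<le> root 4 ((1 - y) / 2)" "root 4 ((1 - y) / 2) \<le> 1"
    using y real_root_le_mono[of 4 "(1 - y) / 2" 1] by auto
  then have a: "a \<in> {0..1}" by (auto simp: a_def)
  have "(1 - a) ^ 4 = (1 - y) / 2"
    using y by (simp add: a_def)
  then have nu: "blest_nu (shuffle a) = y"
    using xi_nu_shuffle(2)[OF a] by (simp add: field_simps)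
  obtain K where K: "\<forall>s\<in>{0..1}. chatterjee_xi (mix s D (shuffle a)) =
    (1 - s) * chatterjee_xi D + s * chatterjee_xi (shuffle a) - s * (1 - s) * K"
    using xi_mix[OF D copula_shuffle[OF a]] by blast
  \<comment> \<open>The quadratic in s equals \<xi> of \<open>D\<close> at s = 0 and 1 at s = 1, so
    it takes the value x in between.\<close>
  have "\<exists>s\<ge>0. s \<le> 1 \<and> (1 - s) * chatterjee_xi D + s * chatterjee_xi (shuffle a) - s * (1 - s) * K = x"
    using assms(3,4) by (intro IVT') (auto simp: xi_nu_shuffle[OF a] intro!: continuous_intros)
  then obtain s where s: "s \<in> {0..1}" "chatterjee_xi (mix s D (shuffle a)) = x"
    using K by auto
  have "blest_nu (mix s D (shuffle a)) = y"
    using nu_mix[OF D copula_shuffle[OF a] s(1)] nu assms(2) by (simp add: algebra_simps)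
  then show ?thesis
    using s copula_mix[OF D copula_shuffle[OF a] s(1)] by (auto simp: xi_nu_region_def)
qed

section \<open>The family \<open>C_fam\<close> and its optimality\<close>

text \<open>The shape of \<open>h_fam\<close> with q as a free parameter in place of
  \<open>q_shift b v\<close>; q later becomes the variable of integration.\<close>

definition kern :: "real \<Rightarrow> real \<Rightarrow> real \<Rightarrow> real" where
  "kern b q t = clip (b * ((1 - t)\<^sup>2 - q)) 0 1"

text \<open>\<open>kern b q t\<close> is \<open>1\<close> for \<open>1 - t \<ge> hi b q\<close>, \<open>0\<close> for \<open>1 - t \<le> lo q\<close> and unclipped in between.\<close>

definition lo :: "real \<Rightarrow> real" where
  "lo q = sqrt (max q 0)"

definition hi :: "real \<Rightarrow> real \<Rightarrow> real" where
  "hi b q = sqrt (min (q + 1 / b) 1)"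

text \<open>Closed form of the mean of \<open>kern b q\<close> over [0, 1] for q in [-1/b, 1]: with
  x = 1 - t it is 1 - hi plus b times the integral of x^2 - q from lo to hi.\<close>

definition level :: "real \<Rightarrow> real \<Rightarrow> real" where
  "level b q = 1 - hi b q + b * ((hi b q ^ 3 - lo q ^ 3) / 3 - q * (hi b q - lo q))"

lemma continuous_kern: "continuous_on S (kern b q)"
  unfolding kern_def clip_def by (intro continuous_intros)

lemma continuous_level: "continuous_on S (level b)"
  unfolding level_def lo_def hi_def by (auto intro!: continuous_intros)

lemma kern_bounds: "0 \<le> kern b q t" "kern b q t \<le> 1"
  by (auto simp: kern_def clip_def)

lemma measurable_kern: "kern b q \<in> borel_measurable borel"
  by (rule borel_measurable_continuous_onI) (rule continuous_kern)

section \<open>The clipped kernel and its mean constraint\<close>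

context
  fixes b :: real
  assumes b: "0 < b"
begin

lemma lo_hi_bounds:
  assumes "q \<in> {-1/b..1}"
  shows "0 \<le> lo q" "lo q \<le> 1" "0 \<le> hi b q" "hi b q \<le> 1" "lo q \<le> hi b q"
proof -
  have "0 \<le> q + 1 / b" "q \<le> 1" "0 < 1 / b" using assms b by auto
  then show "0 \<le> lo q" "lo q \<le> 1" "0 \<le> hi b q" "hi b q \<le> 1" "lo q \<le> hi b q"
    unfolding lo_def hi_def by (auto intro!: real_sqrt_le_mono)
qed

text \<open>One splitting for three integrands: \<open>w\<close> is instantiated to k, (1 - t)^2 k
  and k^2. The three antiderivatives belong to the ranges of t where the kernel is 1, unclipped and
  0.\<close>

lemma kern_has_integral:
  fixes F1 F2 F3 :: "real \<Rightarrow> real"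
  assumes q: "q \<in> {-1/b..1}"
    and F1: "\<And>t. (F1 has_real_derivative w t 1) (at t)"
    and F2: "\<And>t. (F2 has_real_derivative w t (b * ((1 - t)\<^sup>2 - q))) (at t)"
    and F3: "\<And>t. (F3 has_real_derivative w t 0) (at t)"
  shows "((\<lambda>t. w t (kern b q t)) has_integral
    (F1 (1 - hi b q) - F1 0 + (F2 (1 - lo q) - F2 (1 - hi b q)) + (F3 1 - F3 (1 - lo q)))) {0..1}"
proof -
  note l = lo_hi_bounds[OF q]
  have cont: "continuous_on {x..y} F" if "\<And>t. (F has_real_derivative f t) (at t)" for F f x y
    using that by (meson DERIV_continuous continuous_at_imp_continuous_on)
  have 1: "((\<lambda>t. w t (kern b q t)) has_integral (F1 (1 - hi b q) - F1 0)) {0..1 - hi b q}"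
  proof (rule fundamental_theorem_of_calculus_interior)
    fix t assume t: "t \<in> {0<..<1 - hi b q}"
    have "hi b q < 1 - t" using t by auto
    then have "(hi b q)\<^sup>2 < (1 - t)\<^sup>2" using l by (intro power_strict_mono) auto
    moreover have "1 - t < 1" using t by auto
    then have "(1 - t)\<^sup>2 < 1" using l t by (simp add: power_less_one_iff abs_square_less_1)
    moreover have "0 \<le> q + 1 / b" using q by auto
    ultimately have "q + 1 / b < (1 - t)\<^sup>2" by (auto simp: hi_def min_def split: if_splits)
    then have "b * ((1 - t)\<^sup>2 - q) \<ge> 1"
      using b by (simp add: field_simps)
    then have "kern b q t = 1" by (simp add: kern_def clip_def)
    then show "(F1 has_vector_derivative w t (kern b q t)) (at t)"
      using F1[of t] by (simp add: has_real_derivative_iff_has_vector_derivative)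
  qed (use l cont[OF F1] in auto)
  have 2: "((\<lambda>t. w t (kern b q t)) has_integral (F2 (1 - lo q) - F2 (1 - hi b q))) {1 - hi b q..1 - lo q}"
  proof (rule fundamental_theorem_of_calculus_interior)
    fix t assume t: "t \<in> {1 - hi b q<..<1 - lo q}"
    have "1 - t < hi b q" using t by auto
    then have "(1 - t)\<^sup>2 < (hi b q)\<^sup>2" using l t by (intro power_strict_mono) auto
    moreover have "0 \<le> q + 1 / b" using q by auto
    ultimately have "(1 - t)\<^sup>2 < q + 1 / b" by (auto simp: hi_def min_def split: if_splits)
    then have "b * ((1 - t)\<^sup>2 - q) \<le> 1"
      using b by (simp add: field_simps)
    note le1 = this
    have "lo q < 1 - t" using t by auto
    then have "(lo q)\<^sup>2 < (1 - t)\<^sup>2" using l t by (intro power_strict_mono) auto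
    moreover have "0 < (1 - t)\<^sup>2" using l \<open>lo q < 1 - t\<close> by simp
    ultimately have "q < (1 - t)\<^sup>2"
      by (cases "q \<le> 0") (linarith, simp add: lo_def)
    then have "b * ((1 - t)\<^sup>2 - q) \<ge> 0" using b by simp
    with le1 have "kern b q t = b * ((1 - t)\<^sup>2 - q)" by (simp add: kern_def clip_def)
    then show "(F2 has_vector_derivative w t (kern b q t)) (at t)"
      using F2[of t] by (simp add: has_real_derivative_iff_has_vector_derivative)
  qed (use l cont[OF F2] in auto)
  have 3: "((\<lambda>t. w t (kern b q t)) has_integral (F3 1 - F3 (1 - lo q))) {1 - lo q..1}"
  proof (rule fundamental_theorem_of_calculus_interior)
    fix t assume t: "t \<in> {1 - lo q<..<1}"
    have "1 - t < lo q" "0 < 1 - t" using t by auto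
    then have "(1 - t)\<^sup>2 < (lo q)\<^sup>2" "0 < (1 - t)\<^sup>2" using l by (auto intro!: power_strict_mono)
    then have "(1 - t)\<^sup>2 < q" by (auto simp: lo_def max_def split: if_splits)
    then have "b * ((1 - t)\<^sup>2 - q) \<le> 0" using b by (simp add: mult_nonneg_nonpos)
    then have "kern b q t = 0" by (simp add: kern_def clip_def)
    then show "(F3 has_vector_derivative w t (kern b q t)) (at t)"
      using F3[of t] by (simp add: has_real_derivative_iff_has_vector_derivative)
  qed (use l cont[OF F3] in auto)
  show ?thesis
    by (rule has_integral_combine[OF _ _ has_integral_combine[OF _ _ 1 2] 3]) (use l in auto)
qed

lemma level_has_integral:
  assumes "q \<in> {-1/b..1}"
  shows "(kern b q has_integral level b q) {0..1}"
proof -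
  have "((\<lambda>t. kern b q t) has_integral
    ((1 - hi b q) - 0 + (b * (- ((1 - (1 - lo q)) ^ 3 / 3) - q * (1 - lo q)) - b * (- ((1 - (1 - hi b q)) ^ 3 / 3) - q * (1 - hi b q))) + (0 - 0))) {0..1}"
    by (rule kern_has_integral[OF assms, where w = "\<lambda>t k. k" and ?F1.0 = "\<lambda>t. t" and ?F3.0 = "\<lambda>t. 0"
        and ?F2.0 = "\<lambda>t. b * (- ((1 - t) ^ 3 / 3) - q * t)"])
      (auto intro!: derivative_eq_intros simp: algebra_simps)
  then show ?thesis by (simp add: level_def algebra_simps diff_divide_distrib)
qed

lemma kern_weighted_has_integral:
  assumes "q \<in> {-1/b..1}"
  shows "((\<lambda>t. (1 - t)\<^sup>2 * kern b q t) has_integral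
    ((1 - hi b q ^ 3) / 3 + b * ((hi b q ^ 5 - lo q ^ 5) / 5 - q * (hi b q ^ 3 - lo q ^ 3) / 3))) {0..1}"
proof -
  have "((\<lambda>t. (1 - t)\<^sup>2 * kern b q t) has_integral
    (- ((1 - (1 - hi b q)) ^ 3 / 3) - - ((1 - 0) ^ 3 / 3) +
     (b * (- ((1 - (1 - lo q)) ^ 5 / 5) + q * (1 - (1 - lo q)) ^ 3 / 3) -
      b * (- ((1 - (1 - hi b q)) ^ 5 / 5) + q * (1 - (1 - hi b q)) ^ 3 / 3)) + (0 - 0))) {0..1}"
    by (rule kern_has_integral[OF assms, where w = "\<lambda>t k. (1 - t)\<^sup>2 * k"
        and ?F1.0 = "\<lambda>t. - ((1 - t) ^ 3 / 3)" and ?F3.0 = "\<lambda>t. 0"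
        and ?F2.0 = "\<lambda>t. b * (- ((1 - t) ^ 5 / 5) + q * (1 - t) ^ 3 / 3)"])
      (auto intro!: derivative_eq_intros simp: field_simps eval_nat_numeral)
  then show ?thesis by (simp add: algebra_simps diff_divide_distrib)
qed

lemma kern_square_has_integral:
  assumes "q \<in> {-1/b..1}"
  shows "((\<lambda>t. (kern b q t)\<^sup>2) has_integral
    (1 - hi b q + b\<^sup>2 * ((hi b q ^ 5 - lo q ^ 5) / 5 - 2 * q * (hi b q ^ 3 - lo q ^ 3) / 3 + q\<^sup>2 * (hi b q - lo q)))) {0..1}"
proof -
  have "((\<lambda>t. (kern b q t)\<^sup>2) has_integral
    ((1 - hi b q) - 0 +
     (b\<^sup>2 * (- ((1 - (1 - lo q)) ^ 5 / 5) + 2 * q * (1 - (1 - lo q)) ^ 3 / 3 + q\<^sup>2 * (1 - lo q)) -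
      b\<^sup>2 * (- ((1 - (1 - hi b q)) ^ 5 / 5) + 2 * q * (1 - (1 - hi b q)) ^ 3 / 3 + q\<^sup>2 * (1 - hi b q))) + (0 - 0))) {0..1}"
    by (rule kern_has_integral[OF assms, where w = "\<lambda>t k. k\<^sup>2"
        and ?F1.0 = "\<lambda>t. t" and ?F3.0 = "\<lambda>t. 0"
        and ?F2.0 = "\<lambda>t. b\<^sup>2 * (- ((1 - t) ^ 5 / 5) + 2 * q * (1 - t) ^ 3 / 3 + q\<^sup>2 * t)"])
      (auto intro!: derivative_eq_intros simp: field_simps eval_nat_numeral)
  then show ?thesis by (simp add: algebra_simps diff_divide_distrib add_divide_distrib)
qed

text \<open>The kernel is pointwise nonincreasing in q, and equal means would force two continuous
  kernels to agree everywhere on [0, 1].\<close>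

lemma level_strict_antimono:
  assumes "q \<in> {-1/b..1}" "q' \<in> {-1/b..1}" "q < q'"
  shows "level b q' < level b q"
proof -
  have mono: "kern b q' t \<le> kern b q t" for t
  proof -
    have "b * ((1 - t)\<^sup>2 - q') \<le> b * ((1 - t)\<^sup>2 - q)"
      using b assms(3) by (intro mult_left_mono) auto
    then show ?thesis by (auto simp: kern_def clip_def)
  qed
  have I: "((\<lambda>t. kern b q t - kern b q' t) has_integral (level b q - level b q')) {0..1}"
    by (intro has_integral_diff level_has_integral assms)
  have ge: "0 \<le> level b q - level b q'"
    by (rule has_integral_nonneg[OF I]) (use mono in auto)
  moreover have "level b q - level b q' \<noteq> 0"
  proof
    assume 0: "level b q - level b q' = 0"
    \<comment> \<open>A value of (1 - t)^2 at which the kernel for q is positive and the one for q'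
      is below 1. They cannot then be clipped to the same end, so they differ.\<close>
    define s2 where "s2 = (max q 0 + min (q' + 1 / b) 1) / 2"
    have "max q 0 < min (q' + 1 / b) 1"
    proof -
      have "0 < 1 / b" "- (1 / b) \<le> q" using assms b by auto
      moreover from this have "q < q' + 1 / b" "0 < q' + 1 / b" using assms(3) by linarith+
      ultimately show ?thesis using assms by (auto simp: max_def min_def)
    qed
    then have s2: "max q 0 < s2" "s2 < min (q' + 1 / b) 1" by (auto simp: s2_def)
    define t where "t = 1 - sqrt s2"
    have t: "t \<in> {0..1}" "(1 - t)\<^sup>2 = s2"
      using s2 by (auto simp: t_def)
    have "kern b q t - kern b q' t = 0"
      using I 0 mono t continuous_kern
      by (intro has_integral_0_cbox_imp_0[of 0 1 "\<lambda>t. kern b q t - kern b q' t" t])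
        (auto intro!: continuous_intros continuous_on_subset[OF continuous_kern])
    moreover have "b * (s2 - q') < b * (s2 - q)" "b * (s2 - q') < 1" "0 < b * (s2 - q)"
      using s2 b assms(3) by (auto simp: field_simps)
    then have "kern b q' t < kern b q t"
      unfolding kern_def clip_def t(2) by (auto simp: min_def max_def)
    ultimately show False by simp
  qed
  ultimately show ?thesis by simp
qed

lemma level_endpoints: "level b (-1/b) = 1" "level b 1 = 0"
  using b by (auto simp: level_def lo_def hi_def)

lemma level_lebesgue:
  assumes "q \<in> {-1/b..1}"
  shows "(LINT t:{0..1}|lebesgue. clip (b * ((1 - t)\<^sup>2 - q)) 0 1) = level b q"
  using set_integral_lebesgue_continuous(1)[OF level_has_integral[OF assms] continuous_kern]
  by (simp add: kern_def)

text \<open>Existence comes from the intermediate value theorem between the end values 1 and 0,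
  uniqueness from strict monotonicity; together they resolve the definite description in
  \<open>q_shift\<close>.\<close>

lemma q_shift_props:
  assumes v: "v \<in> {0..1}"
  shows "q_shift b v \<in> {-1/b..1}" "level b (q_shift b v) = v"
proof -
  have "\<exists>q\<ge>-1/b. q \<le> 1 \<and> level b q = v"
    using v b level_endpoints by (intro IVT2') (auto intro: continuous_level simp: field_simps)
  then obtain q where q: "q \<in> {-1/b..1}" "level b q = v" by auto
  have "q_shift b v = q"
    unfolding q_shift_def
  proof (rule the_equality)
    show "q \<in> {-1/b..1} \<and> (LINT t:{0..1}|lebesgue. clip (b * ((1 - t)\<^sup>2 - q)) 0 1) = v"
      using q level_lebesgue by simp
    fix q' assume q': "q' \<in> {-1/b..1} \<and> (LINT t:{0..1}|lebesgue. clip (b * ((1 - t)\<^sup>2 - q')) 0 1) = v"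
    then have "level b q' = v" using level_lebesgue[of q'] by simp
    then show "q' = q"
      using q q' level_strict_antimono[of q q'] level_strict_antimono[of q' q] by (cases q q' rule: linorder_cases) auto
  qed
  with q show "q_shift b v \<in> {-1/b..1}" "level b (q_shift b v) = v" by auto
qed

lemma level_bounds:
  assumes "q \<in> {-1/b..1}"
  shows "level b q \<in> {0..1}"
proof -
  have "-1/b < 0" using b by simp
  then have "-1/b < 1" by linarith
  then have e: "-1/b \<in> {-1/b..1}" "1 \<in> {-1/b..1}" by auto
  have "level b q \<le> level b (-1/b)"
    using assms level_strict_antimono[OF e(1) assms] by (cases "q = -1/b") auto
  moreover have "level b 1 \<le> level b q"
    using assms level_strict_antimono[OF assms e(2)] by (cases "q = 1") auto
  ultimately show ?thesis by (simp only: level_endpoints atLeastAtMost_iff)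
qed

lemma q_shift_level:
  assumes "q \<in> {-1/b..1}"
  shows "q_shift b (level b q) = q"
  using q_shift_props[OF level_bounds[OF assms]] assms
    level_strict_antimono[of q "q_shift b (level b q)"] level_strict_antimono[of "q_shift b (level b q)" q]
  by (cases q "q_shift b (level b q)" rule: linorder_cases) auto

lemma level_le_iff:
  assumes "q \<in> {-1/b..1}" "v \<in> {0..1}"
  shows "level b q \<le> v \<longleftrightarrow> q_shift b v \<le> q"
  using q_shift_props[OF assms(2)] assms
    level_strict_antimono[of q "q_shift b v"] level_strict_antimono[of "q_shift b v" q]
  by (cases q "q_shift b v" rule: linorder_cases) auto

text \<open>The inverse of a continuous injection on a compact interval is continuous.\<close>

lemma continuous_q_shift: "continuous_on {0..1} (q_shift b)"
proof -
  have "continuous_on (level b ` {-1/b..1}) (q_shift b)"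
    by (rule continuous_on_inv) (auto intro: continuous_level q_shift_level)
  moreover have "level b ` {-1/b..1} = {0..1}"
    using level_bounds q_shift_props by (auto simp: image_iff) (metis atLeastAtMost_iff)
  ultimately show ?thesis by simp
qed

lemma C_fam_eq_kern: "C_fam b u v = (LINT t:{0..u}|lborel. kern b (q_shift b v) t)"
proof -
  have "(\<lambda>t. indicator {0..u} t *\<^sub>R kern b (q_shift b v) t) \<in> borel_measurable lborel"
    using measurable_kern by simp
  then show ?thesis
    using b by (simp add: C_fam_def C_pos_def h_fam_def kern_def[symmetric] set_lebesgue_integral_def integral_completion)
qed

lemma section_density_C_fam: "section_density (\<lambda>u. C_fam b u v) (kern b (q_shift b v))"
  by (simp add: section_density_def measurable_kern kern_bounds C_fam_eq_kern)

text \<open>Conditional quantile transform: for y in [0, 1], \<open>level b\<close> at (1 - t)^2 - y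
  / b is at most v exactly when q = \<open>q_shift b v\<close> is at most (1 - t)^2 - y / b, that
  is, when y <= b ((1 - t)^2 - q). The measure of these y is the clipped right-hand side.\<close>

lemma copula_C_fam: "copula (C_fam b)"
proof (rule kernel_copula)
  have "level b \<in> borel_measurable borel"
    by (rule borel_measurable_continuous_onI) (rule continuous_level)
  then show "case_prod (\<lambda>t y. level b ((1 - t)\<^sup>2 - y / b)) \<in> borel_measurable (borel \<Otimes>\<^sub>M borel)"
    by measurable
next
  fix t v :: real assume t: "t \<in> {0..1}" and v: "v \<in> {0..1}"
  define z where "z = b * ((1 - t)\<^sup>2 - q_shift b v)"
  have "level b ((1 - t)\<^sup>2 - y / b) \<le> v \<longleftrightarrow> y \<le> z" if y: "y \<in> {0..1}" for y
  proof -
    have "0 \<le> (1 - t)\<^sup>2" "(1 - t)\<^sup>2 \<le> 1" using t by (auto simp: power_le_one)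
    moreover have "0 \<le> y / b" "y / b \<le> 1 / b" using y b by (auto simp: divide_right_mono)
    moreover have "-1/b = - (1 / b)" by simp
    ultimately have "(1 - t)\<^sup>2 - y / b \<in> {-1/b..1}"
      unfolding atLeastAtMost_iff by linarith
    from level_le_iff[OF this v]
    have "level b ((1 - t)\<^sup>2 - y / b) \<le> v \<longleftrightarrow> y / b \<le> (1 - t)\<^sup>2 - q_shift b v"
      by auto
    also have "\<dots> \<longleftrightarrow> y \<le> z"
      using b by (simp add: z_def pos_divide_le_eq mult.commute)
    finally show ?thesis .
  qed
  then have "{y \<in> {0..1}. level b ((1 - t)\<^sup>2 - y / b) \<le> v} = (if z < 0 then {} else {0..min z 1})"
    by auto
  then show "measure lborel {y \<in> {0..1}. level b ((1 - t)\<^sup>2 - y / b) \<le> v} = kern b (q_shift b v) t"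
    by (auto simp: kern_def clip_def z_def[symmetric])
next
  fix v :: real assume v: "v \<in> {0..1}"
  show "(LINT t:{0..1}|lborel. kern b (q_shift b v) t) = v"
    using set_integral_lebesgue_continuous(3)[OF level_has_integral[OF q_shift_props(1)[OF v]] continuous_kern]
      q_shift_props(2)[OF v] by simp
qed (simp add: C_fam_eq_kern)

end

section \<open>Pointwise optimality and the supporting lines\<close>

lemma clip_optimal:
  fixes b p h k :: real
  assumes "0 < b" "0 \<le> h" "h \<le> 1" and k: "k = clip (b * p) 0 1"
  shows "(h - k)\<^sup>2 / b \<le> (2 * p * k - k\<^sup>2 / b) - (2 * p * h - h\<^sup>2 / b)"
proof -
  \<comment> \<open>\<open>k\<close> is the projection of b * p onto [0, 1]; this is the variational
    inequality of that projection.\<close>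
  have "0 \<le> (k - h) * (b * p - k)"
  proof -
    consider "b * p \<le> 0" | "0 < b * p" "b * p < 1" | "1 \<le> b * p" by linarith
    then show ?thesis
    proof cases
      case 1
      then have "k = 0" by (simp add: k clip_def)
      then show ?thesis using 1 assms by (simp add: mult_nonneg_nonpos)
    next
      case 2
      then have "k = b * p" by (simp add: k clip_def)
      then show ?thesis by simp
    next
      case 3
      then have "k = 1" by (simp add: k clip_def)
      then show ?thesis using 3 assms by simp
    qed
  qed
  \<comment> \<open>Completing the square: the excess over (h - k)^2 / b is 2 / b times the product
    just bounded.\<close>
  moreover have "(2 * p * k - k\<^sup>2 / b) - (2 * p * h - h\<^sup>2 / b) - (h - k)\<^sup>2 / b = 2 * ((k - h) * (b * p - k)) / b"
    using assms(1) by (simp add: field_simps power2_eq_square)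
  ultimately show ?thesis
    using assms(1) by (smt (verit) divide_nonneg_pos)
qed

lemma copula_continuous_section:
  assumes "copula C" "u \<in> {0..1}"
  shows "continuous_on {0..1} (C u)"
proof -
  obtain G :: "real \<Rightarrow> real \<Rightarrow> real" where
    "case_prod G \<in> borel_measurable borel"
    and GC: "\<And>u v. \<lbrakk>u \<in> {0..1}; v \<in> {0..1}\<rbrakk> \<Longrightarrow> C u v = G u v"
    and "\<And>u u' v. u \<le> u' \<Longrightarrow> 0 \<le> G u' v - G u v \<and> G u' v - G u v \<le> u' - u"
    and G2: "\<And>u v v'. v \<le> v' \<Longrightarrow> 0 \<le> G u v' - G u v \<and> G u v' - G u v \<le> v' - v"
    by (rule copula_extend[OF assms(1)]) (rule that, assumption+)
  have "\<bar>G u x - G u y\<bar> \<le> \<bar>x - y\<bar>" for x y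
    using G2[of x y u] G2[of y x u] by (cases "x \<le> y") auto
  then have "1-lipschitz_on {0..1} (G u)"
    by (auto intro!: lipschitz_onI simp: dist_real_def)
  then have "continuous_on {0..1} (G u)"
    by (rule lipschitz_on_continuous_on)
  moreover have "continuous_on {0..1} (C u) = continuous_on {0..1} (G u)"
    using GC assms(2) by (intro continuous_on_cong) auto
  ultimately show ?thesis by simp
qed

text \<open>Both sides are continuous in v by the Lipschitz bound, and a continuous nonnegative
  function with vanishing integral is 0 everywhere.\<close>

lemma copula_eq_AE:
  assumes C: "copula C" and D: "copula D"
    and ae: "AE v in lebesgue. v \<in> {0..1} \<longrightarrow> (\<forall>u\<in>{0..1}. C u v = D u v)"
    and u: "u \<in> {0..1}" and v: "v \<in> {0..1}"
  shows "C u v = D u v"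
proof -
  let ?f = "\<lambda>w. \<bar>C u w - D u w\<bar>"
  have cont: "continuous_on {0..1} ?f"
    by (intro continuous_intros copula_continuous_section C D u)
  then have "?f integrable_on {0..1}"
    by (rule integrable_continuous_real)
  then have I: "(?f has_integral integral {0..1} ?f) {0..1}"
    by (rule integrable_integral)
  have "(LINT w:{0..1}|lebesgue. ?f w) = 0"
    unfolding set_lebesgue_integral_def
    by (rule integral_eq_zero_AE) (use ae u in \<open>auto elim!: eventually_mono simp: indicator_def\<close>)
  then have "integral {0..1} ?f = 0"
    using set_integral_lebesgue_continuous(1)[OF I cont] by simp
  then have "?f v = 0"
    using I v cont by (intro has_integral_0_cbox_imp_0[of 0 1 ?f v]) auto
  then show ?thesis by simp
qed

context
  fixes b :: real
  assumes b: "0 < b"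
begin

text \<open>\<open>clip_optimal\<close> with p = (1 - t)^2 - q, integrated over t. The multiplier
  enters only through \<open>J3\<close>, which integrates to 0 because both densities have mean v.
  The factor 4 appears because \<open>wt_int\<close> is half the weighted integral.\<close>

lemma section_optimal:
  assumes D: "copula D" and v: "v \<in> {0..1}" and h: "section_density (\<lambda>u. D u v) h"
  shows "(LINT t:{0..1}|lborel. (h t - kern b (q_shift b v) t)\<^sup>2) / b \<le>
    (4 * wt_int (C_fam b) v - sq_int (C_fam b) v / b) - (4 * wt_int D v - sq_int D v / b)"
proof -
  define k where "k = kern b (q_shift b v)"
  define q where "q = q_shift b v"
  have k: "section_density (\<lambda>u. C_fam b u v) k"
    unfolding k_def by (rule section_density_C_fam[OF b])
  note ih = section_densityD(5)[OF h, of 0 1] section_density_integrable[OF h]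
  note ik = section_densityD(5)[OF k, of 0 1] section_density_integrable[OF k]
  note i = section_density_diff_square[OF h k]
  define J1 where "J1 = (\<lambda>t. 2 * ((1 - t)\<^sup>2 * k t) - (k t)\<^sup>2 / b)"
  define J2 where "J2 = (\<lambda>t. 2 * ((1 - t)\<^sup>2 * h t) - (h t)\<^sup>2 / b)"
  define J3 where "J3 = (\<lambda>t. 2 * q * k t - 2 * q * h t)"
  have J: "set_integrable lborel {0..1} J1" "set_integrable lborel {0..1} J2" "set_integrable lborel {0..1} J3"
    unfolding J1_def J2_def J3_def using ih ik by (auto intro!: set_integral_diff)
  have "(LINT t:{0..1}|lborel. (h t - k t)\<^sup>2 / b) \<le> (LINT t:{0..1}|lborel. J1 t - J2 t - J3 t)"
  proof (rule set_integral_mono)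
    fix t
    have "(h t - k t)\<^sup>2 / b \<le> (2 * ((1 - t)\<^sup>2 - q) * k t - (k t)\<^sup>2 / b) - (2 * ((1 - t)\<^sup>2 - q) * h t - (h t)\<^sup>2 / b)"
      by (rule clip_optimal) (use b section_densityD(2,3)[OF h] in \<open>auto simp: k_def q_def kern_def\<close>)
    also have "\<dots> = J1 t - J2 t - J3 t"
      by (simp add: J1_def J2_def J3_def algebra_simps)
    finally show "(h t - k t)\<^sup>2 / b \<le> J1 t - J2 t - J3 t" .
  qed (use i J in \<open>auto intro!: set_integral_diff\<close>)
  also have "\<dots> = (LINT t:{0..1}|lborel. J1 t) - (LINT t:{0..1}|lborel. J2 t) - (LINT t:{0..1}|lborel. J3 t)"
    using J by (simp add: set_integral_diff)
  also have "(LINT t:{0..1}|lborel. J1 t) = 4 * wt_int (C_fam b) v - sq_int (C_fam b) v / b"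
    unfolding J1_def using ik
    by (simp add: set_integral_diff wt_int_density[of "C_fam b" v k, OF k] sq_int_density[of "C_fam b" v k, OF k])
  also have "(LINT t:{0..1}|lborel. J2 t) = 4 * wt_int D v - sq_int D v / b"
    unfolding J2_def using ih
    by (simp add: set_integral_diff wt_int_density[of D v h, OF h] sq_int_density[of D v h, OF h])
  also have "(LINT t:{0..1}|lborel. J3 t) = 0"
    unfolding J3_def using ih ik
    by (simp add: set_integral_diff section_density_mass[of D, OF D v h] section_density_mass[of "C_fam b", OF copula_C_fam[OF b] v k])
  finally show ?thesis by (simp add: k_def)
qed

text \<open>6 g integrates to the difference of the two functionals, and g dominates the squared L2
  distance of the section densities divided by b. Equality makes g vanish for almost every v, so for
  these v the densities agree almost everywhere and the sections coincide; continuity in v covers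
  the remaining v.\<close>

lemma C_fam_optimal:
  assumes D: "copula D"
  shows "blest_nu D - chatterjee_xi D / b \<le> blest_nu (C_fam b) - chatterjee_xi (C_fam b) / b"
    and "\<lbrakk>blest_nu D - chatterjee_xi D / b = blest_nu (C_fam b) - chatterjee_xi (C_fam b) / b;
      u \<in> {0..1}; v \<in> {0..1}\<rbrakk> \<Longrightarrow> D u v = C_fam b u v"
proof -
  define g where "g = (\<lambda>v. (4 * wt_int (C_fam b) v - sq_int (C_fam b) v / b) - (4 * wt_int D v - sq_int D v / b))"
  note i = section_integrals_integrable[OF D] section_integrals_integrable[OF copula_C_fam[OF b]]
  have gi: "set_integrable lebesgue {0..1} g"
    unfolding g_def using i by (auto intro!: set_integral_diff)
  have "(LINT v:{0..1}|lebesgue. g v) =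
      (4 * (LINT v:{0..1}|lebesgue. wt_int (C_fam b) v) - (LINT v:{0..1}|lebesgue. sq_int (C_fam b) v) / b) -
      (4 * (LINT v:{0..1}|lebesgue. wt_int D v) - (LINT v:{0..1}|lebesgue. sq_int D v) / b)"
    unfolding g_def using i by (simp add: set_integral_diff)
  then have G: "6 * (LINT v:{0..1}|lebesgue. g v) =
      (blest_nu (C_fam b) - chatterjee_xi (C_fam b) / b) - (blest_nu D - chatterjee_xi D / b)"
    using b by (simp add: blest_nu_eq chatterjee_xi_eq field_simps)
  have g: "(LINT t:{0..1}|lborel. (h t - kern b (q_shift b v) t)\<^sup>2) / b \<le> g v"
    if "v \<in> {0..1}" "section_density (\<lambda>u. D u v) h" for v h
    using section_optimal[OF D that] by (simp add: g_def)
  have g0: "0 \<le> g v" if v: "v \<in> {0..1}" for v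
  proof -
    obtain h where h: "section_density (\<lambda>u. D u v) h"
      using copula_section_density[OF D v] by blast
    have "0 \<le> (LINT t:{0..1}|lborel. (h t - kern b (q_shift b v) t)\<^sup>2) / b"
      unfolding set_lebesgue_integral_def using b by (intro divide_nonneg_pos integral_nonneg_AE) auto
    with g[OF v h] show ?thesis by simp
  qed
  then have pos: "AE v in lebesgue. 0 \<le> indicator {0..1} v *\<^sub>R g v"
    by (intro AE_I2) (auto simp: indicator_def)
  have "0 \<le> (LINT v:{0..1}|lebesgue. g v)"
    unfolding set_lebesgue_integral_def by (rule integral_nonneg_AE) (rule pos)
  with G show "blest_nu D - chatterjee_xi D / b \<le> blest_nu (C_fam b) - chatterjee_xi (C_fam b) / b"
    by simp
  assume eq: "blest_nu D - chatterjee_xi D / b = blest_nu (C_fam b) - chatterjee_xi (C_fam b) / b"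
    and uv: "u \<in> {0..1}" "v \<in> {0..1}"
  have "(LINT v:{0..1}|lebesgue. g v) = 0" using G eq by simp
  then have "AE v in lebesgue. indicator {0..1} v *\<^sub>R g v = 0"
    using integral_nonneg_eq_0_iff_AE[OF _ pos] gi by (simp add: set_lebesgue_integral_def set_integrable_def)
  then have "AE v in lebesgue. v \<in> {0..1} \<longrightarrow> (\<forall>u\<in>{0..1}. D u v = C_fam b u v)"
  proof eventually_elim
    case (elim v)
    show ?case
    proof (intro impI ballI)
      fix u :: real assume v: "v \<in> {0..1}" and u: "u \<in> {0..1}"
      obtain h where h: "section_density (\<lambda>u. D u v) h"
        using copula_section_density[OF D v] by blast
      define k where "k = kern b (q_shift b v)"
      have k: "section_density (\<lambda>u. C_fam b u v) k"
        unfolding k_def by (rule section_density_C_fam[OF b])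
      have [measurable]: "h \<in> borel_measurable borel" "k \<in> borel_measurable borel"
        using section_densityD(1)[OF h] section_densityD(1)[OF k] by auto
      note i = section_density_diff_square[OF h k]
      have p: "AE t in lborel. 0 \<le> indicator {0..1} t *\<^sub>R (h t - k t)\<^sup>2"
        by (intro AE_I2) auto
      have "g v = 0" using elim v by simp
      with g[OF v h] b have "(LINT t:{0..1}|lborel. (h t - k t)\<^sup>2) \<le> 0"
        by (simp add: k_def divide_le_0_iff)
      moreover have "0 \<le> (LINT t:{0..1}|lborel. (h t - k t)\<^sup>2)"
        unfolding set_lebesgue_integral_def by (rule integral_nonneg_AE) (rule p)
      ultimately have "(LINT t:{0..1}|lborel. (h t - k t)\<^sup>2) = 0" by simp
      then have "AE t in lborel. indicator {0..1} t *\<^sub>R (h t - k t)\<^sup>2 = 0"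
        using integral_nonneg_eq_0_iff_AE[OF _ p] i by (simp add: set_lebesgue_integral_def set_integrable_def)
      then have ae: "AE t in lborel. indicator {0..u} t *\<^sub>R h t = indicator {0..u} t *\<^sub>R k t"
        by eventually_elim (use u in \<open>auto simp: indicator_def split: if_splits\<close>)
      have "(LINT t:{0..u}|lborel. h t) = (LINT t:{0..u}|lborel. k t)"
        unfolding set_lebesgue_integral_def by (rule integral_cong_AE[OF _ _ ae]) measurable
      then show "D u v = C_fam b u v"
        using section_densityD(4)[OF h u] section_densityD(4)[OF k u] by simp
    qed
  qed
  from copula_eq_AE[OF D copula_C_fam[OF b] this uv] show "D u v = C_fam b u v" .
qed

end

section \<open>Closed forms of \<open>\<xi>\<close> and \<open>\<nu>\<close> on the family\<close>

text \<open>The integral of (1 - t)^2 \<open>kern b q t\<close> over t in [0, 1], for q in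
  [-1/b, 1]; \<open>kern_sq\<close> below is that of the squared kernel.\<close>

definition kern_wt :: "real \<Rightarrow> real \<Rightarrow> real" where
  "kern_wt b q = (1 - hi b q ^ 3) / 3 + b * ((hi b q ^ 5 - lo q ^ 5) / 5 - q * (hi b q ^ 3 - lo q ^ 3) / 3)"

definition kern_sq :: "real \<Rightarrow> real \<Rightarrow> real" where
  "kern_sq b q = 1 - hi b q +
     b\<^sup>2 * ((hi b q ^ 5 - lo q ^ 5) / 5 - 2 * q * (hi b q ^ 3 - lo q ^ 3) / 3 + q\<^sup>2 * (hi b q - lo q))"

lemma continuous_kern_integrals: "continuous_on S (kern_wt b)" "continuous_on S (kern_sq b)"
  unfolding kern_wt_def kern_sq_def lo_def hi_def by (auto intro!: continuous_intros)

text \<open>Differentiation lowers the exponent of a square root power by 2, so antiderivatives that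
  are polynomials in sqrt q or sqrt (q + 1/b) can be checked by polynomial algebra.\<close>

lemma DERIV_sqrt_power:
  fixes q d :: real
  assumes "0 < q + d" and m: "m = n + 2" and D: "D = real m / 2 * sqrt (q + d) ^ n"
  shows "((\<lambda>q. sqrt (q + d) ^ m) has_real_derivative D) (at q)"
proof -
  have s: "0 < sqrt (q + d)" using assms by simp
  have "((\<lambda>q. sqrt (q + d)) has_real_derivative inverse (sqrt (q + d)) / 2) (at q)"
    using assms(1) by (auto intro!: derivative_eq_intros)
  from DERIV_power[OF this, of m]
  have "((\<lambda>q. sqrt (q + d) ^ m) has_real_derivative
      (real m * (inverse (sqrt (q + d)) / 2 * sqrt (q + d) ^ Suc n))) (at q)"
    by (simp add: m)
  also have "real m * (inverse (sqrt (q + d)) / 2 * sqrt (q + d) ^ Suc n) = D"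
    using s by (simp add: D field_simps)
  finally show ?thesis .
qed

lemma DERIV_sqrt_power0:
  fixes q :: real
  assumes "0 < q" "m = n + 2" "D = real m / 2 * sqrt q ^ n"
  shows "((\<lambda>q. sqrt q ^ m) has_real_derivative D) (at q)"
  by (rule DERIV_sqrt_power[of q 0 m n D, unfolded add_0_right]) (rule assms)+

text \<open>Either \<open>lo\<close> is locally constant or lo^2 = q; the product condition records
  both cases at once. It says that the unclipped kernel is 0 at this breakpoint whenever the
  breakpoint moves.\<close>

lemma DERIV_lo:
  assumes "q \<noteq> 0"
  shows "\<exists>d. (lo has_real_derivative d) (at q) \<and> d * ((lo q)\<^sup>2 - q) = 0"
proof (cases "q < 0")
  case True
  have "(lo has_real_derivative 0) (at q)"
    by (rule has_field_derivative_transform_within_open[where f = "\<lambda>_. 0" and S = "{..<0}"])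
      (use True in \<open>auto simp: lo_def\<close>)
  then show ?thesis by auto
next
  case False
  then have q: "0 < q" using assms by simp
  have "(lo has_real_derivative (inverse (sqrt q) / 2)) (at q)"
    by (rule has_field_derivative_transform_within_open[where f = sqrt and S = "{0<..}"])
      (use q in \<open>auto simp: lo_def intro!: derivative_eq_intros\<close>)
  then show ?thesis using q by (auto simp: lo_def)
qed

section \<open>Substituting \<open>v = level b q\<close>\<close>

context
  fixes b :: real
  assumes b: "0 < b"
begin

text \<open>The counterpart at the other breakpoint: where \<open>hi\<close> moves, the unclipped
  kernel equals 1.\<close>

lemma DERIV_hi:
  assumes "- 1 / b < q" "q \<noteq> 1 - 1 / b"
  shows "\<exists>d. (hi b has_real_derivative d) (at q) \<and> d * (b * ((hi b q)\<^sup>2 - q) - 1) = 0"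
proof (cases "q < 1 - 1 / b")
  case True
  have "(hi b has_real_derivative (inverse (sqrt (q + 1 / b)) / 2)) (at q)"
    by (rule has_field_derivative_transform_within_open[where f = "\<lambda>q. sqrt (q + 1 / b)" and S = "{-1/b<..<1 - 1/b}"])
      (use True assms in \<open>auto simp: hi_def intro!: derivative_eq_intros\<close>)
  moreover have "b * ((hi b q)\<^sup>2 - q) = 1"
    using True assms b by (simp add: hi_def algebra_simps)
  ultimately show ?thesis by auto
next
  case False
  have "(hi b has_real_derivative 0) (at q)"
    by (rule has_field_derivative_transform_within_open[where f = "\<lambda>_. 1" and S = "{1 - 1/b<..}"])
      (use False assms in \<open>auto simp: hi_def\<close>)
  then show ?thesis by auto
qed

text \<open>By the two product conditions the moving breakpoints contribute nothing, reflecting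
  continuity of the kernel across them. What remains is the q-derivative -b of the unclipped kernel
  times the length hi - lo of its range.\<close>

lemma DERIV_level:
  assumes "- 1 / b < q" "q \<noteq> 0" "q \<noteq> 1 - 1 / b"
  shows "(level b has_real_derivative (- b * (hi b q - lo q))) (at q)"
proof -
  obtain l where l: "(lo has_real_derivative l) (at q)" "l * ((lo q)\<^sup>2 - q) = 0"
    using DERIV_lo assms by blast
  obtain r where r: "(hi b has_real_derivative r) (at q)" "r * (b * ((hi b q)\<^sup>2 - q) - 1) = 0"
    using DERIV_hi assms by blast
  have "(level b has_real_derivative
      (- r + b * ((3 * (hi b q)\<^sup>2 * r - 3 * (lo q)\<^sup>2 * l) / 3 - (1 * (hi b q - lo q) + (r - l) * q)))) (at q)"
    unfolding level_def[abs_def] by (rule derivative_eq_intros l r refl | simp)+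
  also have "(- r + b * ((3 * (hi b q)\<^sup>2 * r - 3 * (lo q)\<^sup>2 * l) / 3 - (1 * (hi b q - lo q) + (r - l) * q))) =
      - b * (hi b q - lo q) + r * (b * ((hi b q)\<^sup>2 - q) - 1) - b * (l * ((lo q)\<^sup>2 - q))"
    by (simp add: field_simps)
  finally show ?thesis using l r by simp
qed

lemma integral_q_shift:
  fixes f :: "real \<Rightarrow> real"
  assumes f: "continuous_on {-1/b..1} f"
    and I: "((\<lambda>q. b * (hi b q - lo q) * f q) has_integral I) {-1/b..1}"
  shows "(LINT v:{0..1}|lebesgue. f (q_shift b v)) = I"
proof -
  have cont: "continuous_on {0..1} (\<lambda>v. f (q_shift b v))"
    by (rule continuous_on_compose2[OF f continuous_q_shift[OF b]]) (use q_shift_props[OF b] in auto)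
  have lt: "-1/b < 0" using b by simp
  have "((\<lambda>q. (- b * (hi b q - lo q)) *\<^sub>R f (q_shift b (level b q))) has_integral
     (integral {level b (-1/b)..level b 1} (\<lambda>v. f (q_shift b v)) - integral {level b 1..level b (-1/b)} (\<lambda>v. f (q_shift b v)))) {-1/b..1}"
  proof (rule has_integral_substitution_general[where s = "{-1/b, 0, 1 - 1/b}" and c = 0 and d = 1])
    show "-1/b \<le> 1" using lt by linarith
    show "level b ` {-1/b..1} \<subseteq> {0..1}" using level_bounds[OF b] by auto
    fix q assume "q \<in> {-1/b..1} - {-1/b, 0, 1 - 1/b}"
    then have "(level b has_real_derivative (- b * (hi b q - lo q))) (at q)"
      by (intro DERIV_level) auto
    then show "(level b has_real_derivative (- b * (hi b q - lo q))) (at q within {-1/b..1})"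
      by (rule has_field_derivative_at_within)
  qed (use cont continuous_level in auto)
  then have "((\<lambda>q. (- b * (hi b q - lo q)) *\<^sub>R f (q_shift b (level b q))) has_integral
     (- integral {0..1} (\<lambda>v. f (q_shift b v)))) {-1/b..1}"
    by (simp add: level_endpoints[OF b, simplified])
  moreover have "((\<lambda>q. - (b * (hi b q - lo q) * f q)) has_integral - I) {-1/b..1}"
    by (rule has_integral_neg[OF I])
  then have "((\<lambda>q. (- b * (hi b q - lo q)) *\<^sub>R f (q_shift b (level b q))) has_integral - I) {-1/b..1}"
    by (rule has_integral_eq[rotated]) (simp add: q_shift_level[OF b] algebra_simps)
  ultimately have "- integral {0..1} (\<lambda>v. f (q_shift b v)) = - I"
    by (rule has_integral_unique)
  then show ?thesis
    using set_integral_lebesgue_continuous(1)[OF integrable_integral[OF integrable_continuous_real[OF cont]] cont] by simp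
qed

lemma xi_nu_C_fam:
  assumes "((\<lambda>q. b * (hi b q - lo q) * kern_wt b q) has_integral I) {-1/b..1}"
    and "((\<lambda>q. b * (hi b q - lo q) * kern_sq b q) has_integral J) {-1/b..1}"
  shows "blest_nu (C_fam b) = 12 * I - 2" "chatterjee_xi (C_fam b) = 6 * J - 2"
proof -
  have wt: "wt_int (C_fam b) v = kern_wt b (q_shift b v) / 2" and sq: "sq_int (C_fam b) v = kern_sq b (q_shift b v)"
    if v: "v \<in> {0..1}" for v
  proof -
    note q = q_shift_props(1)[OF b v]
    note k = section_density_C_fam[OF b, of v]
    have c: "continuous_on {0..1} (\<lambda>t. (1 - t)\<^sup>2 * kern b (q_shift b v) t)"
      "continuous_on {0..1} (\<lambda>t. (kern b (q_shift b v) t)\<^sup>2)"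
      by (intro continuous_intros continuous_kern)+
    show "wt_int (C_fam b) v = kern_wt b (q_shift b v) / 2"
      using set_integral_lebesgue_continuous(3)[OF kern_weighted_has_integral[OF b q] c(1)]
      by (simp add: wt_int_density[of "C_fam b" v, OF k] kern_wt_def)
    show "sq_int (C_fam b) v = kern_sq b (q_shift b v)"
      using set_integral_lebesgue_continuous(3)[OF kern_square_has_integral[OF b q] c(2)]
      by (simp add: sq_int_density[of "C_fam b" v, OF k] kern_sq_def)
  qed
  have "(LINT v:{0..1}|lebesgue. wt_int (C_fam b) v) = (LINT v:{0..1}|lebesgue. kern_wt b (q_shift b v) / 2)"
    using wt by (intro set_lebesgue_integral_cong) auto
  also have "\<dots> = I / 2"
    using integral_q_shift[OF continuous_kern_integrals(1) assms(1)] by simp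
  finally show "blest_nu (C_fam b) = 12 * I - 2" by (simp add: blest_nu_eq)
  have "(LINT v:{0..1}|lebesgue. sq_int (C_fam b) v) = (LINT v:{0..1}|lebesgue. kern_sq b (q_shift b v))"
    using sq by (intro set_lebesgue_integral_cong) auto
  also have "\<dots> = J"
    using integral_q_shift[OF continuous_kern_integrals(2) assms(2)] by simp
  finally show "chatterjee_xi (C_fam b) = 6 * J - 2" by (simp add: chatterjee_xi_eq)
qed

end

section \<open>Antiderivatives on the ranges of q between breakpoints\<close>

context
  fixes b :: real
  assumes b: "0 < b"
begin

text \<open>Here lo = 0 and hi = c = sqrt (q + 1/b). Writing q = c^2 - 1/b makes the integrands
  polynomials in c. The endpoint r stays general: it will be 1 - 1/b for b <= 1 and 0 for b >
  1.\<close>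

lemma piece_left:
  assumes "- 1 / b \<le> r" "r \<le> 0" "r \<le> 1 - 1 / b"
  defines "c \<equiv> sqrt (r + 1 / b)"
  shows "((\<lambda>q. b * (hi b q - lo q) * kern_wt b q) has_integral (2 * b * c ^ 3 / 9 - b\<^sup>2 * c ^ 8 / 30)) {-1/b..r}"
    and "((\<lambda>q. b * (hi b q - lo q) * kern_sq b q) has_integral
      (2 * b * c ^ 3 / 3 - 4 * b\<^sup>2 * c ^ 6 / 9 + 2 * b ^ 3 * c ^ 8 / 15)) {-1/b..r}"
proof -
  let ?c = "\<lambda>q. sqrt (q + 1 / b)"
  have *: "lo q = 0" "hi b q = ?c q" "q = (?c q)\<^sup>2 - 1 / b" if "q \<in> {-1/b<..<r}" for q
    using that assms by (auto simp: lo_def hi_def)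
  have p: "0 < q + 1 / b" if "q \<in> {-1/b<..<r}" for q using that by auto
  have D3: "((\<lambda>q. ?c q ^ 3) has_real_derivative (3 / 2 * ?c q)) (at q)" if "q \<in> {-1/b<..<r}" for q
    by (rule DERIV_sqrt_power[where n = 1]) (use p[OF that] in simp_all)
  have D6: "((\<lambda>q. ?c q ^ 6) has_real_derivative (3 * ?c q ^ 4)) (at q)" if "q \<in> {-1/b<..<r}" for q
    by (rule DERIV_sqrt_power[where n = 4]) (use p[OF that] in simp_all)
  have D8: "((\<lambda>q. ?c q ^ 8) has_real_derivative (4 * ?c q ^ 6)) (at q)" if "q \<in> {-1/b<..<r}" for q
    by (rule DERIV_sqrt_power[where n = 6]) (use p[OF that] in simp_all)
  have wt: "b * (hi b q - lo q) * kern_wt b q = 2 * b * (3 / 2 * ?c q) / 9 - b\<^sup>2 * (4 * ?c q ^ 6) / 30"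
    if "q \<in> {-1/b<..<r}" for q
  proof -
    define c where "c = ?c q"
    have qe: "q = c\<^sup>2 - 1 / b" using *(3)[OF that] by (simp add: c_def)
    show ?thesis
      unfolding kern_wt_def *(1,2)[OF that] c_def[symmetric]
      unfolding qe using b by (simp add: field_simps eval_nat_numeral)
  qed
  have sq: "b * (hi b q - lo q) * kern_sq b q =
      2 * b * (3 / 2 * ?c q) / 3 - 4 * b\<^sup>2 * (3 * ?c q ^ 4) / 9 + 2 * b ^ 3 * (4 * ?c q ^ 6) / 15"
    if "q \<in> {-1/b<..<r}" for q
  proof -
    define c where "c = ?c q"
    have qe: "q = c\<^sup>2 - 1 / b" using *(3)[OF that] by (simp add: c_def)
    show ?thesis
      unfolding kern_sq_def *(1,2)[OF that] c_def[symmetric]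
      unfolding qe using b by (simp add: field_simps eval_nat_numeral)
  qed
  have "((\<lambda>q. b * (hi b q - lo q) * kern_wt b q) has_integral
      ((2 * b * ?c r ^ 3 / 9 - b\<^sup>2 * ?c r ^ 8 / 30) - (2 * b * ?c (-1/b) ^ 3 / 9 - b\<^sup>2 * ?c (-1/b) ^ 8 / 30))) {-1/b..r}"
  proof (rule fundamental_theorem_of_calculus_interior)
    fix q assume q: "q \<in> {-1/b<..<r}"
    show "((\<lambda>q. 2 * b * ?c q ^ 3 / 9 - b\<^sup>2 * ?c q ^ 8 / 30) has_vector_derivative b * (hi b q - lo q) * kern_wt b q) (at q)"
      unfolding has_real_derivative_iff_has_vector_derivative[symmetric] wt[OF q]
      by (intro DERIV_diff DERIV_cdivide DERIV_cmult D3[OF q] D8[OF q])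
  qed (use assms in \<open>auto intro!: continuous_intros\<close>)
  then show "((\<lambda>q. b * (hi b q - lo q) * kern_wt b q) has_integral (2 * b * c ^ 3 / 9 - b\<^sup>2 * c ^ 8 / 30)) {-1/b..r}"
    by (simp add: c_def)
  have "((\<lambda>q. b * (hi b q - lo q) * kern_sq b q) has_integral
      ((2 * b * ?c r ^ 3 / 3 - 4 * b\<^sup>2 * ?c r ^ 6 / 9 + 2 * b ^ 3 * ?c r ^ 8 / 15) -
       (2 * b * ?c (-1/b) ^ 3 / 3 - 4 * b\<^sup>2 * ?c (-1/b) ^ 6 / 9 + 2 * b ^ 3 * ?c (-1/b) ^ 8 / 15))) {-1/b..r}"
  proof (rule fundamental_theorem_of_calculus_interior)
    fix q assume q: "q \<in> {-1/b<..<r}"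
    show "((\<lambda>q. 2 * b * ?c q ^ 3 / 3 - 4 * b\<^sup>2 * ?c q ^ 6 / 9 + 2 * b ^ 3 * ?c q ^ 8 / 15)
        has_vector_derivative b * (hi b q - lo q) * kern_sq b q) (at q)"
      unfolding has_real_derivative_iff_has_vector_derivative[symmetric] sq[OF q]
      by (intro DERIV_diff DERIV_add DERIV_cdivide DERIV_cmult D3[OF q] D6[OF q] D8[OF q])
  qed (use assms in \<open>auto intro!: continuous_intros\<close>)
  then show "((\<lambda>q. b * (hi b q - lo q) * kern_sq b q) has_integral
      (2 * b * c ^ 3 / 3 - 4 * b\<^sup>2 * c ^ 6 / 9 + 2 * b ^ 3 * c ^ 8 / 15)) {-1/b..r}"
    by (simp add: c_def)
qed

text \<open>Here hi = 1 and lo = a = sqrt q, so the integrands are polynomials in a. The endpoint r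
  will be 0 for b <= 1 and 1 - 1/b for b > 1.\<close>

lemma piece_right:
  assumes "0 \<le> r" "1 - 1 / b \<le> r" "r \<le> 1"
  defines "F \<equiv> \<lambda>a. b\<^sup>2 * (a ^ 2 / 5 - 2 * a ^ 3 / 15 - a ^ 4 / 6 + 2 * a ^ 5 / 15 + 4 * a ^ 7 / 105 - a ^ 8 / 30)"
    and "G \<equiv> \<lambda>a. b ^ 3 * (a ^ 2 / 5 - 2 * a ^ 3 / 15 - a ^ 4 / 3 + 4 * a ^ 5 / 15 + a ^ 6 / 3 - 46 * a ^ 7 / 105 + 2 * a ^ 8 / 15)"
  shows "((\<lambda>q. b * (hi b q - lo q) * kern_wt b q) has_integral (F 1 - F (sqrt r))) {r..1}"
    and "((\<lambda>q. b * (hi b q - lo q) * kern_sq b q) has_integral (G 1 - G (sqrt r))) {r..1}"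
proof -
  have *: "lo q = sqrt q" "hi b q = 1" "q = (sqrt q)\<^sup>2" "0 < q" if "q \<in> {r<..<1}" for q
    using that assms by (auto simp: lo_def hi_def)
  have D2: "((\<lambda>q. sqrt q ^ 2) has_real_derivative (1)) (at q)" if "q \<in> {r<..<1}" for q
    by (rule DERIV_sqrt_power0[where n = 0]) (use *(4)[OF that] in simp_all)
  have D3: "((\<lambda>q. sqrt q ^ 3) has_real_derivative (3 / 2 * sqrt q)) (at q)" if "q \<in> {r<..<1}" for q
    by (rule DERIV_sqrt_power0[where n = 1]) (use *(4)[OF that] in simp_all)
  have D4: "((\<lambda>q. sqrt q ^ 4) has_real_derivative (2 * sqrt q ^ 2)) (at q)" if "q \<in> {r<..<1}" for q
    by (rule DERIV_sqrt_power0[where n = 2]) (use *(4)[OF that] in simp_all)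
  have D5: "((\<lambda>q. sqrt q ^ 5) has_real_derivative (5 / 2 * sqrt q ^ 3)) (at q)" if "q \<in> {r<..<1}" for q
    by (rule DERIV_sqrt_power0[where n = 3]) (use *(4)[OF that] in simp_all)
  have D6: "((\<lambda>q. sqrt q ^ 6) has_real_derivative (3 * sqrt q ^ 4)) (at q)" if "q \<in> {r<..<1}" for q
    by (rule DERIV_sqrt_power0[where n = 4]) (use *(4)[OF that] in simp_all)
  have D7: "((\<lambda>q. sqrt q ^ 7) has_real_derivative (7 / 2 * sqrt q ^ 5)) (at q)" if "q \<in> {r<..<1}" for q
    by (rule DERIV_sqrt_power0[where n = 5]) (use *(4)[OF that] in simp_all)
  have D8: "((\<lambda>q. sqrt q ^ 8) has_real_derivative (4 * sqrt q ^ 6)) (at q)" if "q \<in> {r<..<1}" for q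
    by (rule DERIV_sqrt_power0[where n = 6]) (use *(4)[OF that] in simp_all)
  have "((\<lambda>q. b * (hi b q - lo q) * kern_wt b q) has_integral (F (sqrt 1) - F (sqrt r))) {r..1}"
  proof (rule fundamental_theorem_of_calculus_interior)
    fix q assume q: "q \<in> {r<..<1}"
    have "((\<lambda>q. F (sqrt q)) has_real_derivative
       (b\<^sup>2 * (1 / 5 - 2 * (3 / 2 * sqrt q) / 15 - (2 * sqrt q ^ 2) / 6 + 2 * (5 / 2 * sqrt q ^ 3) / 15
         + 4 * (7 / 2 * sqrt q ^ 5) / 105 - (4 * sqrt q ^ 6) / 30))) (at q)" (is "(_ has_real_derivative ?D) _")
      unfolding F_def
      by (intro DERIV_diff DERIV_add DERIV_cdivide DERIV_cmult D2[OF q] D3[OF q] D4[OF q] D5[OF q] D6[OF q] D7[OF q] D8[OF q])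
    also have "?D = b * (hi b q - lo q) * kern_wt b q"
    proof -
      define a where "a = sqrt q"
      have qe: "q = a\<^sup>2" using *(3)[OF q] by (simp add: a_def)
      show ?thesis
        unfolding kern_wt_def *(1,2)[OF q] a_def[symmetric] unfolding qe by (simp add: field_simps eval_nat_numeral)
    qed
    finally show "((\<lambda>q. F (sqrt q)) has_vector_derivative b * (hi b q - lo q) * kern_wt b q) (at q)"
      by (simp add: has_real_derivative_iff_has_vector_derivative)
  qed (use assms in \<open>auto intro!: continuous_intros\<close>)
  then show "((\<lambda>q. b * (hi b q - lo q) * kern_wt b q) has_integral (F 1 - F (sqrt r))) {r..1}" by simp
  have "((\<lambda>q. b * (hi b q - lo q) * kern_sq b q) has_integral (G (sqrt 1) - G (sqrt r))) {r..1}"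
  proof (rule fundamental_theorem_of_calculus_interior)
    fix q assume q: "q \<in> {r<..<1}"
    have "((\<lambda>q. G (sqrt q)) has_real_derivative
       (b ^ 3 * (1 / 5 - 2 * (3 / 2 * sqrt q) / 15 - (2 * sqrt q ^ 2) / 3 + 4 * (5 / 2 * sqrt q ^ 3) / 15
         + (3 * sqrt q ^ 4) / 3 - 46 * (7 / 2 * sqrt q ^ 5) / 105 + 2 * (4 * sqrt q ^ 6) / 15))) (at q)" (is "(_ has_real_derivative ?D) _")
      unfolding G_def
      by (intro DERIV_diff DERIV_add DERIV_cdivide DERIV_cmult D2[OF q] D3[OF q] D4[OF q] D5[OF q] D6[OF q] D7[OF q] D8[OF q])
    also have "?D = b * (hi b q - lo q) * kern_sq b q"
    proof -
      define a where "a = sqrt q"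
      have qe: "q = a\<^sup>2" using *(3)[OF q] by (simp add: a_def)
      show ?thesis
        unfolding kern_sq_def *(1,2)[OF q] a_def[symmetric] unfolding qe by (simp add: field_simps eval_nat_numeral)
    qed
    finally show "((\<lambda>q. G (sqrt q)) has_vector_derivative b * (hi b q - lo q) * kern_sq b q) (at q)"
      by (simp add: has_real_derivative_iff_has_vector_derivative)
  qed (use assms in \<open>auto intro!: continuous_intros\<close>)
  then show "((\<lambda>q. b * (hi b q - lo q) * kern_sq b q) has_integral (G 1 - G (sqrt r))) {r..1}" by simp
qed

text \<open>For b <= 1 the middle range has lo = 0 and hi = 1: the kernel is nowhere clipped and the
  integrands are polynomials in q.\<close>

lemma piece_middle_le1:
  assumes "b \<le> 1"
  defines "r \<equiv> 1 - 1 / b"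
  shows "((\<lambda>q. b * (hi b q - lo q) * kern_wt b q) has_integral (0 - b\<^sup>2 * (r / 5 - r\<^sup>2 / 6))) {r..0}"
    and "((\<lambda>q. b * (hi b q - lo q) * kern_sq b q) has_integral (0 - b ^ 3 * (r / 5 - r\<^sup>2 / 3 + r ^ 3 / 3))) {r..0}"
proof -
  have r: "r \<le> 0" using b assms(1) by (simp add: r_def field_simps)
  have *: "lo q = 0" "hi b q = 1" if "q \<in> {r<..<0}" for q
    using that by (auto simp: lo_def hi_def r_def)
  have "((\<lambda>q. b * (hi b q - lo q) * kern_wt b q) has_integral (b\<^sup>2 * (0 / 5 - 0\<^sup>2 / 6) - b\<^sup>2 * (r / 5 - r\<^sup>2 / 6))) {r..0}"
  proof (rule fundamental_theorem_of_calculus_interior[OF r])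
    fix q assume q: "q \<in> {r<..<0}"
    show "((\<lambda>q. b\<^sup>2 * (q / 5 - q\<^sup>2 / 6)) has_vector_derivative b * (hi b q - lo q) * kern_wt b q) (at q)"
      unfolding has_real_derivative_iff_has_vector_derivative[symmetric] kern_wt_def *[OF q]
      by (auto intro!: derivative_eq_intros simp: field_simps power2_eq_square)
  qed (auto intro!: continuous_intros)
  then show "((\<lambda>q. b * (hi b q - lo q) * kern_wt b q) has_integral (0 - b\<^sup>2 * (r / 5 - r\<^sup>2 / 6))) {r..0}" by simp
  have "((\<lambda>q. b * (hi b q - lo q) * kern_sq b q) has_integral
      (b ^ 3 * (0 / 5 - 0\<^sup>2 / 3 + 0 ^ 3 / 3) - b ^ 3 * (r / 5 - r\<^sup>2 / 3 + r ^ 3 / 3))) {r..0}"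
  proof (rule fundamental_theorem_of_calculus_interior[OF r])
    fix q assume q: "q \<in> {r<..<0}"
    show "((\<lambda>q. b ^ 3 * (q / 5 - q\<^sup>2 / 3 + q ^ 3 / 3)) has_vector_derivative b * (hi b q - lo q) * kern_sq b q) (at q)"
      unfolding has_real_derivative_iff_has_vector_derivative[symmetric] kern_sq_def *[OF q]
      by (auto intro!: derivative_eq_intros simp: field_simps power2_eq_square power3_eq_cube)
  qed (auto intro!: continuous_intros)
  then show "((\<lambda>q. b * (hi b q - lo q) * kern_sq b q) has_integral (0 - b ^ 3 * (r / 5 - r\<^sup>2 / 3 + r ^ 3 / 3))) {r..0}" by simp
qed

text \<open>Antiderivatives of \<open>a c (a\<^sup>4 + c\<^sup>4)\<close> and \<open>a c\<^sup>3\<close> for \<open>a = sqrt q\<close>, \<open>c = sqrt (q + 1/b)\<close>,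
  found from \<open>(a c)\<^sup>2 = m\<^sup>2 - k\<^sup>2\<close> with \<open>m = q + k\<close> and \<open>k = 1 / (2 b)\<close>.\<close>

definition prim1 :: "real \<Rightarrow> real" where
  "prim1 q = (let k = 1 / (2 * b); m = q + k; w = sqrt q * sqrt (q + 1 / b); L = 2 * ln (sqrt q + sqrt (q + 1 / b)) in
     m * w ^ 3 / 2 + 5 / 4 * k\<^sup>2 * (m * w - k\<^sup>2 * L))"

definition prim2 :: "real \<Rightarrow> real" where
  "prim2 q = (let k = 1 / (2 * b); m = q + k; w = sqrt q * sqrt (q + 1 / b); L = 2 * ln (sqrt q + sqrt (q + 1 / b)) in
     w ^ 3 / 3 + k * (m * w - k\<^sup>2 * L) / 2)"

text \<open>Since w^2 = m^2 - k^2, one has w' = m / w and L' = 1 / w, whence (m w - k^2 L)' = 2 w,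
  (w^3)' = 3 m w and (m w^3)' = w^3 + 3 m^2 w. The targets become w (2 m^2 + 2 k^2) and w (m + k),
  because a^2 = m - k and c^2 = m + k.\<close>

lemma DERIV_prim:
  assumes "0 < q"
  defines "a \<equiv> sqrt q" and "c \<equiv> sqrt (q + 1 / b)"
  shows "(prim1 has_real_derivative a * c * (a ^ 4 + c ^ 4)) (at q)"
    and "(prim2 has_real_derivative a * c ^ 3) (at q)"
proof -
  let ?w = "\<lambda>q. sqrt q * sqrt (q + 1 / b)" and ?L = "\<lambda>q. 2 * ln (sqrt q + sqrt (q + 1 / b))"
  define k where "k = 1 / (2 * b)"
  define m where "m = q + k"
  define w where "w = a * c"
  have pos: "0 < q + 1 / b" "0 < a" "0 < c" "0 < w" "0 < sqrt q + sqrt (q + 1 / b)"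
    using assms b by (auto simp: a_def c_def w_def add_pos_pos)
  have sq: "a\<^sup>2 = m - k" "c\<^sup>2 = m + k"
    using assms pos by (auto simp: a_def c_def m_def k_def)
  have w2: "w\<^sup>2 = m\<^sup>2 - k\<^sup>2"
    by (simp add: w_def power_mult_distrib sq) (simp add: algebra_simps power2_eq_square)
  have a: "(sqrt has_real_derivative 1 / (2 * a)) (at q)"
    using DERIV_real_sqrt[OF assms(1)] by (simp add: a_def field_simps)
  have c: "((\<lambda>q. sqrt (q + 1 / b)) has_real_derivative 1 / (2 * c)) (at q)"
    using pos by (auto intro!: derivative_eq_intros simp: c_def field_simps)
  have W: "(?w has_real_derivative m / w) (at q)"
  proof -
    have "(?w has_real_derivative (1 / (2 * a) * c + 1 / (2 * c) * a)) (at q)"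
      using DERIV_mult[OF a c] by (simp add: a_def c_def)
    also have "1 / (2 * a) * c + 1 / (2 * c) * a = (a\<^sup>2 + c\<^sup>2) / (2 * w)"
      using pos by (simp add: w_def field_simps power2_eq_square)
    finally show ?thesis by (simp add: sq)
  qed
  have L: "(?L has_real_derivative 1 / w) (at q)"
  proof -
    have "(?L has_real_derivative (2 * ((1 / (2 * a) + 1 / (2 * c)) / (a + c)))) (at q)"
      using DERIV_cmult[OF DERIV_chain2[OF DERIV_ln_divide[OF pos(5)] DERIV_add[OF a c]], of 2]
      by (simp add: a_def c_def)
    also have "2 * ((1 / (2 * a) + 1 / (2 * c)) / (a + c)) = 1 / w"
      using pos(2,3) add_pos_pos[OF pos(2,3)] by (simp add: w_def divide_simps)
    finally show ?thesis .
  qed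
  have M: "((\<lambda>q. q + k) has_real_derivative 1) (at q)"
    by (auto intro!: derivative_eq_intros)
  have wq: "?w q = w" by (simp add: w_def a_def c_def)
  have "((\<lambda>q. (q + k) * ?w q - k\<^sup>2 * ?L q) has_real_derivative (1 * w + m / w * m) - k\<^sup>2 * (1 / w)) (at q)"
    using DERIV_diff[OF DERIV_mult[OF M W] DERIV_cmult[OF L, of "k\<^sup>2"]] by (simp add: wq m_def)
  also have "(1 * w + m / w * m) - k\<^sup>2 * (1 / w) = w + (m\<^sup>2 - k\<^sup>2) / w"
    by (simp add: diff_divide_distrib power2_eq_square)
  also have "\<dots> = 2 * w"
    unfolding w2[symmetric] using pos by (simp add: power2_eq_square)
  finally have K: "((\<lambda>q. (q + k) * ?w q - k\<^sup>2 * ?L q) has_real_derivative 2 * w) (at q)" .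
  have W3: "((\<lambda>q. ?w q ^ 3) has_real_derivative 3 * w * m) (at q)"
  proof -
    have "((\<lambda>q. ?w q ^ 3) has_real_derivative (real 3 * (m / w * w ^ 2))) (at q)"
      using DERIV_power[OF W, of 3] by (simp add: wq mult.assoc)
    then show ?thesis using pos by (simp add: power2_eq_square mult_ac)
  qed
  have "((\<lambda>q. (q + k) * ?w q ^ 3 / 2 + 5 / 4 * k\<^sup>2 * ((q + k) * ?w q - k\<^sup>2 * ?L q)) has_real_derivative
      ((1 * w ^ 3 + 3 * w * m * m) / 2 + 5 / 4 * k\<^sup>2 * (2 * w))) (at q)"
    using DERIV_add[OF DERIV_cdivide[OF DERIV_mult[OF M W3], of 2] DERIV_cmult[OF K, of "5 / 4 * k\<^sup>2"]]
    by (simp add: wq m_def)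
  also have "(1 * w ^ 3 + 3 * w * m * m) / 2 + 5 / 4 * k\<^sup>2 * (2 * w) = w * ((w\<^sup>2 + 3 * m\<^sup>2 + 5 * k\<^sup>2) / 2)"
    by (simp add: field_simps power2_eq_square power3_eq_cube)
  also have "(w\<^sup>2 + 3 * m\<^sup>2 + 5 * k\<^sup>2) / 2 = (a\<^sup>2)\<^sup>2 + (c\<^sup>2)\<^sup>2"
    unfolding w2 sq by (simp add: power2_eq_square field_simps)
  also have "(a\<^sup>2)\<^sup>2 + (c\<^sup>2)\<^sup>2 = a ^ 4 + c ^ 4" by simp
  finally show "(prim1 has_real_derivative a * c * (a ^ 4 + c ^ 4)) (at q)"
    unfolding prim1_def[abs_def] Let_def k_def[symmetric] w_def .
  have "((\<lambda>q. ?w q ^ 3 / 3 + k * ((q + k) * ?w q - k\<^sup>2 * ?L q) / 2) has_real_derivative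
      (3 * w * m / 3 + k * (2 * w) / 2)) (at q)"
    by (rule DERIV_add[OF DERIV_cdivide[OF W3] DERIV_cdivide[OF DERIV_cmult[OF K]]])
  also have "3 * w * m / 3 + k * (2 * w) / 2 = w * c\<^sup>2"
    unfolding sq by (simp add: algebra_simps)
  also have "w * c\<^sup>2 = a * c ^ 3" by (simp add: w_def power2_eq_square power3_eq_cube)
  finally show "(prim2 has_real_derivative a * c ^ 3) (at q)"
    unfolding prim2_def[abs_def] Let_def k_def[symmetric] .
qed

lemma continuous_prim: "continuous_on {0..r} prim1" "continuous_on {0..r} prim2"
proof -
  have "0 < sqrt q + sqrt (q + 1 / b)" if "q \<in> {0..r}" for q
  proof -
    have "0 < q + 1 / b" using that b by (auto simp: add_nonneg_pos)
    then show ?thesis using that by (intro add_nonneg_pos) auto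
  qed
  then have *: "\<forall>q\<in>{0..r}. sqrt q + sqrt (q + 1 / b) \<noteq> 0" by force
  show "continuous_on {0..r} prim1" "continuous_on {0..r} prim2"
    unfolding prim1_def[abs_def] prim2_def[abs_def] Let_def
    by (intro continuous_intros *; simp)+
qed

text \<open>For b > 1 both breakpoints move on the middle range: lo = a = sqrt q and hi = c = sqrt
  (q + 1/b). The relation b a^2 = b c^2 - 1 reduces \<open>kern_wt\<close> and
  \<open>kern_sq\<close> to combinations of 1, c^3 and c^5 - a^5; multiplying by c - a creates the
  mixed terms a c (a^4 + c^4) and a c^3 that \<open>prim1\<close> and \<open>prim2\<close>
  integrate.\<close>

lemma piece_middle_gt1:
  assumes "1 < b"
  defines "r \<equiv> 1 - 1 / b"
  defines "F \<equiv> \<lambda>q. b * (2 * sqrt (q + 1 / b) ^ 3 / 3 - 2 * sqrt q ^ 3 / 3) / 3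
      - 2 * b\<^sup>2 / 15 * (sqrt (q + 1 / b) ^ 8 / 4 + sqrt q ^ 8 / 4 - prim1 q)"
    and "G \<equiv> \<lambda>q. b * (2 * sqrt (q + 1 / b) ^ 3 / 3 - 2 * sqrt q ^ 3 / 3)
      + 8 * b ^ 3 / 15 * (sqrt (q + 1 / b) ^ 8 / 4 + sqrt q ^ 8 / 4 - prim1 q)
      - 4 * b\<^sup>2 / 3 * (sqrt (q + 1 / b) ^ 6 / 3 - prim2 q)"
  shows "((\<lambda>q. b * (hi b q - lo q) * kern_wt b q) has_integral (F r - F 0)) {0..r}"
    and "((\<lambda>q. b * (hi b q - lo q) * kern_sq b q) has_integral (G r - G 0)) {0..r}"
proof -
  have r: "0 \<le> r" using b assms(1) by (simp add: r_def field_simps)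
  let ?c = "\<lambda>q. sqrt (q + 1 / b)"
  have p: "0 < q" "0 < q + 1 / b" if "q \<in> {0<..<r}" for q
    using that b by (auto simp: add_pos_pos)
  have *: "lo q = sqrt q" "hi b q = ?c q" "q = (sqrt q)\<^sup>2" "b * (sqrt q)\<^sup>2 = b * (?c q)\<^sup>2 - 1" if "q \<in> {0<..<r}" for q
    using that p[OF that] b by (auto simp: lo_def hi_def r_def field_simps)
  have Da3: "((\<lambda>q. sqrt q ^ 3) has_real_derivative (3 / 2 * sqrt q)) (at q)" if "q \<in> {0<..<r}" for q
    by (rule DERIV_sqrt_power0[where n = 1]) (use p[OF that] in simp_all)
  have Da8: "((\<lambda>q. sqrt q ^ 8) has_real_derivative (4 * sqrt q ^ 6)) (at q)" if "q \<in> {0<..<r}" for q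
    by (rule DERIV_sqrt_power0[where n = 6]) (use p[OF that] in simp_all)
  have Dc3: "((\<lambda>q. ?c q ^ 3) has_real_derivative (3 / 2 * ?c q)) (at q)" if "q \<in> {0<..<r}" for q
    by (rule DERIV_sqrt_power[where n = 1]) (use p[OF that] in simp_all)
  have Dc6: "((\<lambda>q. ?c q ^ 6) has_real_derivative (3 * ?c q ^ 4)) (at q)" if "q \<in> {0<..<r}" for q
    by (rule DERIV_sqrt_power[where n = 4]) (use p[OF that] in simp_all)
  have Dc8: "((\<lambda>q. ?c q ^ 8) has_real_derivative (4 * ?c q ^ 6)) (at q)" if "q \<in> {0<..<r}" for q
    by (rule DERIV_sqrt_power[where n = 6]) (use p[OF that] in simp_all)
  note cont = continuous_prim[of r]
  show "((\<lambda>q. b * (hi b q - lo q) * kern_wt b q) has_integral (F r - F 0)) {0..r}"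
  proof (rule fundamental_theorem_of_calculus_interior[OF r])
    fix q assume q: "q \<in> {0<..<r}"
    define a where "a = sqrt q"
    define c where "c = ?c q"
    have e: "b * a\<^sup>2 = b * c\<^sup>2 - 1" using *(4)[OF q] by (simp add: a_def c_def)
    have "(F has_real_derivative (b * (2 * (3 / 2 * c) / 3 - 2 * (3 / 2 * a) / 3) / 3
        - 2 * b\<^sup>2 / 15 * (4 * c ^ 6 / 4 + 4 * a ^ 6 / 4 - a * c * (a ^ 4 + c ^ 4)))) (at q)" (is "(_ has_real_derivative ?D) _")
      unfolding F_def a_def c_def
      by (intro DERIV_diff DERIV_add DERIV_cdivide DERIV_cmult Da3[OF q] Da8[OF q] Dc3[OF q] Dc6[OF q] Dc8[OF q] DERIV_prim[OF p(1)[OF q]])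
    also have "?D =
        b * (c - a) * (1 / 3 - 2 * b / 15 * (c ^ 5 - a ^ 5))"
      by (simp add: field_simps eval_nat_numeral)
    also have "1 / 3 - 2 * b / 15 * (c ^ 5 - a ^ 5) = kern_wt b q"
    proof -
      have "kern_wt b q = (1 - c ^ 3) / 3 + b * ((c ^ 5 - a ^ 5) / 5 - a\<^sup>2 * (c ^ 3 - a ^ 3) / 3)"
        using *(1,2,3)[OF q] by (simp add: kern_wt_def a_def c_def)
      also have "\<dots> = (1 - c ^ 3) / 3 + b * (c ^ 5 - a ^ 5) / 5 - (b * a\<^sup>2) * c ^ 3 / 3 + b * a ^ 5 / 3"
        by (simp add: field_simps eval_nat_numeral)
      also have "\<dots> = 1 / 3 - 2 * b / 15 * (c ^ 5 - a ^ 5)"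
        unfolding e by (simp add: field_simps eval_nat_numeral)
      finally show ?thesis by simp
    qed
    finally show "(F has_vector_derivative b * (hi b q - lo q) * kern_wt b q) (at q)"
      using *(1,2)[OF q] by (simp add: a_def c_def has_real_derivative_iff_has_vector_derivative)
  qed (use cont in \<open>auto simp: F_def intro!: continuous_intros\<close>)
  show "((\<lambda>q. b * (hi b q - lo q) * kern_sq b q) has_integral (G r - G 0)) {0..r}"
  proof (rule fundamental_theorem_of_calculus_interior[OF r])
    fix q assume q: "q \<in> {0<..<r}"
    define a where "a = sqrt q"
    define c where "c = ?c q"
    have e: "b * a\<^sup>2 = b * c\<^sup>2 - 1" using *(4)[OF q] by (simp add: a_def c_def)
    have "(G has_real_derivative (b * (2 * (3 / 2 * c) / 3 - 2 * (3 / 2 * a) / 3)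
        + 8 * b ^ 3 / 15 * (4 * c ^ 6 / 4 + 4 * a ^ 6 / 4 - a * c * (a ^ 4 + c ^ 4))
        - 4 * b\<^sup>2 / 3 * (3 * c ^ 4 / 3 - a * c ^ 3))) (at q)" (is "(_ has_real_derivative ?D) _")
      unfolding G_def a_def c_def
      by (intro DERIV_diff DERIV_add DERIV_cdivide DERIV_cmult Da3[OF q] Da8[OF q] Dc3[OF q] Dc6[OF q] Dc8[OF q] DERIV_prim[OF p(1)[OF q]])
    also have "?D =
        b * (c - a) * (1 + 8 * b\<^sup>2 / 15 * (c ^ 5 - a ^ 5) - 4 * b / 3 * c ^ 3)"
      by (simp add: field_simps eval_nat_numeral)
    also have "1 + 8 * b\<^sup>2 / 15 * (c ^ 5 - a ^ 5) - 4 * b / 3 * c ^ 3 = kern_sq b q"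
    proof -
      have "kern_sq b q = 1 - c + b\<^sup>2 * ((c ^ 5 - a ^ 5) / 5 - 2 * a\<^sup>2 * (c ^ 3 - a ^ 3) / 3 + (a\<^sup>2)\<^sup>2 * (c - a))"
        using *(1,2,3)[OF q] by (simp add: kern_sq_def a_def c_def)
      also have "\<dots> = 1 - c + b\<^sup>2 * (c ^ 5 - a ^ 5) / 5 - 2 * b * (b * a\<^sup>2) * c ^ 3 / 3 + (b * a\<^sup>2)\<^sup>2 * c - b\<^sup>2 * a ^ 5 / 3"
        by (simp add: field_simps eval_nat_numeral)
      also have "\<dots> = 1 + 8 * b\<^sup>2 / 15 * (c ^ 5 - a ^ 5) - 4 * b / 3 * c ^ 3"
        unfolding e by (simp add: field_simps eval_nat_numeral)
      finally show ?thesis by simp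
    qed
    finally show "(G has_vector_derivative b * (hi b q - lo q) * kern_sq b q) (at q)"
      using *(1,2)[OF q] by (simp add: a_def c_def has_real_derivative_iff_has_vector_derivative)
  qed (use cont in \<open>auto simp: G_def intro!: continuous_intros\<close>)
qed

end

section \<open>Assembling the closed forms for small and large b\<close>

lemma xi_nu_C_fam_le1:
  assumes "0 < b" "b \<le> 1"
  shows "chatterjee_xi (C_fam b) = Xi b" "blest_nu (C_fam b) = Nu b"
proof -
  define r where "r = 1 - 1 / b"
  have b: "0 < b" by fact
  have "1 \<le> 1 / b" using assms by (simp add: field_simps)
  then have r: "r \<le> 0" "- 1 / b \<le> r" "1 - 1 / b \<le> 0" "r \<le> 1 - 1 / b" "r + 1 / b = 1"
    by (auto simp: r_def)
  note l = piece_left[OF b r(2,1,4), unfolded r(5) real_sqrt_one]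
    and m = piece_middle_le1[OF b assms(2), folded r_def]
    and u = piece_right[OF b order_refl r(3) zero_le_one, unfolded real_sqrt_zero]
  \<comment> \<open>Each power of r below comes with at least as high a power of b, so this turns
    the middle piece into a polynomial in b.\<close>
  have rb: "b * r = b - 1" using b by (simp add: r_def field_simps)
  have I: "((\<lambda>q. b * (hi b q - lo q) * kern_wt b q) has_integral (Nu b + 2) / 12) {- 1 / b..1}"
  proof (rule has_integral_eq_rhs[OF has_integral_combine[OF _ _ has_integral_combine[OF _ _ l(1) m(1)] u(1)] sym])
    have "b\<^sup>2 * (r / 5 - r\<^sup>2 / 6) = b * (b * r) / 5 - (b * r)\<^sup>2 / 6"
      by (simp add: field_simps power2_eq_square)
    also have "\<dots> = b * (b - 1) / 5 - (b - 1)\<^sup>2 / 6" by (simp add: rb)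
    finally show "(2 * b * 1 ^ 3 / 9 - b\<^sup>2 * 1 ^ 8 / 30) + (0 - b\<^sup>2 * (r / 5 - r\<^sup>2 / 6)) +
      (b\<^sup>2 * (1\<^sup>2 / 5 - 2 * 1 ^ 3 / 15 - 1 ^ 4 / 6 + 2 * 1 ^ 5 / 15 + 4 * 1 ^ 7 / 105 - 1 ^ 8 / 30) -
       b\<^sup>2 * (0\<^sup>2 / 5 - 2 * 0 ^ 3 / 15 - 0 ^ 4 / 6 + 2 * 0 ^ 5 / 15 + 4 * 0 ^ 7 / 105 - 0 ^ 8 / 30)) = (Nu b + 2) / 12"
      using assms by (simp add: Nu_def field_simps power2_eq_square)
  qed (insert r \<open>1 \<le> 1 / b\<close>, linarith+)
  have J: "((\<lambda>q. b * (hi b q - lo q) * kern_sq b q) has_integral (Xi b + 2) / 6) {- 1 / b..1}"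
  proof (rule has_integral_eq_rhs[OF has_integral_combine[OF _ _ has_integral_combine[OF _ _ l(2) m(2)] u(2)] sym])
    have "b ^ 3 * (r / 5 - r\<^sup>2 / 3 + r ^ 3 / 3) = b\<^sup>2 * (b * r) / 5 - b * (b * r)\<^sup>2 / 3 + (b * r) ^ 3 / 3"
      by (simp add: field_simps power2_eq_square power3_eq_cube)
    also have "\<dots> = b\<^sup>2 * (b - 1) / 5 - b * (b - 1)\<^sup>2 / 3 + (b - 1) ^ 3 / 3" by (simp add: rb)
    finally show "(2 * b * 1 ^ 3 / 3 - 4 * b\<^sup>2 * 1 ^ 6 / 9 + 2 * b ^ 3 * 1 ^ 8 / 15) + (0 - b ^ 3 * (r / 5 - r\<^sup>2 / 3 + r ^ 3 / 3)) +
      (b ^ 3 * (1\<^sup>2 / 5 - 2 * 1 ^ 3 / 15 - 1 ^ 4 / 3 + 4 * 1 ^ 5 / 15 + 1 ^ 6 / 3 - 46 * 1 ^ 7 / 105 + 2 * 1 ^ 8 / 15) -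
       b ^ 3 * (0\<^sup>2 / 5 - 2 * 0 ^ 3 / 15 - 0 ^ 4 / 3 + 4 * 0 ^ 5 / 15 + 0 ^ 6 / 3 - 46 * 0 ^ 7 / 105 + 2 * 0 ^ 8 / 15)) = (Xi b + 2) / 6"
      using assms by (simp add: Xi_def field_simps power2_eq_square power3_eq_cube)
  qed (insert r \<open>1 \<le> 1 / b\<close>, linarith+)
  show "chatterjee_xi (C_fam b) = Xi b" "blest_nu (C_fam b) = Nu b"
    unfolding xi_nu_C_fam[OF b I J] by (simp_all add: field_simps)
qed

lemma arcosh_sqrt:
  fixes b :: real
  assumes "1 \<le> b"
  shows "arcosh (sqrt b) = ln (sqrt b + sqrt (b - 1))"
  using assms by (simp add: arcosh_real_def)

text \<open>The logarithmic terms at the two ends differ by 2 ln ((1 + g) / sqrt (1/b)) = 2 ln (sqrt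
  b + sqrt (b - 1)), the source of the arcosh in the closed forms. At the upper end m = 1 - k and w
  = g; at 0 the product w vanishes.\<close>

lemma prim_diff:
  assumes "1 < b"
  defines "g \<equiv> sqrt ((b - 1) / b)" and "k \<equiv> 1 / (2 * b)"
  shows "prim1 b (1 - 1 / b) - prim1 b 0 =
      (1 - k) * g ^ 3 / 2 + 5 / 4 * k\<^sup>2 * ((1 - k) * g - 2 * k\<^sup>2 * arcosh (sqrt b))"
    and "prim2 b (1 - 1 / b) - prim2 b 0 =
      g ^ 3 / 3 + k * ((1 - k) * g - 2 * k\<^sup>2 * arcosh (sqrt b)) / 2"
proof -
  have g: "sqrt (1 - 1 / b) = g" "0 \<le> g"
    using assms by (auto simp: g_def diff_divide_distrib)
  have m: "1 - 1 / b + k = 1 - k"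
    using assms by (simp add: k_def field_simps)
  have "sqrt b + sqrt (b - 1) = (1 + g) / sqrt (1 / b)"
    using assms by (simp add: g_def real_sqrt_divide field_simps)
  then have L: "arcosh (sqrt b) = ln (g + 1) - ln (sqrt (1 / b))"
  proof -
    have "ln ((1 + g) / sqrt (1 / b)) = ln (1 + g) - ln (sqrt (1 / b))"
      using assms(1) g by (intro ln_divide_pos) auto
    with \<open>sqrt b + sqrt (b - 1) = (1 + g) / sqrt (1 / b)\<close> show ?thesis
      using assms(1) by (simp only: arcosh_sqrt[OF less_imp_le] add.commute)
  qed
  show "prim1 b (1 - 1 / b) - prim1 b 0 =
      (1 - k) * g ^ 3 / 2 + 5 / 4 * k\<^sup>2 * ((1 - k) * g - 2 * k\<^sup>2 * arcosh (sqrt b))"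
    using assms(1) unfolding prim1_def[OF order.strict_trans[OF zero_less_one assms(1)]] Let_def k_def[symmetric] g m L
    by (simp add: algebra_simps)
  show "prim2 b (1 - 1 / b) - prim2 b 0 =
      g ^ 3 / 3 + k * ((1 - k) * g - 2 * k\<^sup>2 * arcosh (sqrt b)) / 2"
    using assms(1) unfolding prim2_def[OF order.strict_trans[OF zero_less_one assms(1)]] Let_def k_def[symmetric] g m L
    by (simp add: algebra_simps add_divide_distrib diff_divide_distrib)
qed

lemma xi_nu_C_fam_gt1:
  assumes "1 < b"
  shows "chatterjee_xi (C_fam b) = Xi b" "blest_nu (C_fam b) = Nu b"
proof -
  have b: "0 < b" using assms by simp
  define r where "r = 1 - 1 / b"
  define g where "g = sqrt ((b - 1) / b)"
  define s where "s = sqrt (1 / b)"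
  define La where "La = arcosh (sqrt b)"
  have r: "0 \<le> r" "1 - 1 / b \<le> r" "r \<le> 1" "- 1 / b \<le> 0" "0 \<le> 1 - 1 / b" "r + 1 / b = 1"
    using assms by (auto simp: r_def field_simps)
  have gr: "sqrt r = g" by (simp add: r_def g_def diff_divide_distrib assms b less_imp_neq[OF b, symmetric])
  \<comment> \<open>Even powers of g are rational in b, so the identities below become linear in g
    and \<open>La\<close> with coefficients rational in b.\<close>
  define G where "G = (b - 1) / b"
  have g2: "g\<^sup>2 = G" using assms by (simp add: g_def G_def)
  have gp: "g ^ 3 = g * G" "g ^ 4 = G\<^sup>2" "g ^ 5 = g * G\<^sup>2" "g ^ 6 = G ^ 3" "g ^ 7 = g * G ^ 3" "g ^ 8 = G ^ 4"
    unfolding g2[symmetric] by (simp_all add: eval_nat_numeral)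
  note p = prim_diff[OF assms, folded g_def r_def La_def]
  define P1 where "P1 = prim1 b r - prim1 b 0"
  define P2 where "P2 = prim2 b r - prim2 b 0"
  note l = piece_left[OF b r(4) order_refl r(5), unfolded add_0_left, folded s_def]
    and m = piece_middle_gt1[OF b assms, folded r_def, unfolded r(6) real_sqrt_one add_0_left real_sqrt_zero gr, folded s_def]
    and u = piece_right[OF b r(1-3), unfolded gr]
  have I: "((\<lambda>q. b * (hi b q - lo q) * kern_wt b q) has_integral (Nu b + 2) / 12) {- 1 / b..1}"
  proof (rule has_integral_eq_rhs[OF has_integral_combine[OF _ _ has_integral_combine[OF _ _ l(1) m(1)] u(1)] sym])
    have NuE: "Nu b = (87 * g / b + 250 * g - 376 * b * g + 448 * b + 144 * b\<^sup>2 * g - 144 * b\<^sup>2 - 105 * La / b\<^sup>2) / 420"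
      using assms by (simp add: Nu_def g_def La_def Let_def)
    have P1E: "P1 = (1 - 1 / (2 * b)) * (g * G) / 2 + 5 / 4 * (1 / (2 * b))\<^sup>2 * ((1 - 1 / (2 * b)) * g - 2 * (1 / (2 * b))\<^sup>2 * La)"
      unfolding P1_def p gp ..
    \<comment> \<open>The powers of s cancel between the left and the middle range, which meet at q
      = 0.\<close>
    have "(2 * b * s ^ 3 / 9 - b\<^sup>2 * s ^ 8 / 30) +
      ((b * (2 * 1 ^ 3 / 3 - 2 * g ^ 3 / 3) / 3 - 2 * b\<^sup>2 / 15 * (1 ^ 8 / 4 + g ^ 8 / 4 - prim1 b r)) -
       (b * (2 * s ^ 3 / 3 - 2 * 0 ^ 3 / 3) / 3 - 2 * b\<^sup>2 / 15 * (s ^ 8 / 4 + 0 ^ 8 / 4 - prim1 b 0))) +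
      (b\<^sup>2 * (1\<^sup>2 / 5 - 2 * 1 ^ 3 / 15 - 1 ^ 4 / 6 + 2 * 1 ^ 5 / 15 + 4 * 1 ^ 7 / 105 - 1 ^ 8 / 30) -
       b\<^sup>2 * (g\<^sup>2 / 5 - 2 * g ^ 3 / 15 - g ^ 4 / 6 + 2 * g ^ 5 / 15 + 4 * g ^ 7 / 105 - g ^ 8 / 30)) =
      b * (2 / 3 - 2 * (g * G) / 3) / 3 - 2 * b\<^sup>2 / 15 * (1 / 4 + G ^ 4 / 4 - P1)
      + b\<^sup>2 * (4 / 105) - b\<^sup>2 * (G / 5 - 2 * (g * G) / 15 - G\<^sup>2 / 6 + 2 * (g * G\<^sup>2) / 15
        + 4 * (g * G ^ 3) / 105 - G ^ 4 / 30)" (is "?L = _")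
      unfolding gp g2 P1_def by (simp add: field_simps)
    also have "\<dots> = (Nu b + 2) / 12"
      unfolding NuE P1E G_def using b by (simp add: field_simps eval_nat_numeral)
    finally show "?L = (Nu b + 2) / 12" .
  qed (insert r, linarith+)
  have J: "((\<lambda>q. b * (hi b q - lo q) * kern_sq b q) has_integral (Xi b + 2) / 6) {- 1 / b..1}"
  proof (rule has_integral_eq_rhs[OF has_integral_combine[OF _ _ has_integral_combine[OF _ _ l(2) m(2)] u(2)] sym])
    have XiE: "Xi b = (183 * g - 38 * b * g - 88 * b\<^sup>2 * g + 112 * b\<^sup>2 + 48 * b ^ 3 * g - 48 * b ^ 3 - 105 * La / b) / 210"
      using assms by (simp add: Xi_def g_def La_def Let_def)
    have P1E: "P1 = (1 - 1 / (2 * b)) * (g * G) / 2 + 5 / 4 * (1 / (2 * b))\<^sup>2 * ((1 - 1 / (2 * b)) * g - 2 * (1 / (2 * b))\<^sup>2 * La)"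
      unfolding P1_def p gp ..
    have P2E: "P2 = (g * G) / 3 + 1 / (2 * b) * ((1 - 1 / (2 * b)) * g - 2 * (1 / (2 * b))\<^sup>2 * La) / 2"
      unfolding P2_def p gp ..
    have "(2 * b * s ^ 3 / 3 - 4 * b\<^sup>2 * s ^ 6 / 9 + 2 * b ^ 3 * s ^ 8 / 15) +
      ((b * (2 * 1 ^ 3 / 3 - 2 * g ^ 3 / 3) + 8 * b ^ 3 / 15 * (1 ^ 8 / 4 + g ^ 8 / 4 - prim1 b r) - 4 * b\<^sup>2 / 3 * (1 ^ 6 / 3 - prim2 b r)) -
       (b * (2 * s ^ 3 / 3 - 2 * 0 ^ 3 / 3) + 8 * b ^ 3 / 15 * (s ^ 8 / 4 + 0 ^ 8 / 4 - prim1 b 0) - 4 * b\<^sup>2 / 3 * (s ^ 6 / 3 - prim2 b 0))) +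
      (b ^ 3 * (1\<^sup>2 / 5 - 2 * 1 ^ 3 / 15 - 1 ^ 4 / 3 + 4 * 1 ^ 5 / 15 + 1 ^ 6 / 3 - 46 * 1 ^ 7 / 105 + 2 * 1 ^ 8 / 15) -
       b ^ 3 * (g\<^sup>2 / 5 - 2 * g ^ 3 / 15 - g ^ 4 / 3 + 4 * g ^ 5 / 15 + g ^ 6 / 3 - 46 * g ^ 7 / 105 + 2 * g ^ 8 / 15)) =
      b * (2 / 3 - 2 * (g * G) / 3) + 8 * b ^ 3 / 15 * (1 / 4 + G ^ 4 / 4 - P1)
      - 4 * b\<^sup>2 / 3 * (1 / 3 - P2) + b ^ 3 * (1 / 35)
      - b ^ 3 * (G / 5 - 2 * (g * G) / 15 - G\<^sup>2 / 3 + 4 * (g * G\<^sup>2) / 15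
        + G ^ 3 / 3 - 46 * (g * G ^ 3) / 105 + 2 * G ^ 4 / 15)" (is "?L = _")
      unfolding gp g2 P1_def P2_def by (simp add: field_simps)
    also have "\<dots> = (Xi b + 2) / 6"
      unfolding XiE P1E P2E G_def using b by (simp add: field_simps eval_nat_numeral)
    finally show "?L = (Xi b + 2) / 6" .
  qed (insert r, linarith+)
  show "chatterjee_xi (C_fam b) = Xi b" "blest_nu (C_fam b) = Nu b"
    unfolding xi_nu_C_fam[OF b I J] by (simp_all add: field_simps)
qed

section \<open>The region\<close>

lemma xi_nu_C_fam_eq:
  assumes "0 < b"
  shows "chatterjee_xi (C_fam b) = Xi b" "blest_nu (C_fam b) = Nu b"
  using assms xi_nu_C_fam_le1[of b] xi_nu_C_fam_gt1[of b] by (cases "b \<le> 1"; simp)+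

lemma C_fam_uminus: "0 < b \<Longrightarrow> C_fam (- b) = flip (C_fam b)"
  by (simp add: fun_eq_iff C_fam_def flip_def)

text \<open>Supplies the corner (0, 0) of the region; mixing with it also produces copulas of
  smaller \<xi> near the family.\<close>

definition indep :: "real \<Rightarrow> real \<Rightarrow> real" where
  "indep u v = u * v"

lemma indep_density: "v \<in> {0..1} \<Longrightarrow> section_density (\<lambda>u. indep u v) (\<lambda>_. v)"
  by (auto simp: section_density_def indep_def set_lebesgue_integral_def)

lemma copula_indep: "copula indep"
proof (rule kernel_copula[where T = "\<lambda>t y. y" and k = "\<lambda>v t. v"])
  fix t v :: real assume "v \<in> {0..1}"
  then have "{y \<in> {0..1}. y \<le> v} = {0..v}" by auto
  with \<open>v \<in> {0..1}\<close> show "measure lborel {y \<in> {0..1}. y \<le> v} = v" by simp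
qed (auto simp: indep_def set_lebesgue_integral_def)

lemma xi_nu_indep: "chatterjee_xi indep = 0" "blest_nu indep = 0"
proof -
  have sq: "sq_int indep v = v\<^sup>2" and wt: "wt_int indep v = v / 6" if v: "v \<in> {0..1}" for v
  proof -
    have "((\<lambda>t. (1 - t)\<^sup>2) has_integral 1/3) {0..1::real}"
      using has_integral_compl_power_Icc[of 0 1 2] by simp
    then have "(LINT t:{0..1}|lborel. (1 - t)\<^sup>2) = (1 / 3 :: real)"
      by (rule set_integral_lebesgue_continuous) (auto intro!: continuous_intros)
    then show "wt_int indep v = v / 6"
      by (simp add: wt_int_density[of indep v, OF indep_density[OF v]])
    show "sq_int indep v = v\<^sup>2"
      by (simp add: sq_int_density[of indep v, OF indep_density[OF v]] set_lebesgue_integral_def)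
  qed
  have 2: "((\<lambda>v. v\<^sup>2) has_integral 1/3) {0..1::real}" "((\<lambda>v. v / 6) has_integral 1/12) {0..1::real}"
    using has_integral_power_Icc[of 0 1 2] has_integral_divide[OF has_integral_power_Icc[of 0 1 1], of 6] by simp_all
  have "(LINT v:{0..1}|lebesgue. sq_int indep v) = (LINT v:{0..1}|lebesgue. v\<^sup>2)"
    using sq by (intro set_lebesgue_integral_cong) auto
  also have "\<dots> = 1 / 3"
    by (rule set_integral_lebesgue_continuous[OF 2(1)]) (auto intro!: continuous_intros)
  finally show "chatterjee_xi indep = 0" by (simp add: chatterjee_xi_eq)
  have "(LINT v:{0..1}|lebesgue. wt_int indep v) = (LINT v:{0..1}|lebesgue. v / 6)"
    using wt by (intro set_lebesgue_integral_cong) auto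
  also have "\<dots> = 1 / 12"
    by (rule set_integral_lebesgue_continuous[OF 2(2)]) (auto intro!: continuous_intros)
  finally show "blest_nu indep = 0" by (simp add: blest_nu_eq)
qed

text \<open>Mixing \<open>C\<close> with its reflection sweeps \<nu> through the whole symmetric
  interval, while convexity keeps \<xi> at most that of \<open>C\<close>; then
  \<open>xi_nu_region_fill\<close> raises \<xi> to x.\<close>

lemma xi_nu_region_fill_symmetric:
  assumes C: "copula C" and "\<bar>y\<bar> \<le> blest_nu C" "chatterjee_xi C \<le> x" "x \<le> 1"
  shows "(x, y) \<in> xi_nu_region"
proof -
  \<comment> \<open>Solves (1 - 2 s) \<nu> = y; if \<nu> is 0 then y is 0 as well and s = 0
    works.\<close>
  define s where "s = (if blest_nu C = 0 then 0 else (1 - y / blest_nu C) / 2)"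
  have s: "s \<in> {0..1}" and e: "(1 - s) * blest_nu C - s * blest_nu C = y"
    using assms(2) by (auto simp: s_def field_simps)
  show ?thesis
  proof (rule xi_nu_region_fill[OF copula_mix[OF C copula_flip[OF C] s] _ _ assms(4)])
    show "blest_nu (mix s C (flip C)) = y"
      using nu_mix[OF C copula_flip[OF C] s] e by (simp add: xi_nu_flip[OF C])
    show "chatterjee_xi (mix s C (flip C)) \<le> x"
      using xi_mix_le[OF C copula_flip[OF C] s] assms(3) by (simp add: xi_nu_flip[OF C] algebra_simps)
  qed
qed

text \<open>Optimality of \<open>C_fam b\<close> against \<open>D\<close> and against its
  reflection.\<close>

lemma abs_nu_le_support_line:
  assumes b: "0 < b" and D: "copula D"
  shows "\<bar>blest_nu D\<bar> \<le> Nu b + (chatterjee_xi D - Xi b) / b"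
  using C_fam_optimal(1)[OF b D] C_fam_optimal(1)[OF b copula_flip[OF D]]
  by (simp add: xi_nu_C_fam_eq[OF b] xi_nu_flip[OF D] diff_divide_distrib)

section \<open>Limits and range of \<open>Xi\<close>\<close>

lemma continuous_on_Xi: "continuous_on {0<..} Xi"
proof -
  have "continuous_on {1..} (\<lambda>b::real. arcosh (sqrt b))"
    by (intro continuous_intros) auto
  then have "continuous_on ({0<..1} \<union> {1..}) (\<lambda>b. if b \<le> 1 then 8 * b^2 * (7 - 3 * b) / 105
      else (\<lambda>b. let \<gamma> = sqrt ((b - 1) / b) in
        (183 * \<gamma> - 38 * b * \<gamma> - 88 * b^2 * \<gamma> + 112 * b^2 + 48 * b^3 * \<gamma> - 48 * b^3
          - 105 * arcosh (sqrt b) / b) / 210) b)"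
    \<comment> \<open>The pieces meet at b = 1, where \<gamma> and the arcosh vanish and both
      formulas give 32 / 105.\<close>
    by (intro continuous_on_cases_le) (auto simp: Let_def intro!: continuous_intros)
  moreover have "{0<..1} \<union> {1..} = ({0<..} :: real set)" by auto
  ultimately show ?thesis by (simp add: Xi_def[abs_def])
qed

text \<open>The last two limits send the intercept Nu b - Xi b / b of the supporting lines to
  0.\<close>

lemma Xi_Nu_at_0:
  "(Xi \<longlongrightarrow> 0) (at_right 0)" "(Nu \<longlongrightarrow> 0) (at_right 0)" "((\<lambda>b. Xi b / b) \<longlongrightarrow> 0) (at_right 0)"
proof -
  have ev: "\<forall>\<^sub>F b::real in at_right 0. 0 < b \<and> b < 1"
    unfolding eventually_at_right_field by (intro exI[of _ 1]) auto
  show "(Xi \<longlongrightarrow> 0) (at_right 0)"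
  proof (rule Lim_transform_eventually)
    show "((\<lambda>b::real. 8 * b^2 * (7 - 3 * b) / 105) \<longlongrightarrow> 0) (at_right 0)" by real_asymp
    show "\<forall>\<^sub>F b::real in at_right 0. 8 * b^2 * (7 - 3 * b) / 105 = Xi b"
      using ev by eventually_elim (simp add: Xi_def)
  qed
  show "(Nu \<longlongrightarrow> 0) (at_right 0)"
  proof (rule Lim_transform_eventually)
    show "((\<lambda>b::real. 4 * b * (28 - 9 * b) / 105) \<longlongrightarrow> 0) (at_right 0)" by real_asymp
    show "\<forall>\<^sub>F b::real in at_right 0. 4 * b * (28 - 9 * b) / 105 = Nu b"
      using ev by eventually_elim (simp add: Nu_def)
  qed
  show "((\<lambda>b. Xi b / b) \<longlongrightarrow> 0) (at_right 0)"
  proof (rule Lim_transform_eventually)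
    show "((\<lambda>b::real. 8 * b * (7 - 3 * b) / 105) \<longlongrightarrow> 0) (at_right 0)" by real_asymp
    show "\<forall>\<^sub>F b::real in at_right 0. 8 * b * (7 - 3 * b) / 105 = Xi b / b"
      using ev by eventually_elim (simp add: Xi_def power2_eq_square)
  qed
qed

lemma Xi_at_top: "(Xi \<longlongrightarrow> 1) at_top"
proof (rule Lim_transform_eventually)
  show "((\<lambda>b::real. (183 * sqrt ((b - 1) / b) - 38 * b * sqrt ((b - 1) / b) - 88 * b^2 * sqrt ((b - 1) / b)
      + 112 * b^2 + 48 * b^3 * sqrt ((b - 1) / b) - 48 * b^3
      - 105 * ln (sqrt b + sqrt (b - 1)) / b) / 210) \<longlongrightarrow> 1) at_top"
    by real_asymp
  show "\<forall>\<^sub>F b::real in at_top. (183 * sqrt ((b - 1) / b) - 38 * b * sqrt ((b - 1) / b) - 88 * b^2 * sqrt ((b - 1) / b)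
      + 112 * b^2 + 48 * b^3 * sqrt ((b - 1) / b) - 48 * b^3
      - 105 * ln (sqrt b + sqrt (b - 1)) / b) / 210 = Xi b"
    using eventually_gt_at_top[of 1] by eventually_elim (simp add: Xi_def Let_def arcosh_sqrt)
qed

text \<open>Intermediate values of the continuous \<open>Xi\<close> between its limits 0 and
  1.\<close>

lemma Xi_surj:
  assumes "0 < x" "x < 1"
  obtains b where "0 < b" "Xi b = x"
proof -
  have "\<forall>\<^sub>F b::real in at_right 0. 0 < b \<and> Xi b < x"
    using order_tendstoD(2)[OF Xi_Nu_at_0(1) assms(1)] eventually_at_right_less
    by eventually_elim auto
  then obtain b1 where b1: "0 < b1" "Xi b1 < x"
    using eventually_happens[of _ "at_right (0::real)"] by (auto simp: trivial_limit_at_right_real)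
  have "\<forall>\<^sub>F b in at_top. 0 < b \<and> x < Xi b"
    using order_tendstoD(1)[OF Xi_at_top assms(2)] eventually_gt_at_top[of 0]
    by eventually_elim auto
  then obtain b2 where b2: "0 < b2" "x < Xi b2"
    using eventually_happens[of _ "at_top :: real filter"] by auto
  have "connected (Xi ` {0<..})"
    by (rule connected_continuous_image[OF continuous_on_Xi]) (rule connected_Ioi)
  then have "x \<in> Xi ` {0<..}"
    using b1 b2 connected_contains_Icc[of "Xi ` {0<..}" "Xi b1" "Xi b2"] by auto
  then show thesis using that by auto
qed

text \<open>Strictness separates the curve from the segment at \<xi> = 1. If Xi b were 1, the
  comonotone copula would lie on the supporting line of \<open>C_fam b\<close> and hence equal it;
  but its section at v = 1/2 has a density that jumps from 1 to 0, whereas the kernel is continuous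
  in t.\<close>

lemma Xi_bounds:
  assumes b: "0 < b"
  shows "0 \<le> Xi b" "Xi b < 1"
proof -
  show "0 \<le> Xi b" using xi_bounds(1)[OF copula_C_fam[OF b]] by (simp add: xi_nu_C_fam_eq[OF b])
  have "Xi b \<noteq> 1"
  proof
    assume 1: "Xi b = 1"
    have M: "copula (shuffle 1)" "chatterjee_xi (shuffle 1) = 1" "blest_nu (shuffle 1) = 1"
      using copula_shuffle[of 1] xi_nu_shuffle[of 1] by auto
    have "Nu b \<le> 1" using nu_bounds[OF copula_C_fam[OF b]] by (simp add: xi_nu_C_fam_eq[OF b])
    moreover have "1 \<le> Nu b"
      using abs_nu_le_support_line[OF b M(1)] M 1 by simp
    ultimately have "shuffle 1 (1/2) (1/2) = C_fam b (1/2) (1/2)"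
      using 1 M b by (intro C_fam_optimal(2)[OF b M(1)]) (auto simp: xi_nu_C_fam_eq[OF b])
    moreover have "shuffle 1 (1/2) (1/2) = (LINT t:{0..1/2::real}|lborel. 1)"
      unfolding shuffle_def by (rule set_lebesgue_integral_cong) (auto simp: shuffle_map_def)
    ultimately have half: "C_fam b (1/2) (1/2) = 1/2" by (simp add: set_lebesgue_integral_def)
    define k where "k = kern b (q_shift b (1/2))"
    have kc: "continuous_on S k" for S unfolding k_def by (rule continuous_kern)
    have k01: "0 \<le> k t" "k t \<le> 1" for t by (auto simp: k_def kern_bounds)
    have d: "section_density (\<lambda>u. C_fam b u (1/2)) k"
      unfolding k_def by (rule section_density_C_fam[OF b])
    have I0: "(k has_integral 1/2) {0..1/2}" and I1: "(k has_integral 1/2) {0..1}"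
    proof -
      have "integral {0..1/2} k = 1/2" "integral {0..1} k = 1/2"
        using section_densityD(7)[OF d, of "1/2"] section_densityD(7)[OF d, of 1] half
          copula_margins(2)[OF copula_C_fam[OF b], of "1/2"] by simp_all
      then show "(k has_integral 1/2) {0..1/2}" "(k has_integral 1/2) {0..1}"
        using integrable_integral[OF section_densityD(6)[OF d]] by metis+
    qed
    \<comment> \<open>A continuous nonnegative function with integral 0 vanishes: 1 - k does so on
      [0, 1/2] and k on [1/2, 1], a clash at t = 1/2.\<close>
    have "((\<lambda>t. 1 - k t) has_integral (1/2 - 1/2)) {0..1/2}"
      using has_integral_diff[OF has_integral_const_real[of 1 0 "1/2"] I0] by simp
    then have "1 - k (1/2) = 0"
      using k01 by (intro has_integral_0_cbox_imp_0[of 0 "1/2" "\<lambda>t. 1 - k t" "1/2"])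
        (auto intro!: continuous_intros kc)
    moreover have I2: "(k has_integral (integral {1/2..1} k)) {1/2..1}"
      by (rule integrable_integral) (rule section_densityD(6)[OF d])
    have "(k has_integral (1/2 + integral {1/2..1} k)) {0..1}"
      by (rule has_integral_combine[OF _ _ I0 I2]) auto
    from has_integral_unique[OF this I1] have "integral {1/2..1} k = 0" by simp
    ultimately have "(k has_integral 0) {1/2..1}" "k (1/2) = 1" using I2 by auto
    then show False
      using has_integral_0_cbox_imp_0[of "1/2" 1 k "1/2"] k01 kc by auto
  qed
  then show "Xi b < 1"
    using xi_bounds(2)[OF copula_C_fam[OF b]] by (simp add: xi_nu_C_fam_eq[OF b])
qed

text \<open>The independence copula sits at the origin and lies below every supporting line, so Nu b
  >= Xi b / b.\<close>

lemma Nu_nonneg: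
  assumes b: "0 < b"
  shows "0 \<le> Nu b"
proof -
  have "0 \<le> Xi b / b" using Xi_bounds(1)[OF b] b by simp
  then show ?thesis using abs_nu_le_support_line[OF b copula_indep] by (simp add: xi_nu_indep)
qed

section \<open>Half-plane description of the region, closedness and convexity\<close>

lemma eq_0_if_le_lines:
  assumes "\<And>b. 0 < b \<Longrightarrow> \<bar>y\<bar> \<le> Nu b + (0 - Xi b) / b"
  shows "y = 0"
proof -
  have "\<bar>y\<bar> \<le> 0 - 0"
  proof (rule tendsto_lowerbound)
    show "((\<lambda>b. Nu b - Xi b / b) \<longlongrightarrow> 0 - 0) (at_right 0)"
      by (intro tendsto_diff Xi_Nu_at_0)
    show "\<forall>\<^sub>F b in at_right 0. \<bar>y\<bar> \<le> Nu b - Xi b / b"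
      using eventually_at_right_less by eventually_elim (use assms in auto)
  qed simp
  then show ?thesis by simp
qed

text \<open>For the converse each abscissa has a copula of extremal \<nu>: independence at x = 0,
  where the lines force y = 0; some \<open>C_fam b\<close> with Xi b = x for 0 < x < 1, whose own
  line bounds |y| by Nu b; the comonotone copula at x = 1.\<close>

lemma xi_nu_region_iff:
  "(x, y) \<in> xi_nu_region \<longleftrightarrow>
    0 \<le> x \<and> x \<le> 1 \<and> \<bar>y\<bar> \<le> 1 \<and> (\<forall>b>0. \<bar>y\<bar> \<le> Nu b + (x - Xi b) / b)"
proof
  assume "(x, y) \<in> xi_nu_region"
  then obtain D where "copula D" "x = chatterjee_xi D" "y = blest_nu D"
    by (auto simp: xi_nu_region_def)
  then show "0 \<le> x \<and> x \<le> 1 \<and> \<bar>y\<bar> \<le> 1 \<and> (\<forall>b>0. \<bar>y\<bar> \<le> Nu b + (x - Xi b) / b)"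
    using xi_bounds nu_bounds abs_nu_le_support_line by auto
next
  assume *: "0 \<le> x \<and> x \<le> 1 \<and> \<bar>y\<bar> \<le> 1 \<and> (\<forall>b>0. \<bar>y\<bar> \<le> Nu b + (x - Xi b) / b)"
  consider "x = 0" | "0 < x" "x < 1" | "x = 1" using * by linarith
  then show "(x, y) \<in> xi_nu_region"
  proof cases
    case 1
    have "y = 0" using * 1 by (intro eq_0_if_le_lines) auto
    then show ?thesis
      using 1 by (intro xi_nu_region_fill_symmetric[OF copula_indep]) (auto simp: xi_nu_indep)
  next
    case 2
    then obtain b where b: "0 < b" "Xi b = x" by (rule Xi_surj)
    then have "\<bar>y\<bar> \<le> Nu b" using * by force
    then show ?thesis
      using b * by (intro xi_nu_region_fill_symmetric[OF copula_C_fam[OF b(1)]]) (auto simp: xi_nu_C_fam_eq[OF b(1)])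
  next
    case 3
    then show ?thesis
      using * by (intro xi_nu_region_fill_symmetric[OF copula_shuffle[of 1]]) (auto simp: xi_nu_shuffle)
  qed
qed

lemma xi_nu_region_0: "(0, y) \<in> xi_nu_region \<longleftrightarrow> y = 0"
proof
  assume *: "(0, y) \<in> xi_nu_region"
  show "y = 0"
    using * unfolding xi_nu_region_iff by (intro eq_0_if_le_lines) blast
next
  assume "y = 0"
  then show "(0, y) \<in> xi_nu_region"
    by (intro xi_nu_region_fill_symmetric[OF copula_indep]) (auto simp: xi_nu_indep)
qed

lemma xi_nu_region_Xi:
  assumes b: "0 < b"
  shows "(Xi b, y) \<in> xi_nu_region \<longleftrightarrow> \<bar>y\<bar> \<le> Nu b"
proof
  assume "(Xi b, y) \<in> xi_nu_region"
  then have "\<bar>y\<bar> \<le> Nu b + (Xi b - Xi b) / b" using b unfolding xi_nu_region_iff by blast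
  then show "\<bar>y\<bar> \<le> Nu b" by simp
next
  assume "\<bar>y\<bar> \<le> Nu b"
  then show "(Xi b, y) \<in> xi_nu_region"
    using Xi_bounds[OF b]
    by (intro xi_nu_region_fill_symmetric[OF copula_C_fam[OF b]]) (auto simp: xi_nu_C_fam_eq[OF b])
qed

lemma xi_nu_region_1: "(1, y) \<in> xi_nu_region \<longleftrightarrow> \<bar>y\<bar> \<le> 1"
proof
  assume "\<bar>y\<bar> \<le> 1"
  then show "(1, y) \<in> xi_nu_region"
    by (intro xi_nu_region_fill_symmetric[OF copula_shuffle[of 1]]) (auto simp: xi_nu_shuffle)
qed (auto simp: xi_nu_region_iff)

lemma xi_nu_region_cases:
  assumes "(x, y) \<in> xi_nu_region"
  obtains "x = 0" "y = 0" | b where "0 < b" "x = Xi b" "\<bar>y\<bar> \<le> Nu b" | "x = 1" "\<bar>y\<bar> \<le> 1"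
proof -
  have "0 \<le> x" "x \<le> 1" using assms by (auto simp: xi_nu_region_iff)
  then consider "x = 0" | "0 < x" "x < 1" | "x = 1" by linarith
  then show thesis
  proof cases
    case 2
    then obtain b where "0 < b" "Xi b = x" by (rule Xi_surj)
    then show thesis using that(2)[of b] assms xi_nu_region_Xi by auto
  qed (use that assms xi_nu_region_0 xi_nu_region_1 in auto)
qed

text \<open>Each constraint of the half-plane description is a weak inequality between continuous
  functions of the point.\<close>

lemma closed_xi_nu_region: "closed xi_nu_region"
proof -
  have eq: "xi_nu_region = {p. 0 \<le> fst p} \<inter> {p. fst p \<le> 1} \<inter> {p. \<bar>snd p\<bar> \<le> 1} \<inter>
      (\<Inter>b\<in>{0<..}. {p. \<bar>snd p\<bar> \<le> Nu b + (fst p - Xi b) / b})"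
    using xi_nu_region_iff by auto
  show ?thesis
    unfolding eq by (intro closed_Int closed_INT ballI closed_Collect_le continuous_intros) auto
qed

text \<open>The point of the chord has the \<nu> of the mixture and, by convexity of \<xi>, at least
  its \<xi>; filling towards \<xi> = 1 reaches it.\<close>

lemma convex_xi_nu_region: "convex xi_nu_region"
  unfolding convex_alt
proof (intro ballI allI impI)
  fix p q :: "real \<times> real" and s :: real
  assume "p \<in> xi_nu_region" "q \<in> xi_nu_region" and s: "0 \<le> s \<and> s \<le> 1"
  then obtain C D where C: "copula C" "p = (chatterjee_xi C, blest_nu C)" and D: "copula D" "q = (chatterjee_xi D, blest_nu D)"
    by (auto simp: xi_nu_region_def)
  have s': "s \<in> {0..1}" using s by auto
  have "((1 - s) * chatterjee_xi C + s * chatterjee_xi D, (1 - s) * blest_nu C + s * blest_nu D) \<in> xi_nu_region"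
  proof (rule xi_nu_region_fill[OF copula_mix[OF C(1) D(1) s']])
    show "(1 - s) * chatterjee_xi C + s * chatterjee_xi D \<le> 1"
      using xi_bounds(2)[OF C(1)] xi_bounds(2)[OF D(1)] s by (intro convex_bound_le) auto
  qed (use nu_mix[OF C(1) D(1) s'] xi_mix_le[OF C(1) D(1) s'] in auto)
  then show "(1 - s) *\<^sub>R p + s *\<^sub>R q \<in> xi_nu_region"
    by (simp add: C D)
qed

section \<open>The frontier\<close>

lemma interior_xi_nu_region:
  assumes "(x, y) \<in> interior xi_nu_region"
  shows "\<exists>e>0. (x + e, y) \<in> xi_nu_region \<and> (x - e, y) \<in> xi_nu_region \<and>
    (x, y + e) \<in> xi_nu_region \<and> (x, y - e) \<in> xi_nu_region"
proof -
  obtain e where e: "e > 0" "ball (x, y) e \<subseteq> xi_nu_region"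
    using assms by (auto simp: mem_interior)
  have "{(x + e / 2, y), (x - e / 2, y), (x, y + e / 2), (x, y - e / 2)} \<subseteq> ball (x, y) e"
    using e(1) by (auto simp: dist_Pair_Pair dist_real_def)
  with e show ?thesis by (intro exI[of _ "e / 2"]) auto
qed

text \<open>A point with |y| < Nu b is interior: moving \<open>C_fam b\<close> slightly towards
  independence lowers \<xi> strictly while \<nu> stays above |y|, and filling gives an open
  rectangle around the point. Conversely, a point on a branch leaves the region under a small
  vertical step, and one with x = 0 or x = 1 under a horizontal step.\<close>

lemma frontier_xi_nu_region_iff:
  "(x, y) \<in> frontier xi_nu_region \<longleftrightarrow>
    (x = 0 \<and> y = 0) \<or> (\<exists>b>0. x = Xi b \<and> \<bar>y\<bar> = Nu b) \<or> (x = 1 \<and> \<bar>y\<bar> \<le> 1)"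
proof -
  have fr: "(x, y) \<in> frontier xi_nu_region \<longleftrightarrow> (x, y) \<in> xi_nu_region \<and> (x, y) \<notin> interior xi_nu_region"
    using closed_xi_nu_region by (auto simp: frontier_def)
  show ?thesis
  proof
    assume *: "(x, y) \<in> frontier xi_nu_region"
    then have "(x, y) \<in> xi_nu_region" using fr by simp
    then show "(x = 0 \<and> y = 0) \<or> (\<exists>b>0. x = Xi b \<and> \<bar>y\<bar> = Nu b) \<or> (x = 1 \<and> \<bar>y\<bar> \<le> 1)"
    proof (cases rule: xi_nu_region_cases)
      case (2 b)
      note C = copula_C_fam[OF 2(1)] and xn = xi_nu_C_fam_eq[OF 2(1)]
      have "\<bar>y\<bar> = Nu b"
      proof (rule ccontr)
        assume "\<bar>y\<bar> \<noteq> Nu b"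
        then have lt: "\<bar>y\<bar> < Nu b" using 2 by simp
        \<comment> \<open>Otherwise the slice at x = 0, which is a single point, would contain the
          nonzero ordinate Nu b.\<close>
        have X: "0 < Xi b"
        proof (rule ccontr)
          assume "\<not> 0 < Xi b"
          then have "Xi b = 0" using Xi_bounds[OF 2(1)] by simp
          then have "(0, Nu b) \<in> xi_nu_region"
            using xi_nu_region_Xi[OF 2(1), of "Nu b"] lt by auto
          then show False using lt by (simp add: xi_nu_region_0)
        qed
        \<comment> \<open>Chosen so that (1 - s) Nu b is the midpoint of |y| and Nu b.\<close>
        define s where "s = (1 - \<bar>y\<bar> / Nu b) / 2"
        have s: "s \<in> {0..1}" "0 < s" "\<bar>y\<bar> < (1 - s) * Nu b"
        proof -
          have "\<bar>y\<bar> / Nu b < 1" "0 \<le> \<bar>y\<bar> / Nu b" using lt by auto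
          then show "s \<in> {0..1}" "0 < s" by (auto simp: s_def)
          have "(1 - s) * Nu b = (Nu b + \<bar>y\<bar>) / 2" using lt by (simp add: s_def field_simps)
          then show "\<bar>y\<bar> < (1 - s) * Nu b" using lt by simp
        qed
        let ?D = "mix s (C_fam b) indep"
        have D: "copula ?D" by (rule copula_mix[OF C copula_indep s(1)])
        have nu: "blest_nu ?D = (1 - s) * Nu b"
          using nu_mix[OF C copula_indep s(1)] by (simp add: xn xi_nu_indep)
        have xi: "chatterjee_xi ?D \<le> (1 - s) * Xi b"
          using xi_mix_le[OF C copula_indep s(1)] by (simp add: xn xi_nu_indep)
        let ?O = "{(1 - s) * Xi b <..< 1} \<times> {- ((1 - s) * Nu b) <..< (1 - s) * Nu b}"
        have "?O \<subseteq> xi_nu_region"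
        proof clarify
          fix x' y' assume "x' \<in> {(1 - s) * Xi b <..< 1}" "y' \<in> {- ((1 - s) * Nu b) <..< (1 - s) * Nu b}"
          then show "(x', y') \<in> xi_nu_region"
            using xi by (intro xi_nu_region_fill_symmetric[OF D]) (auto simp: nu)
        qed
        moreover have "open ?O" by (intro open_Times) auto
        moreover have "(x, y) \<in> ?O"
          using 2 s X Xi_bounds[OF 2(1)] by (auto simp: abs_less_iff)
        ultimately have "(x, y) \<in> interior xi_nu_region"
          by (meson interiorI)
        with * fr show False by simp
      qed
      then show ?thesis using 2 by blast
    qed auto
  next
    assume *: "(x = 0 \<and> y = 0) \<or> (\<exists>b>0. x = Xi b \<and> \<bar>y\<bar> = Nu b) \<or> (x = 1 \<and> \<bar>y\<bar> \<le> 1)"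
    then have "(x, y) \<in> xi_nu_region"
      using xi_nu_region_0 xi_nu_region_1 xi_nu_region_Xi by auto
    moreover have "(x, y) \<notin> interior xi_nu_region"
    proof
      assume "(x, y) \<in> interior xi_nu_region"
      from interior_xi_nu_region[OF this] obtain e where e: "e > 0"
        "(x + e, y) \<in> xi_nu_region" "(x - e, y) \<in> xi_nu_region"
        "(x, y + e) \<in> xi_nu_region" "(x, y - e) \<in> xi_nu_region"
        by blast
      from * consider "x = 0" | b where "0 < b" "x = Xi b" "\<bar>y\<bar> = Nu b" | "x = 1" by blast
      then show False
      proof cases
        case (2 b)
        then have "\<bar>y + e\<bar> \<le> \<bar>y\<bar>" "\<bar>y - e\<bar> \<le> \<bar>y\<bar>"
          using e xi_nu_region_Xi[OF 2(1)] by auto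
        then show False using e(1) by linarith
      qed (use e in \<open>auto simp: xi_nu_region_iff\<close>)
    qed
    ultimately show "(x, y) \<in> frontier xi_nu_region" using fr by simp
  qed
qed

section \<open>Uniqueness on the two branches and the full statement\<close>

lemma unique_copula_upper:
  assumes b: "0 < b"
  shows "unique_copula_at (C_fam b) (Xi b, Nu b)"
  unfolding unique_copula_at_def
proof (intro conjI allI impI ballI)
  show "copula (C_fam b)" by (rule copula_C_fam[OF b])
  show "(chatterjee_xi (C_fam b), blest_nu (C_fam b)) = (Xi b, Nu b)"
    by (simp add: xi_nu_C_fam_eq[OF b])
  fix D u v assume "copula D \<and> (chatterjee_xi D, blest_nu D) = (Xi b, Nu b)"
    and uv: "u \<in> {0..1::real}" "v \<in> {0..1::real}"
  then have D: "copula D" "chatterjee_xi D = Xi b" "blest_nu D = Nu b" by auto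
  show "D u v = C_fam b u v"
    by (rule C_fam_optimal(2)[OF b D(1) _ uv]) (simp add: D xi_nu_C_fam_eq[OF b])
qed

text \<open>The reflection carries the lower branch to the upper one; equality of the reflected
  copulas at 1 - v is equality of the originals at v.\<close>

lemma unique_copula_lower:
  assumes b: "0 < b"
  shows "unique_copula_at (C_fam (- b)) (Xi b, - Nu b)"
  unfolding unique_copula_at_def C_fam_uminus[OF b]
proof (intro conjI allI impI ballI)
  show "copula (flip (C_fam b))" by (rule copula_flip[OF copula_C_fam[OF b]])
  show "(chatterjee_xi (flip (C_fam b)), blest_nu (flip (C_fam b))) = (Xi b, - Nu b)"
    by (simp add: xi_nu_flip[OF copula_C_fam[OF b]] xi_nu_C_fam_eq[OF b])
  fix D u v assume "copula D \<and> (chatterjee_xi D, blest_nu D) = (Xi b, - Nu b)"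
    and uv: "u \<in> {0..1::real}" "v \<in> {0..1::real}"
  then have D: "copula D" "chatterjee_xi D = Xi b" "blest_nu D = - Nu b" by auto
  have "flip D u (1 - v) = C_fam b u (1 - v)"
    by (rule C_fam_optimal(2)[OF b copula_flip[OF D(1)]])
      (use uv in \<open>simp_all add: D xi_nu_flip[OF D(1)] xi_nu_C_fam_eq[OF b]\<close>)
  then show "D u v = flip (C_fam b) u v"
    by (simp add: flip_def)
qed

theorem theorem1p1:
  shows
    "(convex xi_nu_region \<and> closed xi_nu_region \<and>
      xi_nu_region =
        {(Xi_ext b, y) |b y. b \<in> {0..\<infinity>} \<and> - Nu_ext b \<le> y \<and> y \<le> Nu_ext b})
     \<and>
     (upper_branch \<subseteq> frontier xi_nu_region \<and>
      lower_branch \<subseteq> frontier xi_nu_region \<and>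
      (0, 0) \<in> frontier xi_nu_region \<and>
      ((\<lambda>b. (Xi b, Nu b)) \<longlongrightarrow> (0, 0)) (at_right 0) \<and>
      ((\<lambda>b. (Xi b, - Nu b)) \<longlongrightarrow> (0, 0)) (at_right 0) \<and>
      (\<forall>b>0. unique_copula_at (C_fam b) (Xi b, Nu b)) \<and>
      (\<forall>b>0. unique_copula_at (C_fam (- b)) (Xi b, - Nu b)) \<and>
      frontier xi_nu_region - (upper_branch \<union> lower_branch \<union> {(0, 0)}) =
        {(1, y) |y. -1 \<le> y \<and> y \<le> 1})
     \<and>
     (copula (C_fam 1) \<and>
      (\<forall>C. copula C \<longrightarrow>
         blest_nu C - chatterjee_xi C \<le> blest_nu (C_fam 1) - chatterjee_xi (C_fam 1)))"
proof (intro conjI allI impI)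
  show "convex xi_nu_region" by (rule convex_xi_nu_region)
  show "closed xi_nu_region" by (rule closed_xi_nu_region)
  show "xi_nu_region = {(Xi_ext b, y) |b y. b \<in> {0..\<infinity>} \<and> - Nu_ext b \<le> y \<and> y \<le> Nu_ext b}" (is "_ = ?R")
  proof (rule set_eqI)
    fix p :: "real \<times> real"
    obtain x y where p: "p = (x, y)" by (cases p)
    show "p \<in> xi_nu_region \<longleftrightarrow> p \<in> ?R"
    proof
      assume "p \<in> xi_nu_region"
      then have "(x, y) \<in> xi_nu_region" by (simp add: p)
      then have "\<exists>b\<in>{0..\<infinity>}. x = Xi_ext b \<and> \<bar>y\<bar> \<le> Nu_ext b"
      proof (cases rule: xi_nu_region_cases)
        case 1
        then show ?thesis by (intro bexI[of _ 0]) (auto simp: Xi_ext_def Nu_ext_def)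
      next
        case (2 b)
        then show ?thesis by (intro bexI[of _ "ereal b"]) (auto simp: Xi_ext_def Nu_ext_def)
      next
        case 3
        then show ?thesis by (intro bexI[of _ \<infinity>]) (auto simp: Xi_ext_def Nu_ext_def)
      qed
      then show "p \<in> ?R" by (auto simp: p abs_le_iff)
    next
      assume "p \<in> ?R"
      then obtain b where b: "b \<in> {0..\<infinity>}" "x = Xi_ext b" "\<bar>y\<bar> \<le> Nu_ext b"
        by (auto simp: p abs_le_iff)
      \<comment> \<open>The parameter is 0, a positive real or infinity, matching the three kinds of
        vertical slices.\<close>
      then show "p \<in> xi_nu_region"
        using xi_nu_region_0 xi_nu_region_1 xi_nu_region_Xi
        by (cases b) (auto simp: p Xi_ext_def Nu_ext_def zero_ereal_def split: if_splits)
    qed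
  qed
  show "upper_branch \<subseteq> frontier xi_nu_region" "lower_branch \<subseteq> frontier xi_nu_region"
  proof -
    have "(Xi b, y) \<in> frontier xi_nu_region" if "0 < b" "\<bar>y\<bar> = Nu b" for b y
      using that unfolding frontier_xi_nu_region_iff by blast
    then show "upper_branch \<subseteq> frontier xi_nu_region" "lower_branch \<subseteq> frontier xi_nu_region"
      using Nu_nonneg by (auto simp: upper_branch_def lower_branch_def)
  qed
  show "(0, 0) \<in> frontier xi_nu_region"
    by (simp add: frontier_xi_nu_region_iff)
  show "((\<lambda>b. (Xi b, Nu b)) \<longlongrightarrow> (0, 0)) (at_right 0)"
    by (intro tendsto_Pair Xi_Nu_at_0)
  show "((\<lambda>b. (Xi b, - Nu b)) \<longlongrightarrow> (0, 0)) (at_right 0)"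
    using tendsto_Pair[OF Xi_Nu_at_0(1) tendsto_minus[OF Xi_Nu_at_0(2)]] by simp
  show "unique_copula_at (C_fam b) (Xi b, Nu b)" if "0 < b" for b
    by (rule unique_copula_upper[OF that])
  show "unique_copula_at (C_fam (- b)) (Xi b, - Nu b)" if "0 < b" for b
    by (rule unique_copula_lower[OF that])
  show "frontier xi_nu_region - (upper_branch \<union> lower_branch \<union> {(0, 0)}) = {(1, y) |y. -1 \<le> y \<and> y \<le> 1}"
  proof (rule set_eqI)
    fix p :: "real \<times> real"
    obtain x y where p: "p = (x, y)" by (cases p)
    \<comment> \<open>With the branches, their frontier description and the segment named, the claim
      is propositional. The analytic input is Xi b < 1, which keeps the segment off both
      branches.\<close>
    define A where "A \<longleftrightarrow> (\<exists>b>0. x = Xi b \<and> (y = Nu b \<or> y = - Nu b))"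
    define B where "B \<longleftrightarrow> (\<exists>b>0. x = Xi b \<and> \<bar>y\<bar> = Nu b)"
    define S where "S \<longleftrightarrow> x = 1 \<and> \<bar>y\<bar> \<le> 1"
    have "p \<in> upper_branch \<or> p \<in> lower_branch \<longleftrightarrow> A"
      unfolding A_def p upper_branch_def lower_branch_def by blast
    moreover have "p \<in> frontier xi_nu_region \<longleftrightarrow> p = (0, 0) \<or> B \<or> S"
      unfolding p B_def S_def prod.inject by (rule frontier_xi_nu_region_iff)
    moreover have "B \<Longrightarrow> A"
      unfolding A_def B_def by (auto simp: abs_if split: if_splits)
    moreover have "S \<Longrightarrow> \<not> A"
      using Xi_bounds(2) unfolding A_def S_def by force
    moreover have "S \<Longrightarrow> p \<noteq> (0, 0)"
      by (simp add: S_def p)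
    moreover have "p \<in> {(1, y) |y. -1 \<le> y \<and> y \<le> 1} \<longleftrightarrow> S"
      by (auto simp: p S_def)
    ultimately show "p \<in> frontier xi_nu_region - (upper_branch \<union> lower_branch \<union> {(0, 0)}) \<longleftrightarrow>
        p \<in> {(1, y) |y. -1 \<le> y \<and> y \<le> 1}"
      unfolding Diff_iff Un_iff singleton_iff by argo
  qed
  show "copula (C_fam 1)" by (rule copula_C_fam) simp
  \<comment> \<open>For b = 1 the slope 1 / b is 1, so the maximised functional is \<nu> - \<xi>
    itself.\<close>
  show "blest_nu C - chatterjee_xi C \<le> blest_nu (C_fam 1) - chatterjee_xi (C_fam 1)" if "copula C" for C
    using C_fam_optimal(1)[of 1, OF _ that] by simp
qed

end
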